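(* Write $L=\log\log x$. For any fixed integer $\ell\ge 1$ and any integer $k\ge 0$ with $k\ll L$ we have \[\sum_{\substack{n\le x\\ \omega^*(n)=k}}\binom{r_{\mathcal{R}}^*(n)}{\ell}\ll_\ell\frac{xL^{O_\ell(1)}}{(\sqrt{\log x})^{\ell+1}}\cdot\frac{(2^{\ell-1}L)^k}{k!}.\] That is: for every integer $\ell\ge 1$ and every $C>0$ there are constants $K,A,x_0>0$, depending only on $\ell$ and $C$, such that for all $x\ge x_0$ and all integers $0\le k\le C\log\log x$, the left-hand side is at most $K\,\dfrac{x(\log\log x)^{A}}{(\log x)^{(\ell+1)/2}}\cdot\dfrac{(2^{\ell-1}\log\log x)^k}{k!}$.
   Context: The sum is over positive integers $n\le x$. For a positive integer $n$, $\omega^*(n)$ denotes the number of distinct odd prime factors of $n$. $\mathcal{R}$ is the set of positive integers $k$ which can be written as a sum of two squares, i.e. $k=a^2+b^2$ with integers $a\ge 0$, $b\ge 1$. For a set $S$ of positive integers, $r_S^*(n):=\#\{(a,b)\in\mathbb{Z}_{\ge 0}\times S:\ a^2+b^2=n,\ \gcd(a,b)=1\}$. So $r_{\mathcal{R}}^*(n)$ counts the representations of $n$ as $a^2+b^2$ with $a\ge 0$ an integer, $b\in\mathcal{R}$, and $\gcd(a,b)=1$. The logarithm is natural. *)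

theory Defs
  imports Complex_Main "HOL-Computational_Algebra.Primes"
begin

definition omega_star :: "nat \<Rightarrow> nat" where
  "omega_star n = card {p \<in> prime_factors n. odd p}"

(* As b >= 1, every member is positive. *)
definition sums_two_squares :: "nat set" where
  "sums_two_squares = {k. \<exists>a b :: nat. b \<ge> 1 \<and> k = a\<^sup>2 + b\<^sup>2}"

(* S is meant to be a set of positive integers. The counted set is always finite
   (a, b <= n), so card is the true cardinality. *)
definition r_star :: "nat set \<Rightarrow> nat \<Rightarrow> nat" where
  "r_star S n = card {(a, b). b \<in> S \<and> a\<^sup>2 + b\<^sup>2 = n \<and> gcd a b = 1}"

end

theory Submission
  imports Defs "HOL-Number_Theory.Number_Theory" "HOL-Real_Asymp.Real_Asymp"
    "HOL-Analysis.Summation_Tests" "HOL-Library.Discrete_Functions"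
begin

text \<open>
  Write \<open>L = log log x\<close>. An integer \<open>n \<le> x\<close> with \<open>\<omega>\<^sup>*(n) = k \<lless> L\<close> that has a primitive representation and
  exceeds \<open>\<surd>x\<close> has a prime power divisor larger than \<open>y = x\<^bsup>1/(4CL)\<^esup>\<close>; up to a negligible set of \<open>n\<close> divisible
  by a large square, this is a prime \<open>p\<close> dividing \<open>n = m p\<close> exactly once. Writing \<open>p = u\<^sup>2 + v\<^sup>2\<close>, every
  representation of \<open>n\<close> arises from a primitive representation \<open>m = s\<^sup>2 + t\<^sup>2\<close> with \<open>b = s u + t v\<close>. So an
  \<open>l\<close>-subset of representations of \<open>n\<close> gives \<open>l\<close> pairwise independent linear forms in \<open>(u, v)\<close>, all taking
  values that are sums of two squares, while \<open>u\<^sup>2 + v\<^sup>2\<close> has no small prime factor.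

  For fixed \<open>m\<close>, forms and \<open>v\<close> this is a one-dimensional sieve in \<open>u\<close>: a prime \<open>q \<equiv> 1\<close> mod 4 excludes two
  classes, and a prime \<open>q \<equiv> 3\<close> mod 4 excludes, for each form, the \<open>u\<close> where \<open>q\<close> divides the form exactly once.
  A form with \<open>s = 0\<close> does not depend on \<open>u\<close>; there is at most one, and discarding one form still leaves
  sieve dimension \<open>(l + 1)/2\<close>, which is all that is claimed. Brun's pure sieve loses only powers of \<open>L\<close>,
  and so does ignoring the primes that divide \<open>v\<close>, some \<open>s\<close> or some determinant of two forms.
  There are at most \<open>4 \<cdot> 2\<^bsup>k-1\<^esup>\<close> forms for each \<open>m\<close>, and the sum of \<open>1/m\<close> is \<open>O((L/2)\<^bsup>k-1\<^esup>/(k-1)!)\<close>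
  because all odd primes dividing \<open>m\<close> are 1 mod 4.
\<close>


section \<open>Mertens' theorem modulo 4\<close>

text \<open>Fixing \<open>v\<close> and sieving only in \<open>u\<close> replaces a two-dimensional
  lattice sieve by counting periodic sets in an interval. The trivial sum over \<open>v\<close>
  loses nothing, since both variables range up to sqrt(x/m), but the interval must be long against
  the sieve level for every \<open>m\<close>; this is what the large prime is for. Two scales
  provide it: \<open>w = x^(1/(24 C L))\<close>, up to which u^2 + v^2 has no prime factor, and
  \<open>y = w^6\<close>, the lower bound for \<open>p\<close>. Then x/m >= w^6 leaves room for the
  sieve; w^6 is the cube of w^2, so a prime power q^e > y with e >= 2 exactly dividing
  \<open>n\<close> yields d^2 dividing \<open>n\<close> with d >= w^2; and 2 y^k <= sqrt x for k <=
  C L and large \<open>x\<close>. The shape of the bound comes from (2^k)^l, for the choice of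
  forms, times (L/2)^k, for the sum over \<open>m\<close>: together (2^(l-1) L)^k. The sums of 1/p
  over the classes 1 and 3 mod 4 are needed only up to O(1), because they enter through an
  exponential and O(1) there costs a constant factor.\<close>

lemma abel_summation_bound:
  fixes a f :: "nat \<Rightarrow> real"
  assumes bd: "\<And>n. \<bar>\<Sum>i=m..n. a i\<bar> \<le> B"
    and dec: "\<And>n. n \<ge> m \<Longrightarrow> f (Suc n) \<le> f n"
    and nonneg: "\<And>n. n \<ge> m \<Longrightarrow> 0 \<le> f n"
  shows "\<bar>\<Sum>i=m..n. a i * f i\<bar> \<le> B * f m"
proof (cases "n \<ge> m")
  case False
  have "B \<ge> 0" using bd[of n] by linarith
  then show ?thesis using False nonneg[of m] by simp
next
  case True
  define S where "S n = (\<Sum>i=m..n. a i)" for n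
  \<comment> \<open>Subtracting the boundary term \<open>S n * f n\<close> leaves the increments
    \<open>S n * (f n - f (Suc n))\<close>, whose bounds telescope.\<close>
  have "\<bar>(\<Sum>i=m..n. a i * f i) - S n * f n\<bar> \<le> B * (f m - f n)"
    using True
  proof (induction n rule: dec_induct)
    case base
    then show ?case by (simp add: S_def)
  next
    case (step n)
    have "(\<Sum>i=m..Suc n. a i * f i) - S (Suc n) * f (Suc n)
        = ((\<Sum>i=m..n. a i * f i) - S n * f n) + S n * (f n - f (Suc n))"
      using step.hyps by (simp add: S_def algebra_simps)
    moreover have "\<bar>S n * (f n - f (Suc n))\<bar> \<le> B * (f n - f (Suc n))"
      using bd[of n] dec[of n] step.hyps by (auto simp: abs_mult S_def intro!: mult_right_mono)
    ultimately show ?case using step.IH by (simp add: algebra_simps)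
  qed
  moreover have "\<bar>S n * f n\<bar> \<le> B * f n"
    using bd[of n] nonneg[of n] True by (auto simp: abs_mult S_def intro!: mult_right_mono)
  ultimately show ?thesis by (simp add: algebra_simps)
qed

section \<open>The nonprincipal character modulo 4 and its L-series at 1\<close>

definition chi4 :: "nat \<Rightarrow> real" where
  "chi4 n = (if n mod 4 = 1 then 1 else if n mod 4 = 3 then -1 else 0)"

lemma chi4_mult: "chi4 (m * n) = chi4 m * chi4 n"
proof -
  have "m mod 4 \<in> {0,1,2,3}" "n mod 4 \<in> {0,1,2,3}" by auto
  then show ?thesis
    unfolding chi4_def mod_mult_eq[of m 4 n, symmetric] by auto
qed

lemma abs_chi4_le: "\<bar>chi4 n\<bar> \<le> 1"
  by (auto simp: chi4_def)

lemma sum_chi4_atMost: "(\<Sum>i\<le>n. chi4 i) = (if n mod 4 \<in> {1,2} then 1 else 0)"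
proof (induction n)
  case 0
  then show ?case by (simp add: chi4_def)
next
  case (Suc n)
  have "n mod 4 \<in> {0,1,2,3}" by auto
  then show ?case using Suc by (auto simp: chi4_def mod_Suc)
qed

lemma sum_chi4_bounded: "\<bar>\<Sum>i=m..n. chi4 i\<bar> \<le> 1"
proof (cases m)
  case 0
  then have "{m..n} = {..n}" by auto
  then show ?thesis by (simp add: sum_chi4_atMost)
next
  case (Suc k)
  show ?thesis
  proof (cases "m \<le> n")
    case True
    have "{..n} = {..k} \<union> {m..n}" using Suc True by auto
    then have "(\<Sum>i\<le>n. chi4 i) = (\<Sum>i\<le>k. chi4 i) + (\<Sum>i=m..n. chi4 i)"
      using Suc by (simp only:) (subst sum.union_disjoint, auto)
    then show ?thesis by (auto simp: sum_chi4_atMost split: if_splits)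
  qed auto
qed

text \<open>Partial sums of the Leibniz series 1 - 1/3 + 1/5 - ..., written as products so that Abel
  summation applies directly.\<close>

definition sum_chi4_over :: "nat \<Rightarrow> real" where
  "sum_chi4_over n = (\<Sum>i=1..n. chi4 i * (1 / real i))"

lemma sum_chi4_over_diff:
  assumes "m \<le> n" "m \<ge> 1"
  shows "\<bar>sum_chi4_over n - sum_chi4_over m\<bar> \<le> 1 / real m"
proof -
  have "{1..n} = {1..m} \<union> {Suc m..n}" using assms by auto
  then have "sum_chi4_over n = sum_chi4_over m + (\<Sum>i=Suc m..n. chi4 i * (1 / real i))"
    unfolding sum_chi4_over_def by (simp only:) (subst sum.union_disjoint, auto)
  moreover have "\<bar>\<Sum>i=Suc m..n. chi4 i * (1 / real i)\<bar> \<le> 1 * (1 / real (Suc m))"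
    by (rule abel_summation_bound) (auto intro: sum_chi4_bounded simp: field_simps)
  moreover have "1 / real (Suc m) \<le> 1 / real m" using assms by (simp add: field_simps)
  ultimately show ?thesis by simp
qed

text \<open>An explicit form of L(1, \<chi>) being nonzero: the first term is 1, the second
  vanishes, and the terms from 3 on add up to at most 1/3 in absolute value. This is what makes the
  two odd residue classes modulo 4 equally rich in primes.\<close>

lemma sum_chi4_over_ge:
  assumes "n \<ge> 1"
  shows "sum_chi4_over n \<ge> 2 / 3"
proof (cases "n \<ge> 3")
  case True
  have e: "{1..n} = {1} \<union> {2..n}" using True by auto
  have "sum_chi4_over n = 1 + (\<Sum>i=2..n. chi4 i * (1 / real i))"
    unfolding sum_chi4_over_def e by (subst sum.union_disjoint) (auto simp: chi4_def)
  also have "(\<Sum>i=2..n. chi4 i * (1 / real i)) = (\<Sum>i=3..n. chi4 i * (1 / real i))"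
  proof (rule sum.mono_neutral_right)
    have "i = 2" if "i \<in> {2..n} - {3..n}" for i using that by auto
    then show "\<forall>i\<in>{2..n} - {3..n}. chi4 i * (1 / real i) = 0" by (auto simp: chi4_def)
  qed auto
  finally have "sum_chi4_over n = 1 + (\<Sum>i=3..n. chi4 i * (1 / real i))" .
  moreover have "\<bar>\<Sum>i=3..n. chi4 i * (1 / real i)\<bar> \<le> 1 * (1 / real 3)"
    by (rule abel_summation_bound) (auto intro: sum_chi4_bounded simp: field_simps)
  ultimately show ?thesis by simp
next
  case False
  then have "n = 1 \<or> n = 2" using assms by auto
  then show ?thesis
  proof
    assume "n = 2"
    then have "{1..n} = {1, 2}" by auto
    then show ?thesis by (simp add: sum_chi4_over_def chi4_def)
  qed (simp add: sum_chi4_over_def chi4_def)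
qed

section \<open>Chebyshev's upper bound and Mertens' first theorem\<close>

lemma sum_divisors_swap:
  fixes F :: "nat \<Rightarrow> nat \<Rightarrow> real"
  shows "(\<Sum>n=1..N. \<Sum>d | d dvd n. F d (n div d)) = (\<Sum>d=1..N. \<Sum>e=1..N div d. F d e)"
proof -
  have "(\<Sum>n=1..N. \<Sum>d | d dvd n. F d (n div d))
      = (\<Sum>(n, d)\<in>(SIGMA n:{1..N}. {d. d dvd n}). F d (n div d))"
    by (subst sum.Sigma) auto
  also have "\<dots> = (\<Sum>(d, e)\<in>(SIGMA d:{1..N}. {1..N div d}). F d e)"
    by (rule sum.reindex_bij_witness[of _ "\<lambda>(d, e). (d * e, d)" "\<lambda>(n, d). (d, n div d)"])
      (auto simp: less_eq_div_iff_mult_less_eq Suc_le_eq div_greater_zero_iff dvd_imp_le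
         mult.commute intro: le_trans[OF dvd_imp_le] div_le_mono dvd_pos_nat)
  also have "\<dots> = (\<Sum>d=1..N. \<Sum>e=1..N div d. F d e)"
    by (subst sum.Sigma) auto
  finally show ?thesis .
qed

lemma sum_ln_eq_mangoldt:
  "(\<Sum>n=1..N. ln (real n)) = (\<Sum>d=1..N. mangoldt d * real (N div d))"
proof -
  have "(\<Sum>n=1..N. ln (real n)) = (\<Sum>n=1..N. \<Sum>d | d dvd n. mangoldt d)"
    by (intro sum.cong) (auto simp: mangoldt_sum)
  also have "\<dots> = (\<Sum>d=1..N. \<Sum>e=1..N div d. mangoldt d)"
    by (rule sum_divisors_swap)
  finally show ?thesis by (simp add: mult.commute)
qed

lemma sum_ln_eq_ln_fact: "(\<Sum>n=1..N. ln (real n)) = ln (fact N)"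
  by (induction N) (auto simp: ln_mult)

definition psi :: "nat \<Rightarrow> real" where
  "psi n = (\<Sum>d=1..n. mangoldt d)"

lemma psi_mono: "m \<le> n \<Longrightarrow> psi m \<le> psi n"
  unfolding psi_def by (intro sum_mono2) (auto simp: mangoldt_nonneg)

text \<open>Chebyshev's argument: the logarithm of the central binomial coefficient is the sum of
  \<Lambda>(d) times (2N div d) - 2 (N div d). These brackets are nonnegative, and at least 1 for N
  < d <= 2N, while the coefficient is at most 4^N.\<close>

lemma psi_double: "psi (2 * N) - psi N \<le> 2 * real N * ln 2"
proof -
  have split: "(\<Sum>d=1..N. mangoldt d * real (N div d)) = (\<Sum>d=1..2*N. mangoldt d * real (N div d))"
    by (rule sum.mono_neutral_left) auto
  have e: "{1..2*N} = {1..N} \<union> {Suc N..2*N}" by auto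
  have "psi (2 * N) - psi N = (\<Sum>d=Suc N..2*N. mangoldt d)"
    unfolding psi_def e by (subst sum.union_disjoint) auto
  also have "\<dots> \<le> (\<Sum>d=Suc N..2*N. mangoldt d * (real (2 * N div d) - 2 * real (N div d)))"
  proof (rule sum_mono)
    fix d assume d: "d \<in> {Suc N..2*N}"
    then have "N div d = 0" by auto
    moreover have "2 * N div d \<ge> 1" using d by (simp add: Suc_le_eq div_greater_zero_iff)
    ultimately show "mangoldt d \<le> mangoldt d * (real (2 * N div d) - 2 * real (N div d))"
      using mangoldt_nonneg[of d] by (simp add: mult_le_cancel_left1)
  qed
  also have "\<dots> \<le> (\<Sum>d=1..2*N. mangoldt d * (real (2 * N div d) - 2 * real (N div d)))"
  proof (rule sum_mono2)
    fix d
    have "2 * (N div d) \<le> 2 * N div d"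
      by (cases "d = 0") (auto simp: less_eq_div_iff_mult_less_eq)
    then have "real (2 * N div d) - 2 * real (N div d) \<ge> 0" by linarith
    then show "0 \<le> mangoldt d * (real (2 * N div d) - 2 * real (N div d))"
      using mangoldt_nonneg by simp
  qed auto
  also have "\<dots> = ln (fact (2 * N)) - 2 * ln (fact N)"
    unfolding sum_ln_eq_ln_fact[symmetric] sum_ln_eq_mangoldt split
    by (simp add: sum_subtractf sum_distrib_left algebra_simps)
  also have "\<dots> = ln (real ((2 * N) choose N))"
    by (simp add: binomial_fact ln_div ln_mult)
  also have "\<dots> \<le> ln (2 ^ (2 * N))"
  proof (rule ln_mono)
    have "real ((2 * N) choose N) \<le> real (2 ^ (2 * N))"
      by (intro of_nat_mono binomial_le_pow2)
    then show "real ((2 * N) choose N) \<le> 2 ^ (2 * N)" by simp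
  qed simp
  finally show ?thesis by (simp add: ln_realpow)
qed

lemma psi_power_two: "psi (2 ^ j) \<le> 2 * 2 ^ j * ln 2"
proof (induction j)
  case 0
  then show ?case by (simp add: psi_def)
next
  case (Suc j)
  show ?case using psi_double[of "2 ^ j"] Suc by simp
qed

lemma psi_le: "psi n \<le> 4 * ln 2 * real n"
proof (cases "n = 0")
  case False
  then obtain j where j: "2 ^ j \<le> n" "n < 2 ^ Suc j"
    using ex_power_ivl1[of 2 n] by auto
  have "psi n \<le> psi (2 ^ Suc j)" using j by (intro psi_mono) auto
  also have "\<dots> \<le> 2 * 2 ^ Suc j * ln 2" by (rule psi_power_two)
  also have "\<dots> = (4 * ln 2) * real (2 ^ j)" by simp
  also have "\<dots> \<le> (4 * ln 2) * real n" using j by (intro mult_left_mono) auto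
  finally show ?thesis .
qed (simp add: psi_def)

text \<open>The elementary half of Stirling's formula, which follows inductively from n (ln (n+1) -
  ln n) <= 1. It serves both Mertens' theorem and the truncation error of the sieve.\<close>

lemma ln_fact_ge: "ln (fact n) \<ge> real n * ln (real n) - real n"
proof (induction n)
  case (Suc n)
  show ?case
  proof (cases "n = 0")
    case False
    have "ln (real (Suc n) / real n) \<le> real (Suc n) / real n - 1"
      using False by (intro ln_le_minus_one) auto
    then have "real n * (ln (real (Suc n)) - ln (real n)) \<le> 1"
      using False by (simp add: ln_div field_simps)
    moreover have "ln (fact (Suc n) :: real) = ln (real (Suc n)) + ln (fact n)"
      unfolding fact_Suc by (subst ln_mult_pos) auto
    ultimately show ?thesis using Suc by (simp add: algebra_simps)
  qed simp
qed simp

lemma ln_fact_le: "ln (fact n) \<le> real n * ln (real n)"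
proof -
  have "ln (fact n :: real) \<le> ln (real n ^ n)"
    using fact_le_power[of n, where 'a = real] by (intro ln_mono) auto
  then show ?thesis by (cases "n = 0") (auto simp: ln_realpow)
qed

text \<open>\<open>ln (fact N)\<close> is the sum of \<Lambda>(d) (N div d). Replacing N div d by
  N/d changes it by at most \<open>psi N\<close>, which Chebyshev's bound makes O(N); dividing by N
  gives the claim, with 4 ln 2 <= 4.\<close>

lemma sum_mangoldt_over:
  assumes "N \<ge> 1"
  shows "\<bar>(\<Sum>d=1..N. mangoldt d / real d) - ln (real N)\<bar> \<le> 4"
proof -
  have id: "real N * (\<Sum>d=1..N. mangoldt d / real d) = (\<Sum>d=1..N. mangoldt d * (real N / real d))"
    by (simp add: sum_distrib_left field_simps)
  have le: "real (N div d) \<le> real N / real d" for d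
    by (rule of_nat_div_le_of_nat)
  have ge: "real N / real d \<le> real (N div d) + 1" if "d \<ge> 1" for d
  proof -
    have "N < d * Suc (N div d)" using that
      by (metis dividend_less_times_div less_le_trans mult_Suc_right zero_less_one)
    then have "real N < real d * real (Suc (N div d))" by (metis of_nat_less_iff of_nat_mult)
    then show ?thesis using that by (simp add: field_simps)
  qed
  have "(\<Sum>d=1..N. mangoldt d * (real N / real d)) \<ge> (\<Sum>d=1..N. mangoldt d * real (N div d))"
    by (intro sum_mono mult_left_mono le mangoldt_nonneg)
  then have lo: "real N * (\<Sum>d=1..N. mangoldt d / real d) \<ge> real N * ln (real N) - real N"
    using ln_fact_ge[of N] unfolding id sum_ln_eq_mangoldt[symmetric] sum_ln_eq_ln_fact by linarith
  have "(\<Sum>d=1..N. mangoldt d * (real N / real d)) \<le> (\<Sum>d=1..N. mangoldt d * (real (N div d) + 1))"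
    by (intro sum_mono mult_left_mono ge mangoldt_nonneg) auto
  also have "\<dots> = ln (fact N) + psi N"
    unfolding sum_ln_eq_ln_fact[symmetric] sum_ln_eq_mangoldt
    by (simp add: algebra_simps sum.distrib psi_def)
  also have "\<dots> \<le> real N * ln (real N) + 4 * ln 2 * real N"
    using ln_fact_le[of N] psi_le[of N] by linarith
  finally have hi: "real N * (\<Sum>d=1..N. mangoldt d / real d) \<le> real N * ln (real N) + 4 * ln 2 * real N"
    unfolding id .
  have "ln (2::real) \<le> 1" using ln_le_minus_one[of "2::real"] by simp
  then have "real N * (ln 2 * 4) \<le> real N * 4" by (intro mult_left_mono) auto
  then have hi': "real N * (\<Sum>d=1..N. mangoldt d / real d) \<le> real N * (ln (real N) + 4)"
    using hi by (simp add: algebra_simps)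
  have lo': "real N * (\<Sum>d=1..N. mangoldt d / real d) \<ge> real N * (ln (real N) - 4)"
    using lo by (simp add: algebra_simps)
  show ?thesis using hi' lo' assms by (simp add: abs_le_iff)
qed

definition prime_ln :: "nat \<Rightarrow> real" where
  "prime_ln n = (if prime n then ln (real n) else 0)"

lemma prime_ln_le_mangoldt: "prime_ln n \<le> mangoldt n"
  by (auto simp: prime_ln_def mangoldt_nonneg)

lemma summable_ln_over_square: "summable (\<lambda>n. ln (real n) / real n ^ 2)"
proof (rule summable_comparison_test_bigo)
  show "summable (\<lambda>n. norm (real n powr (-3/2)))"
    by (simp add: summable_real_powr_iff)
  show "(\<lambda>n. ln (real n) / real n ^ 2) \<in> O(\<lambda>n. real n powr (-3/2))"
    by real_asymp
qed

lemma sum_inverse_powers_le: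
  fixes p :: real
  assumes "p > 1"
  shows "(\<Sum>k=1..N. 1 / p ^ k) \<le> 1 / (p - 1)"
proof -
  have "(\<Sum>k=1..N. 1 / p ^ k) = (1 - 1 / p ^ N) / (p - 1)"
  proof (induction N)
    case (Suc N)
    have "(1 - 1 / q) / (p - 1) + 1 / (p * q) = (1 - 1 / (p * q)) / (p - 1)" if "q > 0" for q
      using assms that by (simp add: field_simps)
    from this[of "p ^ N"] show ?case using Suc assms by simp
  qed simp
  also have "\<dots> \<le> 1 / (p - 1)" using assms by (intro divide_right_mono) auto
  finally show ?thesis .
qed

text \<open>A prime power that is not prime is p^(k+1) with k >= 1. The geometric series over
  \<open>k\<close> leaves at most 2 ln p / p^2, and the series of ln n / n^2 converges.\<close>

lemma mangoldt_minus_prime_ln_bounded: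
  "\<exists>c. \<forall>N. (\<Sum>d=1..N. (mangoldt d - prime_ln d) / real d) \<le> c"
proof (intro exI allI)
  fix N :: nat
  let ?Q = "{d\<in>{1..N}. primepow d \<and> \<not> prime d}"
  let ?P = "{p. prime p \<and> p \<le> N}"
  have finP: "finite ?P" by (rule finite_subset[of _ "{..N}"]) auto
  have "(\<Sum>d=1..N. (mangoldt d - prime_ln d) / real d) = (\<Sum>d\<in>?Q. (mangoldt d - prime_ln d) / real d)"
    by (rule sum.mono_neutral_right) (auto simp: prime_ln_def mangoldt_def)
  also have "\<dots> \<le> (\<Sum>(p, k)\<in>?P \<times> {1..N}. ln (real p) / real p * (1 / real p ^ k))"
  proof (rule sum_le_included[where i = "\<lambda>(p, k). p ^ Suc k"])
    show "\<forall>y\<in>?P \<times> {1..N}. 0 \<le> (case y of (p, k) \<Rightarrow> ln (real p) / real p * (1 / real p ^ k))"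
      by (auto intro!: divide_nonneg_nonneg ln_ge_zero simp: Suc_le_eq prime_gt_0_nat)
    show "\<forall>d\<in>?Q. \<exists>y\<in>?P \<times> {1..N}. (case y of (p, k) \<Rightarrow> p ^ Suc k) = d \<and>
        (mangoldt d - prime_ln d) / real d \<le> (case y of (p, k) \<Rightarrow> ln (real p) / real p * (1 / real p ^ k))"
    proof
      fix d assume d: "d \<in> ?Q"
      then obtain p j where pj: "prime p" "j > 0" "d = p ^ j" by (auto simp: primepow_def)
      then obtain k where k: "j = Suc k" by (cases j) auto
      have "k > 0" using d pj k by (cases k) auto
      have p2: "p \<ge> 2" using pj prime_ge_2_nat by auto
      have "k < p ^ k" using p2 by (intro power_gt_expt) auto
      also have "p ^ k \<le> p ^ j" using p2 k by (intro power_increasing) auto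
      finally have "k \<le> N" using d pj by auto
      moreover have "p \<le> N"
        using d pj p2 self_le_power[of p j] by auto
      moreover have "(mangoldt d - prime_ln d) / real d \<le> ln (real p) / real p * (1 / real p ^ k)"
      proof -
        have "mangoldt d = ln (real p)" using pj by simp
        moreover have "prime_ln d = 0" using d by (simp add: prime_ln_def)
        ultimately show ?thesis using pj k by simp
      qed
      ultimately show "\<exists>y\<in>?P \<times> {1..N}. (case y of (p, k) \<Rightarrow> p ^ Suc k) = d \<and>
        (mangoldt d - prime_ln d) / real d \<le> (case y of (p, k) \<Rightarrow> ln (real p) / real p * (1 / real p ^ k))"
        using pj k \<open>k > 0\<close> by (intro bexI[of _ "(p, k)"]) auto
    qed
  qed (use finP in auto)
  also have "\<dots> = (\<Sum>p\<in>?P. ln (real p) / real p * (\<Sum>k=1..N. 1 / real p ^ k))"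
    by (subst sum.cartesian_product[symmetric]) (simp add: sum_distrib_left)
  also have "\<dots> \<le> (\<Sum>p\<in>?P. ln (real p) / real p * (2 / real p))"
  proof (intro sum_mono mult_left_mono)
    fix p assume "p \<in> ?P"
    then have p2: "real p \<ge> 2" using prime_ge_2_nat[of p] by simp
    have "(\<Sum>k=1..N. 1 / real p ^ k) \<le> 1 / (real p - 1)"
      using p2 by (intro sum_inverse_powers_le) auto
    also have "\<dots> \<le> 2 / real p" using p2 by (simp add: field_simps)
    finally show "(\<Sum>k=1..N. 1 / real p ^ k) \<le> 2 / real p" .
    show "0 \<le> ln (real p) / real p" using p2 by simp
  qed
  also have "\<dots> = 2 * (\<Sum>p\<in>?P. ln (real p) / real p ^ 2)"
    by (simp add: sum_distrib_left power2_eq_square field_simps)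
  also have "\<dots> \<le> 2 * (\<Sum>n. ln (real n) / real n ^ 2)"
  proof -
    have "0 \<le> ln (real n) / real n ^ 2" for n by (cases "n = 0") auto
    then show ?thesis by (intro mult_left_mono sum_le_suminf summable_ln_over_square finP) auto
  qed
  finally show "(\<Sum>d=1..N. (mangoldt d - prime_ln d) / real d) \<le> 2 * (\<Sum>n. ln (real n) / real n ^ 2)" .
qed

lemma ln_over_decreasing:
  assumes "n \<ge> 3"
  shows "ln (real (Suc n)) / real (Suc n) \<le> ln (real n) / real n"
proof -
  have "exp 1 \<le> (3::real)" by (rule exp_le)
  then have "1 \<le> ln (3::real)" by (simp add: ln_ge_iff)
  also have "\<dots> \<le> ln (real n)" using assms by simp
  finally have 1: "1 \<le> ln (real n)" .
  have "ln (real (Suc n) / real n) \<le> real (Suc n) / real n - 1"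
    using assms by (intro ln_le_minus_one) auto
  then have "real n * (ln (real (Suc n)) - ln (real n)) \<le> 1"
    using assms by (simp add: ln_div field_simps)
  then show ?thesis using 1 assms by (simp add: field_simps)
qed

text \<open>
  With \<open>ln = \<Lambda> * 1\<close>, the bounded sum of \<open>\<chi>(n) ln n / n\<close> is the sum of \<open>\<chi>(d) \<Lambda>(d) / d\<close> times the partial
  sum of \<open>\<chi>(e) / e\<close> up to \<open>N/d\<close>. The latter can be replaced by the one up to \<open>N\<close>, which stays away from 0.
\<close>

lemma sum_chi4_mangoldt_bounded:
  assumes "N \<ge> 1"
  shows "\<bar>\<Sum>d=1..N. chi4 d * mangoldt d / real d\<bar> \<le> 20"
proof -
  define G where "G = (\<Sum>d=1..N. chi4 d * mangoldt d / real d)"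
  have conv: "(\<Sum>n=1..N. chi4 n * (ln (real n) / real n))
      = (\<Sum>d=1..N. chi4 d * mangoldt d / real d * sum_chi4_over (N div d))"
  proof -
    have "(\<Sum>n=1..N. chi4 n * (ln (real n) / real n))
        = (\<Sum>n=1..N. \<Sum>d | d dvd n. chi4 d * mangoldt d / real d * (chi4 (n div d) * (1 / real (n div d))))"
    proof (rule sum.cong)
      fix n assume n: "n \<in> {1..N}"
      then have "chi4 n * (ln (real n) / real n) = (\<Sum>d | d dvd n. chi4 n * mangoldt d / real n)"
        using mangoldt_sum[of n, where 'a = real] n
        by (simp flip: sum_distrib_left sum_divide_distrib)
      also have "\<dots> = (\<Sum>d | d dvd n. chi4 d * mangoldt d / real d * (chi4 (n div d) * (1 / real (n div d))))"
        using n by (intro sum.cong) (auto simp: chi4_mult elim!: dvdE)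
      finally show "chi4 n * (ln (real n) / real n) = \<dots>" .
    qed auto
    also have "\<dots> = (\<Sum>d=1..N. \<Sum>e=1..N div d. chi4 d * mangoldt d / real d * (chi4 e * (1 / real e)))"
      by (rule sum_divisors_swap)
    finally show ?thesis by (simp add: sum_chi4_over_def sum_distrib_left)
  qed
  have "\<bar>\<Sum>n=1..N. chi4 n * (ln (real n) / real n)\<bar> \<le> 1"
  proof -
    \<comment> \<open>The terms at 1 and 2 vanish, and ln n / n decreases only from 3 on.\<close>
    have "(\<Sum>n=1..N. chi4 n * (ln (real n) / real n)) = (\<Sum>n=3..N. chi4 n * (ln (real n) / real n))"
    proof (rule sum.mono_neutral_right)
      have "i = 1 \<or> i = 2" if "i \<in> {1..N} - {3..N}" for i using that by auto
      then show "\<forall>i\<in>{1..N} - {3..N}. chi4 i * (ln (real i) / real i) = 0"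
        by (fastforce simp: chi4_def)
    qed auto
    moreover have "\<bar>\<Sum>n=3..N. chi4 n * (ln (real n) / real n)\<bar> \<le> 1 * (ln (real 3) / real 3)"
      by (rule abel_summation_bound) (auto intro: sum_chi4_bounded ln_over_decreasing[simplified])
    moreover have "ln 3 \<le> (3::real)" using ln_le_minus_one[of "3::real"] by simp
    ultimately show ?thesis by simp
  qed
  \<comment> \<open>The tail of the Leibniz series beyond N div d is at most 2d/N. This cancels the
    denominator \<open>d\<close>, so the total error is at most (2/N) \<open>psi N\<close>, bounded
    by Chebyshev.\<close>
  moreover have "\<bar>\<Sum>d=1..N. chi4 d * mangoldt d / real d * (sum_chi4_over N - sum_chi4_over (N div d))\<bar> \<le> 8"
  proof -
    have "\<bar>\<Sum>d=1..N. chi4 d * mangoldt d / real d * (sum_chi4_over N - sum_chi4_over (N div d))\<bar>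
        \<le> (\<Sum>d=1..N. mangoldt d * (2 / real N))"
    proof (rule order_trans[OF sum_abs], rule sum_mono)
      fix d assume d: "d \<in> {1..N}"
      then have q1: "N div d \<ge> 1" by (simp add: Suc_le_eq div_greater_zero_iff)
      have "\<bar>sum_chi4_over N - sum_chi4_over (N div d)\<bar> \<le> 1 / real (N div d)"
        using q1 by (intro sum_chi4_over_diff) auto
      also have "\<dots> \<le> 2 * real d / real N"
      proof -
        have "N < d * Suc (N div d)" using d
          by (metis atLeastAtMost_iff dividend_less_times_div less_le_trans mult_Suc_right zero_less_one)
        also have "\<dots> \<le> d * (2 * (N div d))" using q1 by (intro mult_left_mono) auto
        finally have "real N \<le> real d * (2 * real (N div d))"
          by (metis less_imp_le of_nat_le_iff of_nat_mult of_nat_numeral)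
        then show ?thesis using q1 d by (simp add: field_simps)
      qed
      finally have b: "\<bar>sum_chi4_over N - sum_chi4_over (N div d)\<bar> \<le> 2 * real d / real N" .
      have "\<bar>chi4 d * mangoldt d / real d * (sum_chi4_over N - sum_chi4_over (N div d))\<bar>
          = \<bar>chi4 d\<bar> * (mangoldt d / real d * \<bar>sum_chi4_over N - sum_chi4_over (N div d)\<bar>)"
        by (simp add: abs_mult)
      also have "\<dots> \<le> 1 * (mangoldt d / real d * (2 * real d / real N))"
        using b abs_chi4_le[of d] mangoldt_nonneg[of d]
        by (intro mult_mono mult_left_mono) auto
      finally show "\<bar>chi4 d * mangoldt d / real d * (sum_chi4_over N - sum_chi4_over (N div d))\<bar> \<le> mangoldt d * (2 / real N)"
        using d by simp
    qed
    also have "\<dots> = psi N * (2 / real N)" unfolding psi_def sum_distrib_right ..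
    also have "\<dots> \<le> (4 * ln 2 * real N) * (2 / real N)" by (intro mult_right_mono psi_le) auto
    also have "\<dots> \<le> 8" using assms ln_le_minus_one[of "2::real"] by simp
    finally show ?thesis .
  qed
  moreover have "G * sum_chi4_over N = (\<Sum>n=1..N. chi4 n * (ln (real n) / real n))
      + (\<Sum>d=1..N. chi4 d * mangoldt d / real d * (sum_chi4_over N - sum_chi4_over (N div d)))"
    unfolding conv G_def by (simp add: sum_distrib_right right_diff_distrib sum_subtractf)
  ultimately have "\<bar>G * sum_chi4_over N\<bar> \<le> 9" by linarith
  then have 9: "\<bar>G\<bar> * sum_chi4_over N \<le> 9" using sum_chi4_over_ge[OF assms] by (simp add: abs_mult)
  have "\<bar>G\<bar> * (2 / 3) \<le> \<bar>G\<bar> * sum_chi4_over N" using sum_chi4_over_ge[OF assms] by (intro mult_left_mono) auto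
  with 9 show ?thesis by (simp add: G_def)
qed

section \<open>Removing the weight ln p: sums of reciprocals of primes\<close>

lemma abel_inverse_ln:
  fixes a :: "nat \<Rightarrow> real"
  assumes bd: "\<And>n. \<bar>\<Sum>i=2..n. a i\<bar> \<le> B"
  shows "\<bar>\<Sum>i=2..n. a i / ln (real i)\<bar> \<le> B * (1 / ln 2)"
proof -
  have "\<bar>\<Sum>i=2..n. a i * (1 / ln (real i))\<bar> \<le> B * (1 / ln (real 2))"
    by (rule abel_summation_bound) (use bd in \<open>auto intro!: divide_left_mono\<close>)
  then show ?thesis by simp
qed

lemma sum_from_2: "f 1 = 0 \<Longrightarrow> (\<Sum>i=2..n. f i) = (\<Sum>i=1..n. f i)" for f :: "nat \<Rightarrow> real"
proof (rule sum.mono_neutral_left)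
  assume "f 1 = 0"
  moreover have "i = 1" if "i \<in> {1..n} - {2..n}" for i using that by auto
  ultimately show "\<forall>i\<in>{1..n} - {2..n}. f i = 0" by blast
qed auto

text \<open>Passing from \<Lambda> to primes costs a convergent sum, and Abel summation against 1 /
  ln i then removes the weight. The sums start at 2 because ln 1 = 0.\<close>

lemma sum_prime_chi4_bounded:
  "\<exists>c. \<forall>N. \<bar>\<Sum>p | prime p \<and> p \<le> N. chi4 p / real p\<bar> \<le> c"
proof -
  obtain c where c: "\<And>N. (\<Sum>d=1..N. (mangoldt d - prime_ln d) / real d) \<le> c"
    using mangoldt_minus_prime_ln_bounded by blast
  have *: "\<bar>\<Sum>d=2..N. chi4 d * prime_ln d / real d\<bar> \<le> 20 + c" for N
  proof (cases "N = 0")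
    case True
    then show ?thesis using c[of 0] by simp
  next
    case False
    have "(\<Sum>d=2..N. chi4 d * prime_ln d / real d) = (\<Sum>d=1..N. chi4 d * prime_ln d / real d)"
      by (rule sum_from_2) (simp add: prime_ln_def)
    also have "\<dots> = (\<Sum>d=1..N. chi4 d * mangoldt d / real d)
        - (\<Sum>d=1..N. chi4 d * ((mangoldt d - prime_ln d) / real d))"
      by (simp add: sum_subtractf[symmetric] diff_divide_distrib right_diff_distrib)
    finally have "(\<Sum>d=2..N. chi4 d * prime_ln d / real d) = \<dots>" .
    moreover have "\<bar>\<Sum>d=1..N. chi4 d * ((mangoldt d - prime_ln d) / real d)\<bar> \<le> c"
    proof (rule order_trans[OF sum_abs order_trans[OF sum_mono c[of N]]])
      fix d
      define y where "y = (mangoldt d - prime_ln d) / real d"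
      have "0 \<le> y" using prime_ln_le_mangoldt[of d] by (simp add: y_def)
      then have "\<bar>chi4 d * y\<bar> \<le> y"
        using abs_chi4_le[of d] by (simp add: abs_mult mult_left_le_one_le)
      then show "\<bar>chi4 d * ((mangoldt d - prime_ln d) / real d)\<bar> \<le> (mangoldt d - prime_ln d) / real d"
        by (simp add: y_def)
    qed
    ultimately show ?thesis using sum_chi4_mangoldt_bounded[of N] False by linarith
  qed
  have "(\<Sum>i=2..N. (chi4 i * prime_ln i / real i) / ln (real i))
      = (\<Sum>p | prime p \<and> p \<le> N. chi4 p / real p)" for N
    by (rule sum.mono_neutral_cong_right) (auto simp: prime_ln_def prime_ge_2_nat dest: prime_gt_1_nat)
  then show ?thesis using abel_inverse_ln[OF *] by metis
qed

text \<open>A Riemann sum for the integral of d(ln t) / ln t. The increments of ln are the average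
  values of \<open>prime_ln d / d\<close> in Mertens' first theorem, so this evaluates the expected
  size of the sum of 1/p.\<close>

lemma sum_ln_increment_over_ln:
  assumes "N \<ge> 2"
  shows "\<bar>(\<Sum>i=2..N. (ln (real i) - ln (real (i - 1))) / ln (real i)) - ln (ln (real N))\<bar> \<le> 3"
proof -
  define d where "d i = ln (real i) - ln (real (i - 1))" for i
  define D where "D = (\<Sum>i=3..N. d i / ln (real i))"
  have l2: "ln (2::real) > 0" "ln (2::real) \<le> 1" "ln (2::real) \<ge> 1/2"
    using ln_le_minus_one[of "2::real"] ln_one_minus_pos_upper_bound[of "1/2::real"]
    by (auto simp: ln_div)
  \<comment> \<open>With a = ln n and b = ln (n+1), the difference ln b - ln a lies between (b-a)/b
    and (b-a)/a. These differ by at most 1/a - 1/b because b - a <= 1, and that error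
    telescopes.\<close>
  have up: "(\<Sum>i=3..N. d i / ln (real i)) \<le> ln (ln (real N)) - ln (ln 2)"
    and lo: "(\<Sum>i=3..N. d i / ln (real i)) \<ge> ln (ln (real N)) - ln (ln 2) - (1 / ln 2 - 1 / ln (real N))"
    using assms
  proof (induction N rule: dec_induct)
    case (step n)
    define a b where "a = ln (real n)" and "b = ln (real (Suc n))"
    have ab: "0 < a" "a < b" using step.hyps by (auto simp: a_def b_def)
    have "ln (a / b) \<le> a / b - 1" using ab by (intro ln_le_minus_one) auto
    then have low: "(b - a) / b \<le> ln b - ln a" using ab by (simp add: ln_div field_simps)
    have "ln (b / a) \<le> b / a - 1" using ab by (intro ln_le_minus_one) auto
    then have upp: "ln b - ln a \<le> (b - a) / a" using ab by (simp add: ln_div field_simps)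
    have "b - a = ln (real (Suc n) / real n)" using step.hyps by (simp add: a_def b_def ln_div)
    also have "\<dots> \<le> real (Suc n) / real n - 1" using step.hyps by (intro ln_le_minus_one) auto
    also have "\<dots> \<le> 1" using step.hyps by (simp add: field_simps)
    finally have "b - a \<le> 1" .
    then have "(b - a) * (1 / a - 1 / b) \<le> 1 * (1 / a - 1 / b)"
      using ab by (intro mult_right_mono) (auto simp: field_simps)
    then have dif: "(b - a) / a - (b - a) / b \<le> 1 / a - 1 / b"
      by (simp add: right_diff_distrib)
    have s: "(\<Sum>i=3..Suc n. d i / ln (real i)) = (\<Sum>i=3..n. d i / ln (real i)) + (b - a) / b"
      using step.hyps by (simp add: d_def a_def b_def)
    { case 1 show ?case unfolding s using low step.IH(1)
        by (simp add: a_def b_def) }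
    { case 2 show ?case unfolding s using upp dif step.IH(2)
        by (simp add: a_def b_def) }
  qed auto
  have "{2..N} = {2} \<union> {3..N}" using assms by auto
  then have "(\<Sum>i=2..N. d i / ln (real i)) = 1 + (\<Sum>i=3..N. d i / ln (real i))"
    by (simp only:) (subst sum.union_disjoint, auto simp: d_def)
  moreover have "ln (ln 2) \<le> (0::real)" using l2 by simp
  moreover have "ln (ln 2) \<ge> (-1::real)"
  proof -
    have "ln (1/2::real) \<le> ln (ln 2)" using l2 by (intro ln_mono) auto
    then show ?thesis using l2 by (simp add: ln_div)
  qed
  moreover have "1 / ln 2 \<le> (2::real)" using l2 by (simp add: field_simps)
  moreover have "1 / ln (real N) \<ge> 0" using assms by simp
  ultimately have "\<bar>(\<Sum>i=2..N. d i / ln (real i)) - ln (ln (real N))\<bar> \<le> 3"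
    using up lo by linarith
  then show ?thesis by (simp add: d_def)
qed

text \<open>By Mertens' first theorem the differences between \<open>prime_ln d / d\<close> and the
  increments of ln have bounded partial sums. Abel summation divides them by ln d, and the
  increments reassemble to ln ln N.\<close>

lemma sum_prime_inverse:
  "\<exists>c. \<forall>N\<ge>2. \<bar>(\<Sum>p | prime p \<and> p \<le> N. 1 / real p) - ln (ln (real N))\<bar> \<le> c"
proof -
  obtain c where c: "\<And>N. (\<Sum>d=1..N. (mangoldt d - prime_ln d) / real d) \<le> c"
    using mangoldt_minus_prime_ln_bounded by blast
  have tel: "(\<Sum>d=2..N. ln (real d) - ln (real (d - 1))) = ln (real N)" for N
    by (induction N) (auto simp: not_le numeral_2_eq_2)
  have *: "\<bar>\<Sum>d=2..N. prime_ln d / real d - (ln (real d) - ln (real (d - 1)))\<bar> \<le> 4 + c" for N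
  proof (cases "N = 0")
    case True
    then show ?thesis using c[of 0] by simp
  next
    case False
    have "(\<Sum>d=2..N. prime_ln d / real d) = (\<Sum>d=1..N. prime_ln d / real d)"
      by (rule sum_from_2) (simp add: prime_ln_def)
    also have "\<dots> = (\<Sum>d=1..N. mangoldt d / real d) - (\<Sum>d=1..N. (mangoldt d - prime_ln d) / real d)"
      by (simp add: sum_subtractf[symmetric] diff_divide_distrib)
    finally have "(\<Sum>d=2..N. prime_ln d / real d) = \<dots>" .
    moreover have "0 \<le> (\<Sum>d=1..N. (mangoldt d - prime_ln d) / real d)"
      by (intro sum_nonneg) (simp add: prime_ln_le_mangoldt)
    ultimately show ?thesis
      using sum_mangoldt_over[of N] False c[of N] tel[of N]
      by (simp only: sum_subtractf) linarith
  qed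
  have e: "(\<Sum>i=2..N. (prime_ln i / real i) / ln (real i)) = (\<Sum>p | prime p \<and> p \<le> N. 1 / real p)" for N
    by (rule sum.mono_neutral_cong_right) (auto simp: prime_ln_def prime_ge_2_nat dest: prime_gt_1_nat)
  have "\<bar>(\<Sum>p | prime p \<and> p \<le> N. 1 / real p) - ln (ln (real N))\<bar> \<le> (4 + c) * (1 / ln 2) + 3"
    if "N \<ge> 2" for N
    using abel_inverse_ln[OF *, of N] sum_ln_increment_over_ln[OF that]
    unfolding diff_divide_distrib[of "prime_ln _ / _"] sum_subtractf e by linarith
  then show ?thesis by blast
qed

abbreviation recips :: "nat set \<Rightarrow> real" where
  "recips A \<equiv> \<Sum>p\<in>A. 1 / real p"

abbreviation primes_le :: "real \<Rightarrow> nat set" where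
  "primes_le z \<equiv> {p. prime p \<and> real p \<le> z}"

definition primes_res :: "nat \<Rightarrow> real \<Rightarrow> nat set" where
  "primes_res a z = {p. prime p \<and> p mod 4 = a \<and> real p \<le> z}"

lemma finite_primes_le: "finite (primes_le z)"
  by (rule finite_subset[of _ "{..nat \<lfloor>z\<rfloor>}"]) (auto simp: le_nat_floor)

lemma finite_primes_res: "finite (primes_res a z)"
  by (rule finite_subset[OF _ finite_primes_le[of z]]) (auto simp: primes_res_def)

text \<open>With N the floor of \<open>z\<close>, z <= 2N <= N^2, so ln z at most doubles ln N and
  the iterated logarithm moves by at most ln 2.\<close>

lemma ln_ln_floor:
  fixes z :: real
  assumes "z \<ge> 2"
  shows "ln (ln (real (nat \<lfloor>z\<rfloor>))) \<le> ln (ln z)" "ln (ln z) - 1 \<le> ln (ln (real (nat \<lfloor>z\<rfloor>)))"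
proof -
  define N where "N = nat \<lfloor>z\<rfloor>"
  have N: "N \<ge> 2" "real N \<le> z" "z \<le> real N + 1"
    using assms by (auto simp: N_def le_nat_iff le_floor_iff)
  show "ln (ln (real N)) \<le> ln (ln z)" using N by (intro ln_mono) auto
  have "z \<le> real N * 2" using N by linarith
  also have "\<dots> \<le> real N * real N" using N by (intro mult_left_mono) auto
  finally have "ln z \<le> ln (real N * real N)" using assms by (intro ln_mono) auto
  then have "ln z \<le> 2 * ln (real N)" using N by (simp add: ln_mult)
  then have "ln (ln z) \<le> ln (2 * ln (real N))" using assms by (intro ln_mono) auto
  also have "\<dots> = ln 2 + ln (ln (real N))" using N by (intro ln_mult_pos) auto
  finally show "ln (ln z) - 1 \<le> ln (ln (real N))" using ln_le_minus_one[of "2::real"] by simp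
qed

lemma mertens_second:
  "\<exists>c\<ge>0. \<forall>z\<ge>2. \<bar>recips (primes_le z) - ln (ln z)\<bar> \<le> c"
proof -
  obtain c where c: "\<And>N. N \<ge> 2 \<Longrightarrow> \<bar>(\<Sum>p | prime p \<and> p \<le> N. 1 / real p) - ln (ln (real N))\<bar> \<le> c"
    using sum_prime_inverse by blast
  have "\<bar>recips (primes_le z) - ln (ln z)\<bar> \<le> \<bar>c\<bar> + 1" if z: "z \<ge> 2" for z :: real
  proof -
    have "primes_le z = {p. prime p \<and> p \<le> nat \<lfloor>z\<rfloor>}"
      using z by (auto simp: le_nat_floor nat_le_iff le_floor_iff le_nat_iff)
    moreover have "nat \<lfloor>z\<rfloor> \<ge> 2" using z by (simp add: le_nat_iff le_floor_iff)
    ultimately show ?thesis using c[of "nat \<lfloor>z\<rfloor>"] ln_ln_floor[OF z] by auto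
  qed
  then show ?thesis by (intro exI[of _ "\<bar>c\<bar> + 1"]) auto
qed

text \<open>Up to the prime 2, the sum of the two class sums is the sum over all primes and their
  difference is the sum twisted by \<chi>. Both are known up to O(1), hence so is each
  class.\<close>

lemma mertens_mod_4:
  "\<exists>c\<ge>0. \<forall>z\<ge>2. \<forall>a\<in>{1,3}. \<bar>recips (primes_res a z) - ln (ln z) / 2\<bar> \<le> c"
proof -
  obtain c where c: "\<And>z. z \<ge> 2 \<Longrightarrow> \<bar>recips (primes_le z) - ln (ln z)\<bar> \<le> c"
    and c0: "c \<ge> 0" using mertens_second by blast
  obtain c' where c': "\<And>N. \<bar>\<Sum>p | prime p \<and> p \<le> N. chi4 p / real p\<bar> \<le> c'"
    using sum_prime_chi4_bounded by blast
  have c'0: "c' \<ge> 0" using c'[of 0] by linarith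
  have "\<bar>recips (primes_res a z) - ln (ln z) / 2\<bar> \<le> c + c' + 1"
    if z: "z \<ge> 2" and a: "a \<in> {1, 3}" for z :: real and a
  proof -
    let ?P = "primes_le z"
    have e: "?P = {p. prime p \<and> p \<le> nat \<lfloor>z\<rfloor>}"
      using z by (auto simp: le_nat_floor nat_le_iff le_floor_iff le_nat_iff)
    have cls: "p = 2 \<or> p mod 4 = 1 \<or> p mod 4 = 3" if "prime p" for p :: nat
    proof (cases "p = 2")
      case False
      then have "odd p" using that prime_odd_nat[of p] prime_ge_2_nat[of p] by auto
      then show ?thesis by presburger
    qed simp
    have P: "?P = {2} \<union> primes_res 1 z \<union> primes_res 3 z"
      using z cls by (auto simp: primes_res_def)
    have S: "(\<Sum>p\<in>?P. f p) = f 2 + (\<Sum>p\<in>primes_res 1 z. f p) + (\<Sum>p\<in>primes_res 3 z. f p)"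
      for f :: "nat \<Rightarrow> real"
    proof -
      have "({2} \<union> primes_res 1 z) \<inter> primes_res 3 z = {}" "{2} \<inter> primes_res 1 z = {}"
        by (auto simp: primes_res_def)
      then show ?thesis
        unfolding P by (simp add: sum.union_disjoint finite_primes_res)
    qed
    have chi1: "(\<Sum>p\<in>primes_res 1 z. chi4 p / real p) = recips (primes_res 1 z)"
      by (intro sum.cong) (auto simp: chi4_def primes_res_def)
    have chi3: "(\<Sum>p\<in>primes_res 3 z. chi4 p / real p) = - recips (primes_res 3 z)"
      by (subst sum_negf[symmetric], intro sum.cong) (auto simp: chi4_def primes_res_def)
    have "\<bar>recips (primes_res 1 z) - recips (primes_res 3 z)\<bar> \<le> c'"
      using c'[of "nat \<lfloor>z\<rfloor>"] unfolding e[symmetric] S chi1 chi3 by (simp add: chi4_def)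
    then show ?thesis using c[OF z] a c0 unfolding S by (auto simp: abs_le_iff field_simps)
  qed
  then show ?thesis using c0 c'0 by (intro exI[of _ "c + c' + 1"]) auto
qed

section \<open>Primitive representations as sums of two squares\<close>

text \<open>Raising a^2 = -b^2 modulo \<open>q\<close> to the odd power (q-1)/2 and applying
  Fermat's theorem to both sides would give 1 = -1 modulo \<open>q\<close>.\<close>

lemma prime_3_mod_4_dvd_sum_squares_nat:
  fixes a b q :: nat
  assumes q: "prime q" "q mod 4 = 3" and dvd: "q dvd a\<^sup>2 + b\<^sup>2"
  shows "q dvd a"
proof (rule ccontr)
  assume a: "\<not> q dvd a"
  have b: "\<not> q dvd b"
  proof
    assume "q dvd b"
    then have "q dvd b\<^sup>2" by (simp add: power2_eq_square)
    then have "q dvd a\<^sup>2" using dvd dvd_add_left_iff by blast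
    then show False using a q prime_dvd_power by blast
  qed
  define m where "m = (q - 1) div 2"
  have m: "q - 1 = 2 * m" "odd m" using q(2) unfolding m_def by presburger+
  have fa: "[int a ^ (q - 1) = 1] (mod int q)"
    using fermat_theorem[OF q(1) a] cong_int_iff[of "a ^ (q - 1)" 1 q] by simp
  have fb: "[int b ^ (q - 1) = 1] (mod int q)"
    using fermat_theorem[OF q(1) b] cong_int_iff[of "b ^ (q - 1)" 1 q] by simp
  have "int q dvd (int a)\<^sup>2 + (int b)\<^sup>2" using dvd by (metis int_dvd_int_iff of_nat_add of_nat_power)
  then have "[(int a)\<^sup>2 = - ((int b)\<^sup>2)] (mod int q)" by (simp add: cong_iff_dvd_diff)
  then have "[((int a)\<^sup>2) ^ m = (- ((int b)\<^sup>2)) ^ m] (mod int q)" by (rule cong_pow)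
  moreover have "((int a)\<^sup>2) ^ m = int a ^ (q - 1)" "(- ((int b)\<^sup>2)) ^ m = - (int b ^ (q - 1))"
    using m by (simp_all add: power_mult)
  ultimately have "[int a ^ (q - 1) = - (int b ^ (q - 1))] (mod int q)" by simp
  then have "[1 = - 1] (mod int q)"
    using fa fb by (meson cong_minus_minus_iff cong_sym cong_trans)
  then have "int q dvd 2" by (simp add: cong_iff_dvd_diff)
  then have "q \<le> 2" by (auto dest: zdvd_imp_le)
  then show False using q prime_ge_2_nat[of q] by auto
qed

lemma prime_3_mod_4_dvd_sum_squares:
  fixes a b :: int and q :: nat
  assumes q: "prime q" "q mod 4 = 3" and dvd: "int q dvd a\<^sup>2 + b\<^sup>2"
  shows "int q dvd a" "int q dvd b"
proof -
  have "int ((nat \<bar>a\<bar>)\<^sup>2 + (nat \<bar>b\<bar>)\<^sup>2) = a\<^sup>2 + b\<^sup>2" by simp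
  then have d: "q dvd (nat \<bar>a\<bar>)\<^sup>2 + (nat \<bar>b\<bar>)\<^sup>2" using dvd by (metis int_dvd_int_iff)
  show "int q dvd a" "int q dvd b"
    using prime_3_mod_4_dvd_sum_squares_nat[OF q d]
      prime_3_mod_4_dvd_sum_squares_nat[OF q d[unfolded add.commute[of "(nat \<bar>a\<bar>)\<^sup>2"]]]
    by (simp_all add: int_dvd_int_iff[symmetric])
qed

lemma sums_two_squares_dvd:
  assumes "b \<in> sums_two_squares" "prime q" "q mod 4 = 3" "q dvd b"
  shows "q\<^sup>2 dvd b"
proof -
  obtain c d :: nat where b: "b = c\<^sup>2 + d\<^sup>2" using assms(1) by (auto simp: sums_two_squares_def)
  have "q dvd c" "q dvd d"
    using prime_3_mod_4_dvd_sum_squares_nat[OF assms(2,3), of c d]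
      prime_3_mod_4_dvd_sum_squares_nat[OF assms(2,3), of d c] assms(4)
    by (auto simp: b add.commute)
  then show ?thesis unfolding b by (intro dvd_add dvd_power_same)
qed

lemma ex_sqrt_minus_one_mod_prime:
  assumes "prime q" "q mod 4 = 1"
  shows "\<exists>i::int. int q dvd i\<^sup>2 + 1"
proof -
  have q2: "2 < q" using assms prime_ge_2_nat[of q] by (cases "q = 2") auto
  have "even ((q - 1) div 2)" using assms by presburger
  then have 1: "[Legendre (-1) (int q) = 1] (mod int q)"
    using euler_criterion[OF assms(1) q2, of "-1"] by simp
  have n0: "\<not> [-1 = 0] (mod int q)" using q2
    by (auto simp: cong_iff_dvd_diff dest: zdvd_imp_le)
  have "QuadRes (int q) (-1)"
  proof (rule ccontr)
    assume "\<not> QuadRes (int q) (-1)"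
    then have "Legendre (-1) (int q) = -1" using n0 by (simp add: Legendre_def)
    then have "int q dvd 2" using 1 by (simp add: cong_iff_dvd_diff)
    then show False using q2 by (auto dest: zdvd_imp_le)
  qed
  then show ?thesis by (auto simp: QuadRes_def cong_iff_dvd_diff)
qed

text \<open>Thue's argument: among more than \<open>p\<close> pairs with entries in 0..r, two have
  the same value of a x - b y modulo \<open>p\<close>. Their difference (u, v) makes u^2 + v^2 a
  multiple of \<open>p\<close> strictly between 0 and 2p.\<close>

lemma prime_sum_two_squares:
  fixes a b :: int
  assumes p: "prime p" and dvd: "int p dvd a\<^sup>2 + b\<^sup>2" and nb: "\<not> int p dvd b"
  shows "\<exists>u v :: int. u\<^sup>2 + v\<^sup>2 = int p"
proof -
  define r where "r = floor_sqrt p"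
  have r1: "r\<^sup>2 \<le> p" "p < (Suc r)\<^sup>2" by (auto simp: r_def Suc_floor_sqrt_power2_gt)
  have p_pos: "p > 0" using p prime_gt_0_nat by blast
  let ?A = "{0..int r} \<times> {0..int r}"
  let ?f = "\<lambda>(x, y). (a * x - b * y) mod int p"
  have "\<not> inj_on ?f ?A"
  proof
    assume inj: "inj_on ?f ?A"
    have "?f ` ?A \<subseteq> {0..<int p}" using p_pos by auto
    then have "card ?A \<le> card {0..<int p}" using inj by (intro card_inj_on_le) auto
    moreover have "nat (int r + 1) = Suc r" by linarith
    ultimately show False using r1 by (simp add: power2_eq_square)
  qed
  then obtain x y x' y' where xy: "x \<in> {0..int r}" "y \<in> {0..int r}" "x' \<in> {0..int r}" "y' \<in> {0..int r}"
    "(x, y) \<noteq> (x', y')" "(a * x - b * y) mod int p = (a * x' - b * y') mod int p"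
    by (auto simp: inj_on_def)
  define u v where "u = x - x'" and "v = y - y'"
  have "\<bar>u\<bar> \<le> int r" "\<bar>v\<bar> \<le> int r" using xy by (auto simp: u_def v_def)
  then have "\<bar>u\<bar>\<^sup>2 \<le> (int r)\<^sup>2" "\<bar>v\<bar>\<^sup>2 \<le> (int r)\<^sup>2" by (intro power_mono; simp)+
  then have uv: "u\<^sup>2 \<le> (int r)\<^sup>2" "v\<^sup>2 \<le> (int r)\<^sup>2" by simp_all
  have "int p dvd (a * x - b * y) - (a * x' - b * y')" using xy(6) by (simp add: mod_eq_dvd_iff)
  also have "(a * x - b * y) - (a * x' - b * y') = a * u - b * v"
    by (simp add: u_def v_def algebra_simps)
  finally have d1: "int p dvd a * u - b * v" .
  have "b\<^sup>2 * (u\<^sup>2 + v\<^sup>2) = (a\<^sup>2 + b\<^sup>2) * u\<^sup>2 - (a * u - b * v) * (a * u + b * v)"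
    by (simp add: algebra_simps power2_eq_square)
  then have "int p dvd b\<^sup>2 * (u\<^sup>2 + v\<^sup>2)" using d1 dvd by simp
  then have d2: "int p dvd u\<^sup>2 + v\<^sup>2" using nb p
    by (metis prime_dvd_mult_iff prime_dvd_power prime_nat_int_transfer)
  have pos: "u\<^sup>2 + v\<^sup>2 > 0" using xy(5) by (auto simp: u_def v_def sum_power2_gt_zero_iff)
  \<comment> \<open>A prime is no square; this makes the upper bound 2p strict.\<close>
  have "r\<^sup>2 \<noteq> p"
  proof
    assume "r\<^sup>2 = p"
    then show False using p by (metis prime_power_iff one_neq_zero numeral_eq_one_iff semiring_norm(85))
  qed
  then have "r\<^sup>2 < p" using r1 by simp
  then have "(int r)\<^sup>2 < int p" by (metis of_nat_less_iff of_nat_power)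
  then have lt: "u\<^sup>2 + v\<^sup>2 < 2 * int p" using uv by linarith
  obtain k where k: "u\<^sup>2 + v\<^sup>2 = int p * k" using d2 by (elim dvdE)
  have "k > 0" using pos k p_pos by (simp add: zero_less_mult_iff)
  moreover have "k < 2" using lt k p_pos by (simp add: mult.commute)
  ultimately have "k = 1" by simp
  then show ?thesis using k by auto
qed

text \<open>Division of Gaussian integers: s + t i is the quotient of b + c i by u - v i, where c is
  a or -a, whichever makes the division exact. The choice of sign is the reason why only the
  absolute value of \<open>a\<close> is recovered.\<close>

lemma sum_squares_factor:
  fixes a b u v :: int and m p :: nat
  assumes p: "prime p" and n: "a\<^sup>2 + b\<^sup>2 = int m * int p" and uv: "u\<^sup>2 + v\<^sup>2 = int p"
    and cop: "coprime a b"
  shows "\<exists>s t. s\<^sup>2 + t\<^sup>2 = int m \<and> coprime s t \<and> b = s * u + t * v \<and> \<bar>a\<bar> = \<bar>t * u - s * v\<bar>"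
proof -
  have pp: "prime (int p)" using p by simp
  have p0: "int p > 0" using p prime_gt_0_nat by simp
  have "(b * u - a * v) * (b * u + a * v) = b\<^sup>2 * (u\<^sup>2 + v\<^sup>2) - (a\<^sup>2 + b\<^sup>2) * v\<^sup>2"
    by (simp add: algebra_simps power2_eq_square)
  also have "\<dots> = int p * (b\<^sup>2 - int m * v\<^sup>2)" unfolding n uv by (simp add: algebra_simps)
  finally have "int p dvd (b * u - a * v) * (b * u + a * v)" by simp
  then have "int p dvd b * u - a * v \<or> int p dvd b * u + a * v" using pp prime_dvd_mult_iff by blast
  then obtain c where c: "c = a \<or> c = -a" and d1: "int p dvd b * u - c * v"
    by (metis diff_minus_eq_add mult_minus_left)
  have cn: "c\<^sup>2 + b\<^sup>2 = int m * int p" using c n by auto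
  have sq: "(b * u - c * v)\<^sup>2 + (b * v + c * u)\<^sup>2 = int m * int p * int p"
  proof -
    have "(b * u - c * v)\<^sup>2 + (b * v + c * u)\<^sup>2 = (c\<^sup>2 + b\<^sup>2) * (u\<^sup>2 + v\<^sup>2)"
      by (simp add: algebra_simps power2_eq_square)
    then show ?thesis unfolding cn uv .
  qed
  moreover have "int p dvd int m * int p * int p - (b * u - c * v)\<^sup>2"
    using d1 by (intro dvd_diff) (auto simp: power2_eq_square)
  ultimately have "int p dvd (b * v + c * u)\<^sup>2"
    by (metis add_diff_cancel_left')
  then have d2: "int p dvd b * v + c * u" using pp prime_dvd_power by blast
  obtain s where s: "b * u - c * v = int p * s" using d1 by (elim dvdE)
  obtain t where t: "b * v + c * u = int p * t" using d2 by (elim dvdE)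
  have "(int p)\<^sup>2 * (s\<^sup>2 + t\<^sup>2) = (int p)\<^sup>2 * int m"
    using sq unfolding s t by (simp add: algebra_simps power2_eq_square)
  then have st: "s\<^sup>2 + t\<^sup>2 = int m" using p0 by simp
  have "int p * (s * u + t * v) = (int p * s) * u + (int p * t) * v"
    by (simp add: algebra_simps)
  also have "\<dots> = b * (u\<^sup>2 + v\<^sup>2)"
    unfolding s[symmetric] t[symmetric] by (simp add: algebra_simps power2_eq_square)
  finally have "int p * (s * u + t * v) = b * (u\<^sup>2 + v\<^sup>2)" .
  then have b: "b = s * u + t * v" using p0 uv by simp
  have "int p * (t * u - s * v) = (int p * t) * u - (int p * s) * v"
    by (simp add: algebra_simps)
  also have "\<dots> = c * (u\<^sup>2 + v\<^sup>2)"
    unfolding s[symmetric] t[symmetric] by (simp add: algebra_simps power2_eq_square)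
  finally have "int p * (t * u - s * v) = c * (u\<^sup>2 + v\<^sup>2)" .
  then have cc: "c = t * u - s * v" using p0 uv by simp
  have "coprime s t"
  proof (rule coprimeI)
    fix d assume "d dvd s" "d dvd t"
    then have "d dvd b" "d dvd c" by (simp_all add: b cc)
    then have "d dvd a" using c by auto
    with \<open>d dvd b\<close> show "is_unit d" using cop coprime_common_divisor by blast
  qed
  moreover have "\<bar>a\<bar> = \<bar>t * u - s * v\<bar>" using c cc by auto
  ultimately show ?thesis using st b by blast
qed

text \<open>Signs and order are kept because the linear form s u + t v depends on them.\<close>

definition prim_reps :: "nat \<Rightarrow> (int \<times> int) set" where
  "prim_reps m = {(s, t). s\<^sup>2 + t\<^sup>2 = int m \<and> coprime s t}"

lemma abs_le_square_int: "\<bar>i\<bar> \<le> i\<^sup>2" for i :: int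
proof (cases "i = 0")
  case False
  then have "\<bar>i\<bar> * 1 \<le> \<bar>i\<bar> * \<bar>i\<bar>" by (intro mult_left_mono) auto
  then show ?thesis by (simp add: power2_eq_square)
qed simp

lemma finite_prim_reps: "finite (prim_reps m)"
proof (rule finite_subset)
  show "prim_reps m \<subseteq> {-int m..int m} \<times> {-int m..int m}"
  proof
    fix z assume "z \<in> prim_reps m"
    then obtain s t where z: "z = (s, t)" "s\<^sup>2 + t\<^sup>2 = int m" by (auto simp: prim_reps_def)
    have "\<bar>s\<bar> \<le> int m" "\<bar>t\<bar> \<le> int m" using abs_le_square_int[of s] abs_le_square_int[of t] z zero_le_power2[of s] zero_le_power2[of t] by linarith+
    then show "z \<in> {-int m..int m} \<times> {-int m..int m}" using z by auto
  qed
qed auto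

lemma prim_reps_not_dvd:
  assumes "(s, t) \<in> prim_reps m" "prime q" "q dvd m"
  shows "\<not> int q dvd s" "\<not> int q dvd t"
proof -
  have st: "s\<^sup>2 + t\<^sup>2 = int m" "coprime s t" using assms by (auto simp: prim_reps_def)
  have m: "int q dvd s\<^sup>2 + t\<^sup>2" using st assms(3) by simp
  have pq: "prime (int q)" using assms by simp
  have "\<not> (int q dvd s \<and> int q dvd t)" using st(2) pq
    by (meson coprime_common_divisor not_prime_unit)
  moreover have "int q dvd s \<Longrightarrow> int q dvd t"
    using m pq by (metis dvd_add_right_iff dvd_mult power2_eq_square prime_dvd_power)
  moreover have "int q dvd t \<Longrightarrow> int q dvd s"
    using m pq by (metis dvd_add_left_iff dvd_mult power2_eq_square prime_dvd_power)
  ultimately show "\<not> int q dvd s" "\<not> int q dvd t" by auto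
qed

lemma prim_reps_prime_mod_4:
  assumes "(s, t) \<in> prim_reps m" "prime q" "odd q" "q dvd m"
  shows "q mod 4 = 1"
proof -
  have "q mod 4 \<noteq> 3"
    using prim_reps_not_dvd[OF assms(1,2,4)] prime_3_mod_4_dvd_sum_squares[of q s t] assms
    by (auto simp: prim_reps_def)
  then show ?thesis using assms(3) by presburger
qed

text \<open>Since \<open>omega_star\<close> ignores the prime 2, this is what limits the
  contribution of that prime to a factor 2.\<close>

lemma prim_reps_not_4_dvd:
  assumes "(s, t) \<in> prim_reps m"
  shows "\<not> 4 dvd m"
proof
  assume "4 dvd m"
  then have "int 4 dvd int m" by (simp only: int_dvd_int_iff)
  then have "4 dvd s\<^sup>2 + t\<^sup>2" using assms by (auto simp: prim_reps_def)
  then have 1: "(s\<^sup>2 + t\<^sup>2) mod 4 = 0" by simp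
  have "\<not> (2 dvd s \<and> 2 dvd t)"
    using assms by (auto simp: prim_reps_def dest: coprime_common_divisor)
  moreover have "x\<^sup>2 mod 4 = (if 2 dvd x then 0 else 1)" for x :: int
  proof (cases "2 dvd x")
    case False
    then obtain k where "x = 2 * k + 1" by (elim oddE)
    then have "x\<^sup>2 = 4 * (k\<^sup>2 + k) + 1" by (simp add: power2_eq_square algebra_simps)
    then have "x\<^sup>2 mod 4 = 1" by presburger
    then show ?thesis using False by simp
  qed (auto simp: power2_eq_square elim!: evenE)
  ultimately have "(s\<^sup>2 mod 4 + t\<^sup>2 mod 4) mod 4 \<noteq> 0" by auto
  with 1 show False by (simp add: mod_simps)
qed

text \<open>The product of the two expressions is m (t0^2 - t^2). The prime \<open>q\<close> cannot
  divide both, as it would divide their sum 2 s t0; hence the full power goes into one of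
  them.\<close>

lemma prim_reps_cross_cases:
  assumes st: "(s, t) \<in> prim_reps m" and st0: "(s0, t0) \<in> prim_reps m"
    and q: "prime q" "odd q" "q dvd m"
  shows "int (q ^ multiplicity q m) dvd s * t0 - s0 * t \<or> int (q ^ multiplicity q m) dvd s * t0 + s0 * t"
proof -
  let ?Q = "int (q ^ multiplicity q m)"
  have pq: "prime (int q)" using q by simp
  have Qm: "?Q dvd int m" by (simp only: int_dvd_int_iff multiplicity_dvd)
  have "(s * t0 - s0 * t) * (s * t0 + s0 * t) = (s\<^sup>2 + t\<^sup>2) * t0\<^sup>2 - (s0\<^sup>2 + t0\<^sup>2) * t\<^sup>2"
    by (simp add: algebra_simps power2_eq_square)
  also have "\<dots> = int m * (t0\<^sup>2 - t\<^sup>2)" using st st0 by (simp add: prim_reps_def algebra_simps)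
  finally have dvd: "?Q dvd (s * t0 - s0 * t) * (s * t0 + s0 * t)" using Qm by simp
  show ?thesis
  proof (cases "int q dvd s * t0 - s0 * t")
    case False
    then have "coprime ?Q (s * t0 - s0 * t)" using pq
      by (simp add: prime_imp_coprime coprime_power_left_iff)
    then show ?thesis using dvd coprime_dvd_mult_right_iff by blast
  next
    case True
    have "\<not> int q dvd s * t0 + s0 * t"
    proof
      assume "int q dvd s * t0 + s0 * t"
      then have "int q dvd (s * t0 - s0 * t) + (s * t0 + s0 * t)" using True by (rule dvd_add[rotated])
      then have "int q dvd 2 * (s * t0)" by simp
      then have "int q dvd 2 \<or> int q dvd s \<or> int q dvd t0" using pq prime_dvd_mult_iff by blast
      moreover have "\<not> int q dvd 2" using q prime_ge_2_nat[of q]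
        by (auto dest!: zdvd_imp_le) 
      ultimately show False using prim_reps_not_dvd[OF st q(1,3)] prim_reps_not_dvd[OF st0 q(1,3)] by auto
    qed
    then have "coprime ?Q (s * t0 + s0 * t)" using pq
      by (simp add: prime_imp_coprime coprime_power_left_iff)
    then show ?thesis using dvd coprime_dvd_mult_left_iff by blast
  qed
qed

text \<open>Checked one prime power at a time. If both pairs fall into the same case relative to
  (s0, t0), eliminating s0 shows that the power divides t0 (s t' - s' t), and t0 is a unit modulo
  \<open>q\<close>. The prime 2 occurs at most once, and then all four entries are odd.\<close>

lemma prim_reps_cross_dvd:
  assumes st: "(s, t) \<in> prim_reps m" and st': "(s', t') \<in> prim_reps m" and st0: "(s0, t0) \<in> prim_reps m"
    and m: "m > 0"
    and sig: "\<And>q. prime q \<Longrightarrow> odd q \<Longrightarrow> q dvd m \<Longrightarrow>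
      int (q ^ multiplicity q m) dvd s * t0 - s0 * t \<longleftrightarrow> int (q ^ multiplicity q m) dvd s' * t0 - s0 * t'"
  shows "int m dvd s * t' - s' * t"
proof (cases "s * t' - s' * t = 0")
  case False
  have "m dvd nat \<bar>s * t' - s' * t\<bar>"
  proof (rule multiplicity_le_imp_dvd)
    fix q :: nat assume q: "prime q"
    show "multiplicity q m \<le> multiplicity q (nat \<bar>s * t' - s' * t\<bar>)"
    proof (cases "q dvd m")
      case qm: True
      let ?Q = "int (q ^ multiplicity q m)"
      have "?Q dvd s * t' - s' * t"
      proof (cases "q = 2")
        case True
        have "multiplicity q m \<le> 1"
        proof (rule ccontr)
          assume "\<not> multiplicity q m \<le> 1"
          then have "q ^ 2 dvd m" by (intro multiplicity_dvd') auto
          then show False using prim_reps_not_4_dvd[OF st] True by simp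
        qed
        moreover have "odd s" "odd t" "odd s'" "odd t'"
          using prim_reps_not_dvd[OF st q qm] prim_reps_not_dvd[OF st' q qm] True by auto
        ultimately show ?thesis using True by (cases "multiplicity q m") auto
      next
        case False
        then have odd: "odd q" using q by (metis primes_dvd_imp_eq two_is_prime_nat)
        have "coprime ?Q t0" using prim_reps_not_dvd[OF st0 q qm] q
          by (simp add: prime_imp_coprime coprime_power_left_iff)
        moreover have "?Q dvd t0 * (s * t' - s' * t)"
        proof (cases "?Q dvd s * t0 - s0 * t")
          case True
          moreover have "t0 * (s * t' - s' * t) = t' * (s * t0 - s0 * t) - t * (s' * t0 - s0 * t')"
            by (simp add: algebra_simps)
          ultimately show ?thesis using sig[OF q odd qm] by simp
        next
          case F: False
          have "t0 * (s * t' - s' * t) = t' * (s * t0 + s0 * t) - t * (s' * t0 + s0 * t')"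
            by (simp add: algebra_simps)
          moreover have "?Q dvd s * t0 + s0 * t" "?Q dvd s' * t0 + s0 * t'"
            using prim_reps_cross_cases[OF st st0 q odd qm] prim_reps_cross_cases[OF st' st0 q odd qm]
              F sig[OF q odd qm] by auto
          ultimately show ?thesis by simp
        qed
        ultimately show ?thesis using coprime_dvd_mult_right_iff by blast
      qed
      then have "q ^ multiplicity q m dvd nat \<bar>s * t' - s' * t\<bar>"
        using int_dvd_int_iff by fastforce
      then show ?thesis using False q by (intro multiplicity_geI) auto
    qed (simp add: not_dvd_imp_multiplicity_0)
  qed (use m False in auto)
  then show ?thesis by (metis dvd_abs_iff int_dvd_int_iff int_nat_eq abs_ge_zero)
qed simp

text \<open>
  Relative to a fixed \<open>(s0, t0)\<close>, each odd prime power \<open>q\<^sup>e\<close> exactly dividing \<open>m\<close> divides \<open>s t0 - s0 t\<close> or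
  \<open>s t0 + s0 t\<close>. The set of \<open>q\<close> of the first kind determines \<open>(s, t)\<close> up to the four units.
\<close>

lemma card_prim_reps_le:
  assumes "m > 0"
  shows "card (prim_reps m) \<le> 4 * 2 ^ omega_star m"
proof (cases "prim_reps m = {}")
  case False
  then obtain s0 t0 where st0: "(s0, t0) \<in> prim_reps m" by auto
  define P where "P = {q \<in> prime_factors m. odd q}"
  define sig where "sig = (\<lambda>(s, t). {q \<in> P. int (q ^ multiplicity q m) dvd s * t0 - s0 * t})"
  have "sig z \<in> Pow P" for z by (cases z) (auto simp: sig_def)
  then have "prim_reps m = (\<Union>A\<in>Pow P. {z \<in> prim_reps m. sig z = A})" by blast
  then have "card (prim_reps m) = card (\<Union>A\<in>Pow P. {z \<in> prim_reps m. sig z = A})" by (rule arg_cong)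
  also have "\<dots> \<le> (\<Sum>A\<in>Pow P. card {z \<in> prim_reps m. sig z = A})"
    by (rule card_UN_le) (auto simp: P_def)
  also have "\<dots> \<le> (\<Sum>A\<in>Pow P. 4)"
  proof (rule sum_mono)
    fix A
    show "card {z \<in> prim_reps m. sig z = A} \<le> 4"
    proof (cases "{z \<in> prim_reps m. sig z = A} = {}")
      case False
      then obtain s t where st: "(s, t) \<in> prim_reps m" "sig (s, t) = A" by auto
      have "{z \<in> prim_reps m. sig z = A} \<subseteq> {(s, t), (-s, -t), (-t, s), (t, -s)}"
      proof
        fix z assume "z \<in> {z \<in> prim_reps m. sig z = A}"
        then obtain s' t' where z: "z = (s', t')" "(s', t') \<in> prim_reps m" "sig (s', t') = A"
          by (cases z) auto
        have "int m dvd s * t' - s' * t"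
        proof (rule prim_reps_cross_dvd[OF st(1) z(2) st0 assms])
          fix q assume "prime q" "odd q" "q dvd m"
          then have "q \<in> P" using assms by (auto simp: P_def prime_factors_dvd)
          then show "int (q ^ multiplicity q m) dvd s * t0 - s0 * t \<longleftrightarrow> int (q ^ multiplicity q m) dvd s' * t0 - s0 * t'"
            using st(2) z(3) by (auto simp: sig_def)
        qed
        then obtain d where d: "s * t' - s' * t = int m * d" by (elim dvdE)
        \<comment> \<open>\<open>F\<close> and s t' - s' t are the real and imaginary parts of (s -
          t i)(s' + t' i), of norm m^2. Dividing by \<open>m\<close> gives a Gaussian integer f + d
          i of norm 1, a unit that carries s + t i to s' + t' i.\<close>
        define F where "F = s * s' + t * t'"
        have sm: "s\<^sup>2 + t\<^sup>2 = int m" "s'\<^sup>2 + t'\<^sup>2 = int m" using st z by (auto simp: prim_reps_def)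
        have "(s * t' - s' * t)\<^sup>2 + F\<^sup>2 = (s\<^sup>2 + t\<^sup>2) * (s'\<^sup>2 + t'\<^sup>2)"
          by (simp add: F_def algebra_simps power2_eq_square)
        then have F: "F\<^sup>2 + (int m * d)\<^sup>2 = (int m)\<^sup>2" unfolding d sm by (simp add: power2_eq_square)
        then have "F\<^sup>2 = (int m)\<^sup>2 * (1 - d\<^sup>2)" by (simp add: algebra_simps power_mult_distrib)
        then have "(int m)\<^sup>2 dvd F\<^sup>2" by simp
        then have "int m dvd F" by simp
        then obtain f where f: "F = int m * f" by (elim dvdE)
        have "(int m)\<^sup>2 * (f\<^sup>2 + d\<^sup>2) = (int m)\<^sup>2 * 1"
          using F unfolding f by (simp add: algebra_simps power_mult_distrib)
        then have fd: "f\<^sup>2 + d\<^sup>2 = 1" using assms by simp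
        have "int m * (s * f - t * d) = s * (int m * f) - t * (int m * d)" by (simp add: algebra_simps)
        also have "\<dots> = (s\<^sup>2 + t\<^sup>2) * s'"
          unfolding f[symmetric] d[symmetric] F_def by (simp add: algebra_simps power2_eq_square)
        finally have "int m * s' = int m * (s * f - t * d)" unfolding sm by (rule sym)
        then have s': "s' = s * f - t * d" using assms by simp
        have "int m * (t * f + s * d) = t * (int m * f) + s * (int m * d)" by (simp add: algebra_simps)
        also have "\<dots> = (s\<^sup>2 + t\<^sup>2) * t'"
          unfolding f[symmetric] d[symmetric] F_def by (simp add: algebra_simps power2_eq_square)
        finally have "int m * t' = int m * (t * f + s * d)" unfolding sm by (rule sym)
        then have t': "t' = t * f + s * d" using assms by simp
        have "f\<^sup>2 \<le> 1" "d\<^sup>2 \<le> 1" using fd zero_le_power2[of f] zero_le_power2[of d] by linarith+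
        then have "\<bar>f\<bar> \<le> 1" "\<bar>d\<bar> \<le> 1" by (auto simp: abs_square_le_1)
        then have "f \<in> {-1,0,1}" "d \<in> {-1,0,1}" by auto
        then show "z \<in> {(s, t), (-s, -t), (-t, s), (t, -s)}"
          using fd s' t' z(1) by auto
      qed
      then have "card {z \<in> prim_reps m. sig z = A} \<le> card {(s, t), (-s, -t), (-t, s), (t, -s)}"
        by (intro card_mono) auto
      also have "\<dots> \<le> 4" by (intro card_insert_le_m1 order_trans[OF card_insert_le_m1]) auto
      finally show ?thesis .
    next
      case True
      show ?thesis unfolding True by simp
    qed
  qed
  also have "\<dots> = 4 * 2 ^ omega_star m"
    by (simp add: card_Pow P_def omega_star_def)
  finally show ?thesis .
qed simp

section \<open>Brun's pure sieve\<close>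

text \<open>Inclusion-exclusion truncated after the intersections of \<open>n\<close> sets: the
  terms of degree at most \<open>n\<close> in the expansion of the product of all 1 - x q.\<close>

definition bonferroni_sum :: "'a set \<Rightarrow> ('a \<Rightarrow> real) \<Rightarrow> nat \<Rightarrow> real" where
  "bonferroni_sum P x n = (\<Sum>D | D \<subseteq> P \<and> card D \<le> n. \<Prod>q\<in>D. - x q)"

definition elementary_sym :: "'a set \<Rightarrow> ('a \<Rightarrow> real) \<Rightarrow> nat \<Rightarrow> real" where
  "elementary_sym P x n = (\<Sum>D | D \<subseteq> P \<and> card D = n. \<Prod>q\<in>D. x q)"

text \<open>Subsets are split by whether they contain \<open>p\<close>. The predicate on
  cardinalities lets one lemma serve both truncated sums and elementary symmetric functions.\<close>

lemma sum_subsets_insert: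
  fixes F :: "'a set \<Rightarrow> real"
  assumes "finite P" "p \<notin> P"
  shows "(\<Sum>D | D \<subseteq> insert p P \<and> Q (card D). F D)
    = (\<Sum>D | D \<subseteq> P \<and> Q (card D). F D) + (\<Sum>D | D \<subseteq> P \<and> Q (Suc (card D)). F (insert p D))"
proof -
  have fin: "D \<subseteq> P \<Longrightarrow> finite D" for D using assms(1) finite_subset by blast
  have e: "{D. D \<subseteq> insert p P \<and> Q (card D)}
      = {D. D \<subseteq> P \<and> Q (card D)} \<union> insert p ` {D. D \<subseteq> P \<and> Q (Suc (card D))}" (is "?L = ?R")
  proof
    show "?L \<subseteq> ?R"
    proof
      fix D assume D: "D \<in> ?L"
      show "D \<in> ?R"
      proof (cases "p \<in> D")
        case True
        then have D': "D = insert p (D - {p})" "D - {p} \<subseteq> P" using D by auto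
        have "finite D" using D assms(1) finite_subset[of D "insert p P"] by auto
        then have "card D = Suc (card (D - {p}))" using True by (metis card_Suc_Diff1)
        then have "D \<in> insert p ` {D. D \<subseteq> P \<and> Q (Suc (card D))}"
          using D D' by (intro image_eqI[of _ _ "D - {p}"]) auto
        then show ?thesis by blast
      qed (use D in auto)
    qed
    have "card (insert p D) = Suc (card D)" if "D \<subseteq> P" for D
      using fin[OF that] that assms(2) by (subst card_insert_disjoint) auto
    then show "?R \<subseteq> ?L" by auto
  qed
  have inj: "inj_on (insert p) {D. D \<subseteq> P \<and> Q (Suc (card D))}"
  proof (rule inj_onI)
    fix D D' assume "D \<in> {D. D \<subseteq> P \<and> Q (Suc (card D))}" "D' \<in> {D. D \<subseteq> P \<and> Q (Suc (card D))}"
      "insert p D = insert p D'"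
    moreover from this have "p \<notin> D" "p \<notin> D'" using assms(2) by auto
    ultimately show "D = D'" by (simp add: insert_ident)
  qed
  have disj: "{D. D \<subseteq> P \<and> Q (card D)} \<inter> insert p ` {D. D \<subseteq> P \<and> Q (Suc (card D))} = {}"
    using assms(2) by auto
  show ?thesis unfolding e
    by (subst sum.union_disjoint[OF _ _ disj]) (use assms in \<open>simp_all add: sum.reindex[OF inj]\<close>)
qed

lemma bonferroni_sum_0: "finite P \<Longrightarrow> bonferroni_sum P x 0 = 1"
proof -
  assume "finite P"
  then have "{D. D \<subseteq> P \<and> card D \<le> 0} = {{}}" using finite_subset by (auto simp: card_eq_0_iff)
  then show ?thesis by (simp add: bonferroni_sum_def)
qed

lemma bonferroni_sum_Suc_insert:
  assumes "finite P" "p \<notin> P"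
  shows "bonferroni_sum (insert p P) x (Suc n) = bonferroni_sum P x (Suc n) - x p * bonferroni_sum P x n"
proof -
  have "(\<Sum>D | D \<subseteq> P \<and> Suc (card D) \<le> Suc n. \<Prod>q\<in>insert p D. - x q)
      = (\<Sum>D | D \<subseteq> P \<and> card D \<le> n. - x p * (\<Prod>q\<in>D. - x q))"
  proof (intro sum.cong refl)
    fix D assume "D \<in> {D. D \<subseteq> P \<and> card D \<le> n}"
    then have "finite D" "p \<notin> D" using assms finite_subset by auto
    then show "(\<Prod>q\<in>insert p D. - x q) = - x p * (\<Prod>q\<in>D. - x q)" by simp
  qed auto
  then show ?thesis
    unfolding bonferroni_sum_def sum_subsets_insert[OF assms, where Q = "\<lambda>k. k \<le> Suc n"]
    by (simp add: sum_distrib_left sum_negf)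
qed

text \<open>Allowing weights in \<open>[0, 1]\<close> covers both the indicator functions and the densities in the sieve.\<close>

lemma bonferroni_inequality:
  assumes "finite P" "\<And>q. q \<in> P \<Longrightarrow> 0 \<le> x q \<and> x q \<le> 1"
  shows "0 \<le> (-1) ^ n * (bonferroni_sum P x n - (\<Prod>q\<in>P. 1 - x q))"
  using assms
proof (induction P arbitrary: n rule: finite_induct)
  case empty
  have e: "{D. D \<subseteq> {} \<and> card D \<le> n} = {{} :: 'a set}" by auto
  show ?case unfolding bonferroni_sum_def e by simp
next
  case (insert p P)
  have x: "0 \<le> x p" "x p \<le> 1" using insert.prems by auto
  show ?case
  proof (cases n)
    case 0
    have "(\<Prod>q\<in>insert p P. 1 - x q) \<le> 1" using insert.prems by (intro prod_le_1) auto
    then show ?thesis using 0 insert.hyps by (simp add: bonferroni_sum_0)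
  next
    case (Suc m)
    let ?X = "\<Prod>q\<in>P. 1 - x q"
    \<comment> \<open>With the sign included, the error for the larger set is a nonnegative
      combination of the errors for \<open>P\<close> at levels \<open>Suc m\<close> and
      \<open>m\<close>; hence the induction keeps \<open>n\<close> arbitrary.\<close>
    have "(-1) ^ n * (bonferroni_sum (insert p P) x n - (\<Prod>q\<in>insert p P. 1 - x q))
        = (-1) ^ Suc m * (bonferroni_sum P x (Suc m) - ?X) + x p * ((-1) ^ m * (bonferroni_sum P x m - ?X))"
      using insert.hyps by (simp add: Suc bonferroni_sum_Suc_insert algebra_simps)
    moreover have "0 \<le> (-1) ^ k * (bonferroni_sum P x k - ?X)" for k
      using insert.prems by (intro insert.IH) auto
    ultimately show ?thesis using x by (metis add_nonneg_nonneg mult_nonneg_nonneg)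
  qed
qed

lemma bonferroni_sum_Suc:
  assumes "finite P"
  shows "bonferroni_sum P x (Suc n) = bonferroni_sum P x n + (-1) ^ Suc n * elementary_sym P x (Suc n)"
proof -
  have e: "{D. D \<subseteq> P \<and> card D \<le> Suc n} = {D. D \<subseteq> P \<and> card D \<le> n} \<union> {D. D \<subseteq> P \<and> card D = Suc n}"
    by auto
  have "(\<Sum>D | D \<subseteq> P \<and> card D = Suc n. \<Prod>q\<in>D. - x q) = (-1) ^ Suc n * elementary_sym P x (Suc n)"
    unfolding elementary_sym_def sum_distrib_left
    by (intro sum.cong) (auto simp: prod_uminus)
  then show ?thesis unfolding bonferroni_sum_def e using assms
    by (subst sum.union_disjoint) auto
qed

text \<open>Expanding the n-th power of the sum yields every product over an n-element set n! times.
  The induction uses only the first two terms of the binomial expansion of (s + x p)^n.\<close>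

lemma elementary_sym_le:
  assumes "finite P" "\<And>q. q \<in> P \<Longrightarrow> 0 \<le> x q"
  shows "elementary_sym P x n \<le> (\<Sum>q\<in>P. x q) ^ n / fact n"
  using assms
proof (induction P arbitrary: n rule: finite_induct)
  case empty
  have e: "{D. D \<subseteq> {} \<and> card D = n} = (if n = 0 then {{}} else {})" by auto
  show ?case unfolding elementary_sym_def e by simp
next
  case (insert p P)
  define s where "s = (\<Sum>q\<in>P. x q)"
  have s: "0 \<le> s" "0 \<le> x p" using insert.prems by (auto simp: s_def intro: sum_nonneg)
  have fin: "D \<subseteq> P \<Longrightarrow> finite D" for D using insert.hyps finite_subset by blast
  show ?case
  proof (cases n)
    case 0
    have "{D. D \<subseteq> insert p P \<and> card D = 0} = {{}}"
      using insert.hyps finite_subset[of _ "insert p P"] by (auto simp: card_eq_0_iff)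
    then show ?thesis using 0 by (simp add: elementary_sym_def)
  next
    case (Suc m)
    have "(\<Sum>D | D \<subseteq> P \<and> Suc (card D) = Suc m. \<Prod>q\<in>insert p D. x q)
        = (\<Sum>D | D \<subseteq> P \<and> card D = m. x p * (\<Prod>q\<in>D. x q))"
      using insert.hyps fin by (intro sum.cong) (auto intro!: prod.insert)
    then have "elementary_sym (insert p P) x n = elementary_sym P x n + x p * elementary_sym P x m"
      unfolding elementary_sym_def Suc sum_subsets_insert[OF insert.hyps(1,2), where Q = "\<lambda>k. k = Suc m"]
      by (simp add: sum_distrib_left)
    also have "\<dots> \<le> s ^ n / fact n + x p * (s ^ m / fact m)"
      using insert s unfolding s_def by (intro add_mono mult_left_mono) auto
    also have "\<dots> = (s ^ Suc m + real (Suc m) * x p * s ^ m) / fact n"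
    proof -
      have "A / (k * F) + B * (C / F) = (A + k * B * C) / (k * F)" if "k > 0" "F > 0" for A B C k F :: real
        using that by (simp add: field_simps)
      then show ?thesis unfolding Suc fact_Suc by (simp del: of_nat_Suc)
    qed
    also have "\<dots> \<le> (s + x p) ^ Suc m / fact n"
    proof (intro divide_right_mono)
      have "s ^ m \<le> (s + x p) ^ m" for m using s by (intro power_mono) auto
      have "s ^ Suc m + real (Suc m) * x p * s ^ m \<le> (s + x p) ^ Suc m"
      proof (induction m)
        case (Suc m)
        have "s ^ Suc (Suc m) + real (Suc (Suc m)) * x p * s ^ Suc m
            = s * (s ^ Suc m + real (Suc m) * x p * s ^ m) + x p * s ^ Suc m"
          by (simp add: algebra_simps)
        also have "\<dots> \<le> s * (s + x p) ^ Suc m + x p * (s + x p) ^ Suc m"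
          using Suc s by (intro add_mono mult_left_mono power_mono) auto
        finally show ?case by (simp add: algebra_simps)
      qed simp
      then show "s ^ Suc m + real (Suc m) * x p * s ^ m \<le> (s + x p) ^ Suc m" .
    qed simp
    finally show ?thesis using insert.hyps by (simp add: Suc s_def add.commute)
  qed
qed

section \<open>Periodic sets of integers and the Chinese remainder theorem\<close>

definition periodic :: "int \<Rightarrow> int set \<Rightarrow> bool" where
  "periodic M S \<longleftrightarrow> M > 0 \<and> (\<forall>x. x mod M \<in> S \<longleftrightarrow> x \<in> S)"

lemma periodic_mod: "periodic M S \<Longrightarrow> x mod M \<in> S \<longleftrightarrow> x \<in> S"
  by (auto simp: periodic_def)

lemma card_periodic_block:
  assumes "periodic M S"
  shows "card ({a..<a + M} \<inter> S) = card ({0..<M} \<inter> S)"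
proof (rule bij_betw_same_card[of "\<lambda>x. x mod M"], rule bij_betwI[where g = "\<lambda>y. a + (y - a) mod M"])
  have M: "M > 0" using assms by (simp add: periodic_def)
  show "(\<lambda>x. x mod M) \<in> {a..<a + M} \<inter> S \<rightarrow> {0..<M} \<inter> S"
    using M by (auto simp: periodic_mod[OF assms])
  show "(\<lambda>y. a + (y - a) mod M) \<in> {0..<M} \<inter> S \<rightarrow> {a..<a + M} \<inter> S"
  proof
    fix y assume y: "y \<in> {0..<M} \<inter> S"
    have "(a + (y - a) mod M) mod M = y mod M" by (simp add: mod_simps)
    then have "a + (y - a) mod M \<in> S" using y periodic_mod[OF assms] by (metis IntD2)
    then show "a + (y - a) mod M \<in> {a..<a + M} \<inter> S" using M by auto
  qed
  show "a + (x mod M - a) mod M = x" if "x \<in> {a..<a + M} \<inter> S" for x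
  proof -
    have "(x mod M - a) mod M = (x - a) mod M" by (simp add: mod_simps)
    also have "\<dots> = x - a" using that by (intro mod_pos_pos_trivial) auto
    finally show ?thesis by simp
  qed
  show "(a + (y - a) mod M) mod M = y" if "y \<in> {0..<M} \<inter> S" for y
    using that by (simp add: mod_simps)
qed

lemma card_periodic_blocks:
  assumes "periodic M S"
  shows "card ({a..<a + int k * M} \<inter> S) = k * card ({0..<M} \<inter> S)"
proof (induction k)
  case (Suc k)
  have M: "M > 0" using assms by (simp add: periodic_def)
  have "{a..<a + int (Suc k) * M} \<inter> S
      = ({a..<a + int k * M} \<inter> S) \<union> ({a + int k * M..<(a + int k * M) + M} \<inter> S)"
    using M by (auto simp: algebra_simps) (smt (verit) mult_nonneg_nonneg of_nat_0_le_iff)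
  also have "card \<dots> = card ({a..<a + int k * M} \<inter> S) + card ({a + int k * M..<(a + int k * M) + M} \<inter> S)"
    by (rule card_Un_disjoint) auto
  finally show ?case using Suc card_periodic_block[OF assms] by simp
qed simp

text \<open>The interval lies between \<open>k\<close> and \<open>k + 1\<close> full periods, so
  both the count and the expected value lie within the same window of width one period's
  count.\<close>

lemma card_periodic_interval:
  fixes H :: nat
  assumes "periodic M S"
  shows "\<bar>real (card ({a..<a + int H} \<inter> S)) - real H * (real (card ({0..<M} \<inter> S)) / of_int M)\<bar>
    \<le> real (card ({0..<M} \<inter> S))"
proof -
  have M: "M > 0" using assms by (simp add: periodic_def)
  define \<rho> where "\<rho> = real (card ({0..<M} \<inter> S))"
  define k where "k = nat (int H div M)"
  have k: "int k * M \<le> int H" "int H \<le> int (Suc k) * M"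
  proof -
    have "int k = int H div M" using M by (simp add: k_def pos_imp_zdiv_nonneg_iff)
    then have "int H = int k * M + int H mod M" by simp
    moreover have "int (Suc k) * M = int k * M + M" by (simp add: algebra_simps)
    ultimately show "int k * M \<le> int H" "int H \<le> int (Suc k) * M"
      using pos_mod_bound[OF M, of "int H"] pos_mod_sign[OF M, of "int H"] by linarith+
  qed
  have "card ({a..<a + int k * M} \<inter> S) \<le> card ({a..<a + int H} \<inter> S)"
    using k by (intro card_mono) auto
  then have "k * card ({0..<M} \<inter> S) \<le> card ({a..<a + int H} \<inter> S)"
    by (simp only: card_periodic_blocks[OF assms])
  then have lo: "real k * \<rho> \<le> card ({a..<a + int H} \<inter> S)"
    unfolding \<rho>_def by (metis of_nat_le_iff of_nat_mult)
  have "card ({a..<a + int H} \<inter> S) \<le> card ({a..<a + int (Suc k) * M} \<inter> S)"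
    using k by (intro card_mono) auto
  then have "card ({a..<a + int H} \<inter> S) \<le> Suc k * card ({0..<M} \<inter> S)"
    by (simp only: card_periodic_blocks[OF assms])
  then have hi: "card ({a..<a + int H} \<inter> S) \<le> real (Suc k) * \<rho>"
    unfolding \<rho>_def by (metis of_nat_le_iff of_nat_mult)
  have "real k * of_int M \<le> real H" "real H \<le> real (Suc k) * of_int M"
    using k by (metis of_int_le_iff of_int_mult of_int_of_nat_eq)+
  then have HM: "real k \<le> real H / of_int M" "real H / of_int M \<le> real (Suc k)"
    using M by (simp_all add: field_simps)
  have "\<rho> \<ge> 0" by (simp add: \<rho>_def)
  then have "real k * \<rho> \<le> real H / of_int M * \<rho>" "real H / of_int M * \<rho> \<le> real (Suc k) * \<rho>"
    using HM by (intro mult_right_mono; simp)+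
  then show ?thesis using lo hi unfolding \<rho>_def[symmetric] by (simp add: algebra_simps abs_le_iff)
qed

lemma periodic_Int:
  assumes "periodic M S" "periodic N T"
  shows "periodic (M * N) (S \<inter> T)"
proof -
  have "x mod (M * N) \<in> S \<longleftrightarrow> x \<in> S" "x mod (M * N) \<in> T \<longleftrightarrow> x \<in> T" for x
    using periodic_mod[OF assms(1), of "x mod (M * N)"] periodic_mod[OF assms(1), of x]
      periodic_mod[OF assms(2), of "x mod (M * N)"] periodic_mod[OF assms(2), of x]
    by (simp_all add: mod_mod_cancel)
  then show ?thesis using assms by (auto simp: periodic_def)
qed

lemma card_periodic_Int:
  assumes S: "periodic M S" and T: "periodic N T" and cop: "coprime M N"
  shows "card ({0..<M * N} \<inter> (S \<inter> T)) = card ({0..<M} \<inter> S) * card ({0..<N} \<inter> T)"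
proof -
  have pos: "M > 0" "N > 0" using S T by (auto simp: periodic_def)
  let ?f = "\<lambda>x. (x mod M, x mod N)"
  have "bij_betw ?f ({0..<M * N} \<inter> (S \<inter> T)) (({0..<M} \<inter> S) \<times> ({0..<N} \<inter> T))"
    unfolding bij_betw_def
  proof
    show "inj_on ?f ({0..<M * N} \<inter> (S \<inter> T))"
    proof (rule inj_onI)
      fix x y assume xy: "x \<in> {0..<M * N} \<inter> (S \<inter> T)" "y \<in> {0..<M * N} \<inter> (S \<inter> T)" "?f x = ?f y"
      then have "[x = y] (mod M)" "[x = y] (mod N)" by (auto simp: Cong.cong_def)
      then have "[x = y] (mod M * N)" using cop by (simp add: coprime_cong_mult)
      then show "x = y" using xy by (auto simp: Cong.cong_def)
    qed
    show "?f ` ({0..<M * N} \<inter> (S \<inter> T)) = ({0..<M} \<inter> S) \<times> ({0..<N} \<inter> T)"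
    proof
      show "?f ` ({0..<M * N} \<inter> (S \<inter> T)) \<subseteq> ({0..<M} \<inter> S) \<times> ({0..<N} \<inter> T)"
        using pos by (auto simp: periodic_mod[OF S] periodic_mod[OF T])
      show "({0..<M} \<inter> S) \<times> ({0..<N} \<inter> T) \<subseteq> ?f ` ({0..<M * N} \<inter> (S \<inter> T))"
      proof
        fix z assume "z \<in> ({0..<M} \<inter> S) \<times> ({0..<N} \<inter> T)"
        then obtain y w where z: "z = (y, w)" "y \<in> {0..<M}" "y \<in> S" "w \<in> {0..<N}" "w \<in> T" by auto
        obtain x where "[x = y] (mod M)" "[x = w] (mod N)"
          using binary_chinese_remainder_int[OF cop] by blast
        then have x: "x mod M = y" "x mod N = w" using z by (auto simp: Cong.cong_def)
        define x' where "x' = x mod (M * N)"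
        have x': "x' mod M = y" "x' mod N = w" using x by (auto simp: x'_def mod_mod_cancel)
        have "x' \<in> {0..<M * N} \<inter> (S \<inter> T)"
          using x' z pos periodic_mod[OF S, of x'] periodic_mod[OF T, of x'] by (auto simp: x'_def)
        then show "z \<in> ?f ` ({0..<M * N} \<inter> (S \<inter> T))" using x' z by force
      qed
    qed
  qed
  from bij_betw_same_card[OF this] show ?thesis by (simp only: card_cartesian_product)
qed

lemma periodic_INT_squares:
  fixes B :: "nat \<Rightarrow> int set"
  assumes "finite D" "\<And>q. q \<in> D \<Longrightarrow> prime q" "\<And>q. q \<in> D \<Longrightarrow> periodic (int q ^ 2) (B q)"
  shows "periodic (\<Prod>q\<in>D. int q ^ 2) (\<Inter>q\<in>D. B q)
    \<and> card ({0..<\<Prod>q\<in>D. int q ^ 2} \<inter> (\<Inter>q\<in>D. B q)) = (\<Prod>q\<in>D. card ({0..<int q ^ 2} \<inter> B q))"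
  using assms
proof (induction D rule: finite_induct)
  case empty
  then show ?case by (auto simp: periodic_def)
next
  case (insert p D)
  have IH: "periodic (\<Prod>q\<in>D. int q ^ 2) (\<Inter>q\<in>D. B q)"
    "card ({0..<\<Prod>q\<in>D. int q ^ 2} \<inter> (\<Inter>q\<in>D. B q)) = (\<Prod>q\<in>D. card ({0..<int q ^ 2} \<inter> B q))"
    using insert.IH insert.prems by auto
  have p: "periodic (int p ^ 2) (B p)" using insert.prems by auto
  have "coprime (int p ^ 2) (\<Prod>q\<in>D. int q ^ 2)"
  proof (rule prod_coprime_right)
    fix q assume "q \<in> D"
    then have "p \<noteq> q" "prime p" "prime q" using insert by auto
    then show "coprime (int p ^ 2) (int q ^ 2)" by (simp add: primes_coprime)
  qed
  then show ?case
    using insert.hyps periodic_Int[OF p IH(1)] card_periodic_Int[OF p IH(1)] IH(2) by simp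
qed

text \<open>Inclusion-exclusion is cut at the even level J - 1, which bounds the sifted set from
  above. Every intersection has density the product of the densities, with an error of at most its
  number of residues. The first error term comes from comparing the truncated sum with the full
  product, the second from the boundary effects.\<close>

lemma brun_sieve:
  fixes B :: "nat \<Rightarrow> int set" and P :: "nat set" and H J :: nat
  defines "\<rho> \<equiv> \<lambda>q. real (card ({0..<int q ^ 2} \<inter> B q))"
  defines "E \<equiv> \<Sum>q\<in>P. \<rho> q / real q ^ 2"
  assumes P: "finite P" "\<And>q. q \<in> P \<Longrightarrow> prime q" and per: "\<And>q. q \<in> P \<Longrightarrow> periodic (int q ^ 2) (B q)"
    and J: "odd J"
  shows "real (card {x \<in> {a..<a + int H}. \<forall>q\<in>P. x \<notin> B q})
    \<le> real H * (exp (- E) + E ^ J / fact J) + real J * (1 + (\<Sum>q\<in>P. \<rho> q)) ^ J"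
proof -
  define I where "I = {a..<a + int H}"
  define n where "n = J - 1"
  have n: "J = Suc n" "even n" using J by (auto simp: n_def elim: oddE)
  define g where "g q = \<rho> q / real q ^ 2" for q
  define ind where "ind x q = (if x \<in> B q then 1 else 0 :: real)" for x :: int and q
  let ?Ds = "{D. D \<subseteq> P \<and> card D \<le> n}"
  have finDs: "finite ?Ds" using P by simp
  have finD: "D \<subseteq> P \<Longrightarrow> finite D" for D using P finite_subset by blast
  have \<rho>0: "\<rho> q \<ge> 0" for q by (simp add: \<rho>_def)
  have \<rho>le: "\<rho> q \<le> real q ^ 2" for q
  proof -
    have "card ({0..<int q ^ 2} \<inter> B q) \<le> card {0..<int q ^ 2}" by (intro card_mono) auto
    then show ?thesis unfolding \<rho>_def
      by simp (metis nat_int of_nat_le_iff of_nat_power)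
  qed
  have g01: "0 \<le> g q" "g q \<le> 1" if "q \<in> P" for q
    using \<rho>0[of q] \<rho>le[of q] P(2)[OF that] by (auto simp: g_def prime_gt_0_nat)
  have one: "(\<Prod>q\<in>P. 1 - ind x q) = (if \<forall>q\<in>P. x \<notin> B q then 1 else 0)" for x
    using P(1) by (auto simp: ind_def prod_zero_iff)
  have "real (card {x \<in> I. \<forall>q\<in>P. x \<notin> B q}) = (\<Sum>x\<in>I. \<Prod>q\<in>P. 1 - ind x q)"
    unfolding one by (simp add: I_def sum.If_cases Int_def)
  also have "\<dots> \<le> (\<Sum>x\<in>I. bonferroni_sum P (ind x) n)"
  proof (rule sum_mono)
    fix x
    have "0 \<le> (-1) ^ n * (bonferroni_sum P (ind x) n - (\<Prod>q\<in>P. 1 - ind x q))"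
      by (rule bonferroni_inequality) (auto simp: P ind_def)
    then show "(\<Prod>q\<in>P. 1 - ind x q) \<le> bonferroni_sum P (ind x) n" using n by simp
  qed
  also have "\<dots> = (\<Sum>D\<in>?Ds. \<Sum>x\<in>I. \<Prod>q\<in>D. - ind x q)"
    unfolding bonferroni_sum_def by (rule sum.swap)
  also have "\<dots> \<le> (\<Sum>D\<in>?Ds. real H * (\<Prod>q\<in>D. - g q) + (\<Prod>q\<in>D. \<rho> q))"
  proof (rule sum_mono)
    fix D assume D: "D \<in> ?Ds"
    then have fD: "finite D" using finD by auto
    let ?S = "\<Inter>q\<in>D. B q" and ?M = "\<Prod>q\<in>D. int q ^ 2"
    have per': "periodic ?M ?S" and c: "card ({0..<?M} \<inter> ?S) = (\<Prod>q\<in>D. card ({0..<int q ^ 2} \<inter> B q))"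
      using periodic_INT_squares[OF fD, of B] P per D by blast+
    have c': "real (card ({0..<?M} \<inter> ?S)) = (\<Prod>q\<in>D. \<rho> q)" unfolding c \<rho>_def by simp
    have gD: "(\<Prod>q\<in>D. \<rho> q) / of_int ?M = (\<Prod>q\<in>D. g q)" by (simp add: g_def prod_dividef)
    have "(\<Prod>q\<in>D. - ind x q) = (-1) ^ card D * (if x \<in> ?S then 1 else 0)" for x
      using fD by (auto simp: prod_uminus ind_def prod_zero_iff)
    then have s: "(\<Sum>x\<in>I. \<Prod>q\<in>D. - ind x q) = (-1) ^ card D * real (card (I \<inter> ?S))"
      by (simp add: sum_distrib_left[symmetric] I_def sum.If_cases Int_def)
    have b: "\<bar>real (card (I \<inter> ?S)) - real H * (\<Prod>q\<in>D. g q)\<bar> \<le> (\<Prod>q\<in>D. \<rho> q)"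
      using card_periodic_interval[OF per', of a H] unfolding c' gD I_def .
    have "(-1) ^ card D * real (card (I \<inter> ?S)) - real H * (\<Prod>q\<in>D. - g q)
        = (-1) ^ card D * (real (card (I \<inter> ?S)) - real H * (\<Prod>q\<in>D. g q))"
      by (simp add: prod_uminus algebra_simps)
    also have "\<dots> \<le> \<bar>(-1) ^ card D * (real (card (I \<inter> ?S)) - real H * (\<Prod>q\<in>D. g q))\<bar>" by simp
    also have "\<dots> \<le> (\<Prod>q\<in>D. \<rho> q)" using b by (simp add: abs_mult)
    finally show "(\<Sum>x\<in>I. \<Prod>q\<in>D. - ind x q) \<le> real H * (\<Prod>q\<in>D. - g q) + (\<Prod>q\<in>D. \<rho> q)"
      unfolding s by simp
  qed
  also have "\<dots> = real H * bonferroni_sum P g n + (\<Sum>D\<in>?Ds. \<Prod>q\<in>D. \<rho> q)"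
    by (simp add: bonferroni_sum_def sum.distrib sum_distrib_left)
  also have "\<dots> \<le> real H * (exp (- E) + E ^ J / fact J) + real J * (1 + (\<Sum>q\<in>P. \<rho> q)) ^ J"
  proof (intro add_mono mult_left_mono)
    \<comment> \<open>The odd level \<open>J\<close> bounds the product from below, and level J - 1
      exceeds level \<open>J\<close> by exactly one elementary symmetric function.\<close>
    have "0 \<le> (-1) ^ J * (bonferroni_sum P g J - (\<Prod>q\<in>P. 1 - g q))"
      by (rule bonferroni_inequality) (use P g01 in auto)
    then have "bonferroni_sum P g J \<le> (\<Prod>q\<in>P. 1 - g q)" using J by simp
    moreover have "(\<Prod>q\<in>P. 1 - g q) \<le> (\<Prod>q\<in>P. exp (- g q))"
      using g01 by (intro prod_mono) (auto simp: exp_ge_one_minus_x_over_n_power_n intro: exp_ge_add_one_self[of "- g _", simplified])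
    moreover have "(\<Prod>q\<in>P. exp (- g q)) = exp (- E)"
      using P by (simp add: E_def g_def exp_sum[symmetric] sum_negf)
    moreover have "elementary_sym P g J \<le> E ^ J / fact J"
      unfolding E_def g_def[symmetric] by (rule elementary_sym_le) (use P g01 in auto)
    moreover have "bonferroni_sum P g J = bonferroni_sum P g n - elementary_sym P g J"
      using bonferroni_sum_Suc[OF P(1), of g n] n by simp
    ultimately show "bonferroni_sum P g n \<le> exp (- E) + E ^ J / fact J" by linarith
    let ?R = "\<Sum>q\<in>P. \<rho> q"
    have R0: "?R \<ge> 0" using \<rho>0 by (intro sum_nonneg) auto
    have "?Ds = (\<Union>i\<in>{..n}. {D. D \<subseteq> P \<and> card D = i})" by auto
    then have "(\<Sum>D\<in>?Ds. \<Prod>q\<in>D. \<rho> q) = (\<Sum>i\<le>n. elementary_sym P \<rho> i)"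
      unfolding elementary_sym_def using P by (simp only:) (subst sum.UNION_disjoint, auto)
    also have "\<dots> \<le> (\<Sum>i\<le>n. (1 + ?R) ^ J)"
    proof (rule sum_mono)
      fix i assume i: "i \<in> {..n}"
      have "elementary_sym P \<rho> i \<le> ?R ^ i / fact i" by (rule elementary_sym_le) (use P \<rho>0 in auto)
      also have "\<dots> \<le> ?R ^ i / 1" using R0 by (intro divide_left_mono) auto
      also have "\<dots> \<le> (1 + ?R) ^ i" using R0 by (simp add: power_mono)
      also have "\<dots> \<le> (1 + ?R) ^ J" using R0 i n by (intro power_increasing) auto
      finally show "elementary_sym P \<rho> i \<le> (1 + ?R) ^ J" .
    qed
    also have "\<dots> = real J * (1 + ?R) ^ J" using n by simp
    finally show "(\<Sum>D\<in>?Ds. \<Prod>q\<in>D. \<rho> q) \<le> real J * (1 + ?R) ^ J" .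
  qed simp
  finally show ?thesis unfolding I_def .
qed

section \<open>Local densities\<close>

lemma periodicI:
  assumes "M > 0" "\<And>x y. M dvd x - y \<Longrightarrow> x \<in> S \<Longrightarrow> y \<in> S"
  shows "periodic M S"
  unfolding periodic_def
proof (intro conjI allI)
  fix x
  have "M dvd x mod M - x" "M dvd x - x mod M"
    by (simp_all add: mod_eq_dvd_iff[symmetric])
  then show "x mod M \<in> S \<longleftrightarrow> x \<in> S" using assms(2) by blast
qed fact

lemma card_affine_preimage:
  fixes s c M :: int
  assumes "M > 0" "coprime s M"
  shows "card ({0..<M} \<inter> {u. Q ((s * u + c) mod M)}) = card ({0..<M} \<inter> {w. Q w})"
proof -
  let ?f = "\<lambda>u. (s * u + c) mod M"
  have inj: "inj_on ?f {0..<M}"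
  proof (rule inj_onI)
    fix u u' assume u: "u \<in> {0..<M}" "u' \<in> {0..<M}" "?f u = ?f u'"
    then have "M dvd (s * u + c) - (s * u' + c)" by (simp add: mod_eq_dvd_iff)
    then have "M dvd s * (u - u')" by (simp add: algebra_simps)
    then have "M dvd u - u'" using assms(2) by (simp add: coprime_commute coprime_dvd_mult_right_iff)
    then have "u mod M = u' mod M" by (simp add: mod_eq_dvd_iff)
    then show "u = u'" using u by simp
  qed
  have "?f ` {0..<M} \<subseteq> {0..<M}" using assms by auto
  then have surj: "?f ` {0..<M} = {0..<M}" using inj by (intro endo_inj_surj) auto
  have "{0..<M} \<inter> {w. Q w} = ?f ` ({0..<M} \<inter> {u. Q (?f u)})"
  proof -
    have "?f ` ({0..<M} \<inter> {u. Q (?f u)}) = ?f ` {0..<M} \<inter> {w. Q w}" by blast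
    then show ?thesis unfolding surj by simp
  qed
  moreover have "inj_on ?f ({0..<M} \<inter> {u. Q (?f u)})" using inj by (rule inj_on_subset) auto
  ultimately show ?thesis by (simp add: card_image)
qed

lemma multiples_below_square:
  assumes "q > 0"
  shows "{0..<int q ^ 2} \<inter> {w. int q dvd w} = (\<lambda>k. int q * int k) ` {..<q}"
proof
  show "(\<lambda>k. int q * int k) ` {..<q} \<subseteq> {0..<int q ^ 2} \<inter> {w. int q dvd w}"
    using assms by (auto simp: power2_eq_square)
  show "{0..<int q ^ 2} \<inter> {w. int q dvd w} \<subseteq> (\<lambda>k. int q * int k) ` {..<q}"
  proof
    fix w assume w: "w \<in> {0..<int q ^ 2} \<inter> {w. int q dvd w}"
    then obtain k where k: "w = int q * k" by (auto elim: dvdE)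
    have "0 \<le> k" "k < int q" using w assms unfolding k
      by (auto simp: power2_eq_square zero_le_mult_iff)
    then show "w \<in> (\<lambda>k. int q * int k) ` {..<q}"
      unfolding k by (intro image_eqI[of _ _ "nat k"]) auto
  qed
qed

text \<open>The affine map permutes the residues modulo q^2. Among these there are \<open>q\<close>
  multiples of \<open>q\<close>, and all but 0 are divisible by \<open>q\<close> exactly
  once.\<close>

lemma card_affine_dvd:
  fixes s c :: int
  assumes q: "prime q" and s: "\<not> int q dvd s"
  shows "card ({0..<int q ^ 2} \<inter> {u. int q dvd s * u + c}) = q"
    "card ({0..<int q ^ 2} \<inter> {u. int q dvd s * u + c \<and> \<not> int q ^ 2 dvd s * u + c}) = q - 1"
proof -
  let ?M = "int q ^ 2"
  have q0: "q > 0" using q prime_gt_0_nat by blast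
  have cop: "coprime s ?M" using q s
    by (simp add: coprime_commute[of s] prime_imp_coprime)
  have inj: "inj_on (\<lambda>k. int q * int k) {..<q}" using q0 by (auto simp: inj_on_def)
  have dm: "int q dvd x mod ?M \<longleftrightarrow> int q dvd x" for x
    by (rule dvd_mod_iff) (simp add: power2_eq_square)
  have "card ({0..<?M} \<inter> {u. int q dvd s * u + c}) = card ({0..<?M} \<inter> {w. int q dvd w})"
    using card_affine_preimage[of ?M s "\<lambda>w. int q dvd w" c] q0 cop by (simp add: dm)
  also have "\<dots> = q" unfolding multiples_below_square[OF q0] by (simp add: card_image[OF inj])
  finally show "card ({0..<?M} \<inter> {u. int q dvd s * u + c}) = q" .
  have "card ({0..<?M} \<inter> {u. int q dvd s * u + c \<and> \<not> ?M dvd s * u + c})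
      = card ({0..<?M} \<inter> {w. int q dvd w \<and> w \<noteq> 0})"
    using card_affine_preimage[of ?M s "\<lambda>w. int q dvd w \<and> w \<noteq> 0" c] q0 cop
    by (simp add: dm dvd_eq_mod_eq_0[of ?M])
  also have "{0..<?M} \<inter> {w. int q dvd w \<and> w \<noteq> 0} = (\<lambda>k. int q * int k) ` {..<q} - {0}"
    unfolding multiples_below_square[OF q0, symmetric] by auto
  also have "card \<dots> = q - 1"
    using q0 by (subst card_Diff_singleton) (auto simp: card_image[OF inj] image_iff)
  finally show "card ({0..<?M} \<inter> {u. int q dvd s * u + c \<and> \<not> ?M dvd s * u + c}) = q - 1" .
qed

text \<open>
  The modulus \<open>q\<^sup>2\<close> is needed for \<open>q \<equiv> 3\<close> mod 4: a sum of two squares may be divisible by \<open>q\<^sup>2\<close>, but not by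
  \<open>q\<close> exactly once.
\<close>

definition sieved_residues :: "int \<Rightarrow> (int \<times> int) set \<Rightarrow> nat \<Rightarrow> int set" where
  "sieved_residues v T q = (if q mod 4 = 1 then {u. int q dvd u\<^sup>2 + v\<^sup>2}
     else {u. \<exists>s t. (s, t) \<in> T \<and> int q dvd s * u + t * v \<and> \<not> int q ^ 2 dvd s * u + t * v})"

lemma periodic_sieved_residues:
  assumes "q > 0"
  shows "periodic (int q ^ 2) (sieved_residues v T q)"
proof (rule periodicI)
  fix x y assume d: "int q ^ 2 dvd x - y" and x: "x \<in> sieved_residues v T q"
  have d1: "int q dvd x - y" using d by (meson dvd_trans dvd_triv_left power2_eq_square dvd_refl dvd_power zero_less_numeral)
  have sq: "(x\<^sup>2 + v\<^sup>2) - (y\<^sup>2 + v\<^sup>2) = (x - y) * (x + y)" by (simp add: power2_eq_square algebra_simps)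
  have 1: "int q dvd x\<^sup>2 + v\<^sup>2 \<Longrightarrow> int q dvd y\<^sup>2 + v\<^sup>2"
    using d1 sq by (metis dvd_diff_right_iff dvd_mult2 dvd_diff_commute)
  have lin: "(s * x + c) - (s * y + c) = (x - y) * s" for s c by (simp add: algebra_simps)
  have 2: "k dvd s * x + c \<longleftrightarrow> k dvd s * y + c" if "k dvd x - y" for k s c
    using that lin[of s c] by (metis dvd_diff_left_iff dvd_diff_right_iff dvd_mult2)
  show "y \<in> sieved_residues v T q" using x 1 2[OF d] 2[OF d1]
    unfolding sieved_residues_def by (cases "q mod 4 = 1") simp_all
qed (use assms in simp)

text \<open>With i a square root of -1 modulo \<open>q\<close>, u^2 + v^2 splits as (u + i v)(u - i
  v). The two roots differ because \<open>q\<close> does not divide 2 i v, and each lifts to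
  \<open>q\<close> residues modulo q^2.\<close>

lemma card_sieved_residues_1:
  assumes q: "prime q" "q mod 4 = 1" and v: "\<not> int q dvd v"
  shows "card ({0..<int q ^ 2} \<inter> sieved_residues v T q) = 2 * q"
proof -
  obtain i where i: "int q dvd i\<^sup>2 + 1" using ex_sqrt_minus_one_mod_prime[OF q] by blast
  have pq: "prime (int q)" using q by simp
  have ni: "\<not> int q dvd i"
  proof
    assume "int q dvd i"
    then have "int q dvd i\<^sup>2" by (simp add: power2_eq_square)
    then have "int q dvd 1" using i by (metis dvd_add_right_iff)
    then show False using pq not_prime_unit by blast
  qed
  have n1: "\<not> int q dvd 1" using pq not_prime_unit by blast
  have n2: "\<not> int q dvd 2" using q prime_ge_2_nat[of q] by (cases "q = 2") (auto dest!: zdvd_imp_le)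
  let ?A = "{0..<int q ^ 2} \<inter> {u. int q dvd 1 * u + i * v}"
  let ?B = "{0..<int q ^ 2} \<inter> {u. int q dvd 1 * u + - (i * v)}"
  have "int q dvd u\<^sup>2 + v\<^sup>2 \<longleftrightarrow> int q dvd u + i * v \<or> int q dvd u - i * v" for u
  proof -
    have "u\<^sup>2 + v\<^sup>2 = (u + i * v) * (u - i * v) + (i\<^sup>2 + 1) * v\<^sup>2"
      by (simp add: power2_eq_square algebra_simps)
    then have "int q dvd u\<^sup>2 + v\<^sup>2 \<longleftrightarrow> int q dvd (u + i * v) * (u - i * v)"
      using i by (simp add: dvd_add_left_iff)
    then show ?thesis using pq prime_dvd_mult_iff by blast
  qed
  then have "{0..<int q ^ 2} \<inter> sieved_residues v T q = ?A \<union> ?B" using q by (auto simp: sieved_residues_def)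
  moreover have "?A \<inter> ?B = {}"
  proof (rule ccontr)
    assume "?A \<inter> ?B \<noteq> {}"
    then obtain u where "int q dvd 1 * u + i * v" "int q dvd 1 * u + - (i * v)" by auto
    then have "int q dvd (1 * u + i * v) - (1 * u + - (i * v))" by (rule dvd_diff)
    then have "int q dvd 2 * (i * v)" by simp
    then show False using pq n2 ni v prime_dvd_mult_iff by blast
  qed
  ultimately show ?thesis
    using card_affine_dvd(1)[OF q(1) n1, of "i * v"] card_affine_dvd(1)[OF q(1) n1, of "- (i * v)"]
    by (simp add: card_Un_disjoint)
qed

text \<open>If \<open>q\<close> divided two forms at the same \<open>u\<close>, eliminating
  \<open>u\<close> would make it divide (s t' - s' t) v. So the classes belonging to different forms
  are disjoint and their counts add up.\<close>

lemma card_sieved_residues_3: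
  assumes q: "prime q" "q mod 4 = 3" and v: "\<not> int q dvd v" and T: "finite T"
    and s: "\<And>s t. (s, t) \<in> T \<Longrightarrow> \<not> int q dvd s"
    and cross: "\<And>s t s' t'. (s, t) \<in> T \<Longrightarrow> (s', t') \<in> T \<Longrightarrow> (s, t) \<noteq> (s', t') \<Longrightarrow> \<not> int q dvd s * t' - s' * t"
  shows "card ({0..<int q ^ 2} \<inter> sieved_residues v T q) = card T * (q - 1)"
proof -
  have pq: "prime (int q)" using q by simp
  define F where "F = (\<lambda>(s, t). {0..<int q ^ 2} \<inter> {u. int q dvd s * u + t * v \<and> \<not> int q ^ 2 dvd s * u + t * v})"
  have "{0..<int q ^ 2} \<inter> sieved_residues v T q = (\<Union>z\<in>T. F z)" using q by (auto simp: sieved_residues_def F_def)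
  also have "card \<dots> = (\<Sum>z\<in>T. card (F z))"
  proof (rule card_UN_disjoint)
    show "\<forall>z\<in>T. \<forall>w\<in>T. z \<noteq> w \<longrightarrow> F z \<inter> F w = {}"
    proof (intro ballI impI)
      fix z w assume zw: "z \<in> T" "w \<in> T" "z \<noteq> w"
      obtain s t s' t' where e: "z = (s, t)" "w = (s', t')" by (cases z, cases w) auto
      show "F z \<inter> F w = {}"
      proof (rule ccontr)
        assume "F z \<inter> F w \<noteq> {}"
        then obtain u where "int q dvd s * u + t * v" "int q dvd s' * u + t' * v"
          by (auto simp: F_def e)
        then have "int q dvd s * (s' * u + t' * v) - s' * (s * u + t * v)" by (intro dvd_diff dvd_mult)
        also have "s * (s' * u + t' * v) - s' * (s * u + t * v) = (s * t' - s' * t) * v"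
          by (simp add: algebra_simps)
        finally show False using cross[of s t s' t'] zw e v pq prime_dvd_mult_iff by blast
      qed
    qed
    show "\<forall>z\<in>T. finite (F z)" by (auto simp: F_def)
  qed (use T in auto)
  also have "\<dots> = (\<Sum>z\<in>T. q - 1)"
    using card_affine_dvd(2)[OF q(1)] s by (intro sum.cong) (auto simp: F_def)
  finally show ?thesis by simp
qed

lemma sum_inverse_squares_le:
  assumes "finite P" "\<And>q. q \<in> P \<Longrightarrow> q \<ge> (2::nat)"
  shows "(\<Sum>q\<in>P. 1 / real q ^ 2) \<le> 1"
proof -
  obtain N where N: "P \<subseteq> {..N}" using finite_nat_iff_bounded_le assms(1) by blast
  have "(\<Sum>q\<in>P. 1 / real q ^ 2) \<le> (\<Sum>q=2..Suc N. 1 / real q ^ 2)"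
    using N assms(2) by (intro sum_mono2) auto
  also have "\<dots> \<le> 1 - 1 / real (Suc N)"
  proof (induction N)
    case (Suc N)
    have "1 / real (Suc (Suc N)) ^ 2 \<le> 1 / real (Suc N) - 1 / real (Suc (Suc N))"
    proof -
      have "1 / (a + 1) ^ 2 \<le> 1 / a - 1 / (a + 1)" if a: "a > 0" for a :: real
      proof -
        have "1 / (a + 1) ^ 2 \<le> 1 / (a * (a + 1))"
          using a by (intro divide_left_mono) (auto simp: power2_eq_square)
        also have "\<dots> = 1 / a - 1 / (a + 1)" using a by (simp add: field_simps)
        finally show ?thesis .
      qed
      from this[of "real (Suc N)"] show ?thesis by (simp add: add.commute)
    qed
    then show ?case using Suc by simp
  qed simp
  finally show ?thesis by (rule order_trans) simp
qed

section \<open>Prime divisors of a given integer\<close>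

abbreviation prime_divisors :: "int \<Rightarrow> nat set" where
  "prime_divisors w \<equiv> {q. prime q \<and> int q dvd w}"

lemma card_prime_divisors_le:
  fixes w :: int
  assumes "w \<noteq> 0"
  shows "finite (prime_divisors w)"
    "real (card (prime_divisors w)) * ln 2 \<le> ln \<bar>real_of_int w\<bar>"
proof -
  define n where "n = nat \<bar>w\<bar>"
  have n: "n > 0" using assms by (simp add: n_def)
  have e: "prime_divisors w = prime_factors n"
  proof -
    have "int q dvd w \<longleftrightarrow> q dvd n" for q
      unfolding n_def by (metis dvd_abs_iff int_dvd_int_iff int_nat_eq abs_ge_zero)
    then show ?thesis using n by (auto simp: prime_factors_dvd)
  qed
  show "finite (prime_divisors w)" unfolding e by simp
  have "2 ^ card (prime_factors n) = (\<Prod>q\<in>prime_factors n. 2::nat)" by simp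
  also have "\<dots> \<le> (\<Prod>q\<in>prime_factors n. q ^ multiplicity q n)"
  proof (intro prod_mono conjI)
    fix q assume q: "q \<in> prime_factors n"
    then have "2 \<le> q" by (intro prime_ge_2_nat) auto
    moreover have "multiplicity q n > 0" using q by (simp add: prime_factors_multiplicity)
    ultimately show "2 \<le> q ^ multiplicity q n" by (meson le_trans self_le_power le_numeral_extra(4) one_le_numeral)
  qed simp
  also have "\<dots> = n" using n by (simp add: prime_factorization_nat[symmetric])
  finally have "real (2 ^ card (prime_factors n)) \<le> real n" by (simp only: of_nat_le_iff)
  then have "ln (2 ^ card (prime_factors n)) \<le> ln (real n)" by (intro ln_mono) auto
  moreover have "real n = \<bar>real_of_int w\<bar>" by (simp add: n_def)
  ultimately show "real (card (prime_divisors w)) * ln 2 \<le> ln \<bar>real_of_int w\<bar>"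
    unfolding e by (simp add: ln_realpow)
qed

text \<open>Primes up to ln X contribute ln ln ln X + O(1) by Mertens. There are at most ln X / ln 2
  larger ones, each contributing less than 1 / ln X. For X = x this is ln L + O(1), so leaving out
  such primes in the sieve costs a power of \<open>L\<close>.\<close>

lemma sum_inverse_prime_divisors:
  "\<exists>c\<ge>0. \<forall>X::real. \<forall>w::int. ln X \<ge> 2 \<longrightarrow> w \<noteq> 0 \<longrightarrow> \<bar>real_of_int w\<bar> \<le> X \<longrightarrow>
     recips (prime_divisors w) \<le> ln (ln (ln X)) + c"
proof -
  obtain c where c: "\<And>z. z \<ge> 2 \<Longrightarrow> \<bar>recips (primes_le z) - ln (ln z)\<bar> \<le> c"
    and c0: "c \<ge> 0" using mertens_second by blast
  have "recips (prime_divisors w) \<le> ln (ln (ln X)) + (c + 2)"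
    if X: "ln X \<ge> 2" and w: "w \<noteq> 0" "\<bar>real_of_int w\<bar> \<le> X" for X :: real and w :: int
  proof -
    let ?S = "prime_divisors w"
    let ?A = "{q\<in>?S. real q \<le> ln X}" and ?B = "{q\<in>?S. real q > ln X}"
    note fin = card_prime_divisors_le(1)[OF w(1)]
    have "(\<Sum>q\<in>?S. 1 / real q) = (\<Sum>q\<in>?A. 1 / real q) + (\<Sum>q\<in>?B. 1 / real q)"
    proof (subst sum.union_disjoint[symmetric])
      show "finite ?A" "finite ?B" by (rule finite_subset[OF _ fin]; auto)+
    qed (auto intro!: sum.cong)
    also have "(\<Sum>q\<in>?A. 1 / real q) \<le> recips (primes_le (ln X))"
      by (intro sum_mono2 finite_primes_le) auto
    also have "\<dots> \<le> ln (ln (ln X)) + c" using c[OF X] by linarith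
    also have "(\<Sum>q\<in>?B. 1 / real q) \<le> (\<Sum>q\<in>?B. 1 / ln X)"
      using X by (intro sum_mono divide_left_mono) auto
    also have "\<dots> = real (card ?B) / ln X" by simp
    also have "\<dots> \<le> real (card ?S) / ln X"
      using X fin by (intro divide_right_mono of_nat_mono card_mono) auto
    also have "\<dots> \<le> 2"
    proof -
      have "ln (2::real) \<ge> 1/2"
        using ln_one_minus_pos_upper_bound[of "1/2::real"] by (auto simp: ln_div)
      then have "real (card ?S) * (1/2) \<le> real (card ?S) * ln 2" by (intro mult_left_mono) auto
      also have "\<dots> \<le> ln \<bar>real_of_int w\<bar>" by (rule card_prime_divisors_le(2)[OF w(1)])
      also have "\<dots> \<le> ln X" using w by (intro ln_mono) auto
      finally show ?thesis using X by (simp add: field_simps)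
    qed
    finally show ?thesis by simp
  qed
  then show ?thesis using c0 by (intro exI[of _ "c + 2"]) auto
qed

section \<open>The sieve bound\<close>

text \<open>For primes dividing none of these integers the classes excluded by different conditions are disjoint.\<close>

definition exceptional :: "int \<Rightarrow> (int \<times> int) set \<Rightarrow> int set" where
  "exceptional v T = insert v (fst ` T \<union> (\<lambda>((s, t), (s', t')). s * t' - s' * t) ` (T \<times> T - Id))"

lemma exceptional_cases:
  assumes "w \<in> exceptional v T"
  obtains (diag) "w = v" | (fst) s t where "(s, t) \<in> T" "w = s"
    | (cross) s t s' t' where "(s, t) \<in> T" "(s', t') \<in> T" "(s, t) \<noteq> (s', t')" "w = s * t' - s' * t"
proof -
  from assms consider "w = v" | "w \<in> fst ` T"
    | "w \<in> (\<lambda>((s, t), (s', t')). s * t' - s' * t) ` (T \<times> T - Id)"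
    unfolding exceptional_def by blast
  then show thesis
  proof cases
    case 3
    then obtain y where y: "y \<in> T \<times> T - Id" "w = (\<lambda>((s, t), (s', t')). s * t' - s' * t) y" by blast
    obtain s t s' t' where "y = ((s, t), (s', t'))" by (metis surj_pair)
    then show thesis using y by (intro cross[of s t s' t']) auto
  qed (use diag fst in auto)
qed

lemma finite_exceptional: "finite T \<Longrightarrow> finite (exceptional v T)"
  by (simp add: exceptional_def)

lemma card_exceptional_le:
  assumes "finite T"
  shows "card (exceptional v T) \<le> 1 + card T + card T ^ 2"
proof -
  have "card ((\<lambda>((s, t), (s', t')). s * t' - s' * t) ` (T \<times> T - Id)) \<le> card (T \<times> T - Id)"
    using assms by (intro card_image_le) auto
  also have "\<dots> \<le> card (T \<times> T)" using assms by (intro card_mono) auto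
  finally have "card ((\<lambda>((s, t), (s', t')). s * t' - s' * t) ` (T \<times> T - Id)) \<le> card T ^ 2"
    by (simp only: card_cartesian_product power2_eq_square)
  moreover have "card (fst ` T) \<le> card T" using assms by (rule card_image_le)
  ultimately show ?thesis unfolding exceptional_def
    using assms by (auto simp: card_insert_if intro!: order_trans[OF card_Un_le])
qed

text \<open>A sieving prime contributes 2/q in the class 1, and h (q-1)/q^2 in the class 3. The
  terms h/q^2 sum to at most \<open>h\<close>, and a left-out prime would have contributed at most
  (h+2)/q.\<close>

lemma density_sum:
  fixes T :: "(int \<times> int) set" and v :: int and z :: real
  defines "P \<equiv> {q \<in> primes_res 1 z \<union> primes_res 3 z. \<forall>w\<in>exceptional v T. \<not> int q dvd w}"
  defines "E \<equiv> \<Sum>q\<in>P. real (card ({0..<int q ^ 2} \<inter> sieved_residues v T q)) / real q ^ 2"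
  assumes T: "finite T" "card T = h" and exc0: "\<And>w. w \<in> exceptional v T \<Longrightarrow> w \<noteq> 0"
  shows "E \<le> (real h + 2) * recips (primes_le z)"
    and "E \<ge> 2 * recips (primes_res 1 z) + real h * recips (primes_res 3 z)
      - (real h + 2) * (\<Sum>w\<in>exceptional v T. recips (prime_divisors w)) - real h"
proof -
  let ?U = "primes_res 1 z \<union> primes_res 3 z"
  define f where "f q = (if q mod 4 = 1 then 2 / real q else real h / real q)" for q :: nat
  have finU: "finite ?U" by (simp add: finite_primes_res)
  have finP: "finite P" and PU: "P \<subseteq> ?U" using finU by (auto simp: P_def)
  have prP: "prime q" if "q \<in> ?U" for q using that by (auto simp: primes_res_def)
  have card: "real (card ({0..<int q ^ 2} \<inter> sieved_residues v T q)) / real q ^ 2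
      = (if q mod 4 = 1 then f q else f q - real h / real q ^ 2)" if "q \<in> P" for q
  proof -
    have q: "prime q" "q mod 4 = 1 \<or> q mod 4 = 3" and nd: "\<And>w. w \<in> exceptional v T \<Longrightarrow> \<not> int q dvd w"
      using that by (auto simp: P_def primes_res_def)
    have v: "\<not> int q dvd v" using nd by (simp add: exceptional_def)
    have q0: "q > 0" using q prime_gt_0_nat by blast
    show ?thesis
    proof (cases "q mod 4 = 1")
      case True
      then show ?thesis using card_sieved_residues_1[OF q(1) True v] q0 by (simp add: f_def power2_eq_square)
    next
      case False
      then have q3: "q mod 4 = 3" using q by simp
      have "card ({0..<int q ^ 2} \<inter> sieved_residues v T q) = card T * (q - 1)"
      proof (rule card_sieved_residues_3[OF q(1) q3 v T(1)])
        show "\<not> int q dvd s" if "(s, t) \<in> T" for s t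
          using that by (intro nd) (force simp: exceptional_def)
        show "\<not> int q dvd s * t' - s' * t" if "(s, t) \<in> T" "(s', t') \<in> T" "(s, t) \<noteq> (s', t')" for s t s' t'
          using that by (intro nd) (force simp: exceptional_def)
      qed
      then show ?thesis using False q0 T(2)
        by (simp add: f_def power2_eq_square of_nat_diff Suc_le_eq field_simps)
    qed
  qed
  have f0: "0 \<le> f q" "f q \<le> (real h + 2) * (1 / real q)" for q
    by (auto simp: f_def divide_right_mono)
  have "E = (\<Sum>q\<in>P. if q mod 4 = 1 then f q else f q - real h / real q ^ 2)"
    unfolding E_def using card by (intro sum.cong) auto
  also have "\<dots> \<le> (\<Sum>q\<in>P. (real h + 2) * (1 / real q))"
  proof (intro sum_mono)
    fix q
    have "0 \<le> real h / real q ^ 2" by simp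
    then show "(if q mod 4 = 1 then f q else f q - real h / real q ^ 2) \<le> (real h + 2) * (1 / real q)"
    proof (cases "q mod 4 = 1")
      case False
      have "f q - real h / real q ^ 2 \<le> (real h + 2) * (1 / real q)"
        using f0(2)[of q] \<open>0 \<le> real h / real q ^ 2\<close> by linarith
      then show ?thesis using False by simp
    qed (use f0(2)[of q] in simp)
  qed
  also have "\<dots> = (real h + 2) * (\<Sum>q\<in>P. 1 / real q)" by (simp add: sum_distrib_left)
  also have "\<dots> \<le> (real h + 2) * recips (primes_le z)"
    by (intro mult_left_mono sum_mono2 finite_primes_le) (auto simp: P_def primes_res_def)
  finally show "E \<le> (real h + 2) * recips (primes_le z)" .
  have "(\<Sum>q\<in>P. f q) - real h \<le> (\<Sum>q\<in>P. f q) - real h * (\<Sum>q\<in>P. 1 / real q ^ 2)"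
  proof -
    have "(\<Sum>q\<in>P. 1 / real q ^ 2) \<le> 1"
      using prime_ge_2_nat[OF prP[OF subsetD[OF PU]]] by (intro sum_inverse_squares_le finP)
    then have "real h * (\<Sum>q\<in>P. 1 / real q ^ 2) \<le> real h * 1" by (intro mult_left_mono) auto
    then show ?thesis by simp
  qed
  also have "\<dots> = (\<Sum>q\<in>P. f q - real h / real q ^ 2)"
    by (simp add: sum_subtractf sum_distrib_left)
  also have "\<dots> \<le> (\<Sum>q\<in>P. if q mod 4 = 1 then f q else f q - real h / real q ^ 2)"
    by (intro sum_mono) auto
  also have "\<dots> = E" unfolding E_def using card by (intro sum.cong) auto
  finally have E1: "(\<Sum>q\<in>P. f q) - real h \<le> E" .
  have "(\<Sum>q\<in>?U. f q) = (\<Sum>q\<in>P. f q) + (\<Sum>q\<in>?U - P. f q)"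
    using sum.subset_diff[OF PU finU, of f] by simp
  \<comment> \<open>Each left-out prime divides an exceptional integer; primes dividing several of
    them are counted repeatedly.\<close>
  moreover have "(\<Sum>q\<in>?U - P. f q) \<le> (real h + 2) * (\<Sum>w\<in>exceptional v T. recips (prime_divisors w))"
  proof -
    have "(\<Sum>q\<in>?U - P. f q) \<le> (\<Sum>q\<in>?U - P. (real h + 2) * (1 / real q))"
      by (intro sum_mono f0)
    also have "\<dots> = (real h + 2) * (\<Sum>q\<in>?U - P. 1 / real q)" by (simp add: sum_distrib_left)
    also have "\<dots> \<le> (real h + 2) * (\<Sum>w\<in>exceptional v T. recips (prime_divisors w))"
    proof (intro mult_left_mono)
      have "(\<Sum>q\<in>?U - P. 1 / real q)
          \<le> (\<Sum>y\<in>(SIGMA w:exceptional v T. prime_divisors w). 1 / real (snd y))"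
      proof (rule sum_le_included[where i = snd])
        show "finite (SIGMA w:exceptional v T. prime_divisors w)"
          using finite_exceptional[OF T(1)] card_prime_divisors_le(1) exc0 by (intro finite_SigmaI) auto
        show "\<forall>q\<in>?U - P. \<exists>y\<in>(SIGMA w:exceptional v T. prime_divisors w).
            snd y = q \<and> 1 / real q \<le> 1 / real (snd y)"
        proof
          fix q assume "q \<in> ?U - P"
          then obtain w where "w \<in> exceptional v T" "int q dvd w" "prime q" using prP by (auto simp: P_def)
          then show "\<exists>y\<in>(SIGMA w:exceptional v T. prime_divisors w).
            snd y = q \<and> 1 / real q \<le> 1 / real (snd y)" by (intro bexI[of _ "(w, q)"]) auto
        qed
      qed (use finU in auto)
      also have "\<dots> = (\<Sum>w\<in>exceptional v T. recips (prime_divisors w))"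
        using finite_exceptional[OF T(1)] card_prime_divisors_le(1) exc0
        by (subst sum.Sigma) (auto simp: case_prod_unfold)
      finally show "(\<Sum>q\<in>?U - P. 1 / real q) \<le> (\<Sum>w\<in>exceptional v T. recips (prime_divisors w))" .
    qed simp
    finally show ?thesis .
  qed
  moreover have "(\<Sum>q\<in>?U. f q) = 2 * recips (primes_res 1 z) + real h * recips (primes_res 3 z)"
  proof -
    have "primes_res 1 z \<inter> primes_res 3 z = {}" by (auto simp: primes_res_def)
    then have "(\<Sum>q\<in>?U. f q) = (\<Sum>q\<in>primes_res 1 z. f q) + (\<Sum>q\<in>primes_res 3 z. f q)"
      by (simp add: sum.union_disjoint finite_primes_res)
    also have "(\<Sum>q\<in>primes_res 1 z. f q) = (\<Sum>q\<in>primes_res 1 z. 2 * (1 / real q))"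
      by (intro sum.cong) (auto simp: f_def primes_res_def)
    also have "(\<Sum>q\<in>primes_res 3 z. f q) = (\<Sum>q\<in>primes_res 3 z. real h * (1 / real q))"
      by (intro sum.cong) (auto simp: f_def primes_res_def)
    finally show ?thesis by (simp only: sum_distrib_left)
  qed
  ultimately show "E \<ge> 2 * recips (primes_res 1 z) + real h * recips (primes_res 3 z)
      - (real h + 2) * (\<Sum>w\<in>exceptional v T. recips (prime_divisors w)) - real h"
    using E1 by linarith
qed

text \<open>Since J! >= (J/e)^J, the quotient is at most (e E / J)^J. The factor 9 bounds e^2, which
  makes the base at most 1/e.\<close>

lemma power_over_fact_le:
  fixes E :: real
  assumes "0 \<le> E" "9 * E \<le> real J" "J > 0"
  shows "E ^ J / fact J \<le> exp (- real J)"
proof -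
  have "exp (2::real) = exp 1 * exp 1" by (simp add: exp_add[symmetric])
  also have "\<dots> \<le> 3 * 3" using exp_le by (intro mult_mono) auto
  finally have "exp (2::real) \<le> 9" by simp
  then have "E * exp 2 \<le> E * 9" using assms by (intro mult_left_mono) auto
  then have "E \<le> real J * exp (-2)" using assms by (simp add: exp_minus field_simps)
  then have "E ^ J \<le> (real J * exp (-2)) ^ J" using assms by (intro power_mono) auto
  also have "\<dots> = exp (real J * ln (real J) - 2 * real J)"
  proof -
    have "(real J * exp (-2)) ^ J = (exp (ln (real J) - 2)) ^ J"
      using assms by (simp add: exp_diff exp_minus divide_inverse)
    then show ?thesis by (simp add: exp_of_nat_mult[symmetric] algebra_simps)
  qed
  finally have 1: "E ^ J \<le> exp (real J * ln (real J) - 2 * real J)" .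
  have "exp (real J * ln (real J) - real J) \<le> exp (ln (fact J))"
    using ln_fact_ge[of J] by (simp only: exp_le_cancel_iff)
  also have "exp (ln (fact J)) = (fact J :: real)" by (rule exp_ln) simp
  finally have 2: "exp (real J * ln (real J) - real J) \<le> fact J" .
  have "E ^ J / fact J \<le> exp (real J * ln (real J) - 2 * real J) / exp (real J * ln (real J) - real J)"
    using 1 2 assms by (intro frac_le) auto
  also have "\<dots> = exp (- real J)" by (simp add: exp_diff[symmetric])
  finally show ?thesis .
qed

lemma sqrt_exp_power: "sqrt (exp L) ^ n = exp (real n * L / 2)"
proof -
  have "sqrt (exp L) = exp (L / 2)"
    by (rule real_sqrt_unique) (auto simp: power2_eq_square exp_add[symmetric])
  then show ?thesis by (simp add: exp_of_nat_mult[symmetric])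
qed

text \<open>Every threshold below is a condition on L = ln ln x alone. The bound 1 < x0 keeps ln x
  positive.\<close>

lemma eventually_ge_exp:
  fixes Q :: "real \<Rightarrow> bool"
  assumes "\<forall>\<^sub>F L in at_top. Q L"
  shows "\<exists>x0>1. \<forall>x\<ge>x0. Q (ln (ln x))"
proof -
  have "filterlim (\<lambda>x::real. ln (ln x)) at_top at_top" by real_asymp
  then have "\<forall>\<^sub>F x in at_top. Q (ln (ln x))" by (rule eventually_compose_filterlim[OF assms])
  then obtain x0 where "\<forall>x\<ge>x0. Q (ln (ln x))" by (auto simp: eventually_at_top_linorder)
  then show ?thesis by (intro exI[of _ "max x0 2"]) auto
qed

lemma eventually_quadratic_le_exp: "\<forall>\<^sub>F L in at_top. a * L ^ 2 \<le> exp (L::real)"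
proof -
  have "\<forall>\<^sub>F L in at_top. L * L ^ 2 \<le> exp (L::real)" by real_asymp
  then show ?thesis using eventually_ge_at_top[of a]
  proof eventually_elim
    case (elim L)
    have "a * L ^ 2 \<le> L * L ^ 2" using elim by (intro mult_right_mono) auto
    then show ?case using elim by linarith
  qed
qed

text \<open>In terms of L = ln ln x this is exp(e^L / (c L)), the form in which it is
  estimated.\<close>

abbreviation level :: "real \<Rightarrow> real \<Rightarrow> real" where
  "level c x \<equiv> x powr (1 / (c * ln (ln x)))"

abbreviation survivors :: "nat \<Rightarrow> real \<Rightarrow> int \<Rightarrow> (int \<times> int) set \<Rightarrow> int set" where
  "survivors R w v T \<equiv> {u \<in> {- int R..int R}.
     (\<forall>q. prime q \<and> real q \<le> w \<longrightarrow> \<not> int q dvd u\<^sup>2 + v\<^sup>2) \<and>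
     (\<forall>(s, t)\<in>T. \<exists>b\<in>sums_two_squares. int b = s * u + t * v)}"

text \<open>Only primes up to z = exp(e^L / (D L^2)) are sieved, with truncation level
  \<open>J\<close> of order \<open>L\<close>. Going this far below the given level lowers ln ln z by
  2 ln L + O(1), hence costs a power of \<open>L\<close>, but brings the error of the pure sieve
  below the square root of the level.\<close>

lemma sieve_bound:
  fixes h :: nat and c0 :: real
  assumes c0: "c0 \<ge> 1"
  shows "\<exists>K A x0. K > 0 \<and> A \<ge> 0 \<and> (\<forall>x\<ge>x0. \<forall>T v R. finite T \<longrightarrow> card T = h \<longrightarrow>
    (\<forall>w\<in>exceptional v T. w \<noteq> 0 \<and> \<bar>real_of_int w\<bar> \<le> x) \<longrightarrow> level c0 x \<le> real R \<longrightarrow>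
    real (card (survivors R (level c0 x) v T))
      \<le> K * real R * ln (ln x) powr A / sqrt (ln x) ^ (h + 2))"
proof -
  obtain c1 where c1: "\<And>z. z \<ge> 2 \<Longrightarrow> \<bar>recips (primes_le z) - ln (ln z)\<bar> \<le> c1"
    and c10: "c1 \<ge> 0" using mertens_second by blast
  obtain c2 where c2: "\<And>z a. z \<ge> 2 \<Longrightarrow> a \<in> {1,3} \<Longrightarrow> \<bar>recips (primes_res a z) - ln (ln z) / 2\<bar> \<le> c2"
    and c20: "c2 \<ge> 0" using mertens_mod_4 by blast
  obtain c3 where c3: "\<And>X w. ln X \<ge> 2 \<Longrightarrow> w \<noteq> 0 \<Longrightarrow> \<bar>real_of_int w\<bar> \<le> X \<Longrightarrow>
     recips (prime_divisors w) \<le> ln (ln (ln X)) + c3"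
    and c30: "c3 \<ge> 0" using sum_inverse_prime_divisors by metis
  \<comment> \<open>The total density is at most (h+3) L, and \<open>power_over_fact_le\<close> asks
    for \<open>J\<close> to be at least 9 times that.\<close>
  define a where "a = 9 * (3 + real h)"
  \<comment> \<open>Chosen so that J <= 2 a L gives 5 J y <= e^L / (2 c0 L), half the exponent of
    the level.\<close>
  define D where "D = 20 * a * c0"
  define wn where "wn = 1 + real h + real h ^ 2"
  \<comment> \<open>The summand 1 accounts for the loss of 2 ln L in ln ln z, and \<open>wn\<close>
    for the number of exceptional integers, each of which costs (h+2) ln L.\<close>
  define A where "A = (real h + 2) * (1 + wn)"
  define B where "B = (real h + 2) / 2 * ln D + (real h + 2) * c2 + (real h + 2) * wn * c3 + real h"
  define K where "K = 3 * exp B + 4"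
  have a27: "a \<ge> 27" by (simp add: a_def)
  have "20 * 27 * 1 \<le> D" unfolding D_def using a27 c0 by (intro mult_mono) auto
  then have D1: "D \<ge> 540" by simp
  have wn0: "wn \<ge> 0" by (simp add: wn_def)
  have A0: "A \<ge> 0" using wn0 by (simp add: A_def)
  have ev: "\<forall>\<^sub>F L in at_top. L \<ge> 1 \<and> L \<ge> (2 + real h) * c1 \<and> D * L ^ 2 \<le> exp L \<and> c0 * (h + 2) * L ^ 2 \<le> exp L"
    by (intro eventually_conj eventually_ge_at_top eventually_quadratic_le_exp)
  obtain x0 where x0: "x0 > 1" "\<forall>x\<ge>x0. ln (ln x) \<ge> 1 \<and> ln (ln x) \<ge> (2 + real h) * c1 \<and>
      D * ln (ln x) ^ 2 \<le> exp (ln (ln x)) \<and> c0 * (h + 2) * ln (ln x) ^ 2 \<le> exp (ln (ln x))"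
    using eventually_ge_exp[OF ev] by blast
  have main: "real (card (survivors R (level c0 x) v T))
      \<le> K * real R * ln (ln x) powr A / sqrt (ln x) ^ (h + 2)" (is "real (card ?Sel) \<le> _")
    if x: "x \<ge> x0" and T: "finite T" "card T = h"
      and exc_facts: "\<And>w. w \<in> exceptional v T \<Longrightarrow> w \<noteq> 0" "\<And>w. w \<in> exceptional v T \<Longrightarrow> \<bar>real_of_int w\<bar> \<le> x"
      and R: "level c0 x \<le> real R" for x T v R
  proof -
    define L where "L = ln (ln x)"
    have x1: "x > 1" "x > 0" using x x0(1) by auto
    have lx: "ln x = exp L" using x1 by (simp add: L_def)
    have L1: "L \<ge> 1" and Lc: "L \<ge> (2 + real h) * c1" and LD: "D * L ^ 2 \<le> exp L"
      and Lh: "c0 * (h + 2) * L ^ 2 \<le> exp L"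
      using x0(2) x unfolding L_def by blast+
    have xp: "level c0 x = exp (exp L / (c0 * L))"
      using x1 lx by (simp add: powr_def L_def)
    define y where "y = exp L / (D * L ^ 2)"
    define z where "z = exp y"
    have L0: "L > 0" using L1 by simp
    have DL: "D * L ^ 2 > 0" using D1 L1 by simp
    have y1: "y \<ge> 1" using LD DL by (simp add: y_def)
    have "exp 1 \<le> z" using y1 by (simp add: z_def)
    moreover have "2 \<le> exp (1::real)" using exp_ge_add_one_self[of 1] by simp
    ultimately have z2: "z \<ge> 2" by linarith
    have lly: "ln (ln z) = L - ln D - 2 * ln L"
      using D1 L1 by (simp add: z_def y_def ln_div ln_mult ln_realpow)
    have lnD: "ln D \<ge> 0" and lnL: "ln L \<ge> 0" using D1 L1 by auto
    have zle: "z \<le> level c0 x"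
    proof -
      have "c0 * L \<le> D * L ^ 2"
      proof -
        have "1 \<le> 20 * a" using a27 by simp
        then have "c0 * 1 \<le> c0 * (20 * a)" using c0 by (intro mult_left_mono) auto
        then have "c0 \<le> D" unfolding D_def by (simp add: mult.commute)
        moreover have "L * 1 \<le> L * L" using L1 by (intro mult_left_mono) auto
        ultimately show ?thesis using c0 L1 by (intro mult_mono) (auto simp: power2_eq_square)
      qed
      then have "y \<le> exp L / (c0 * L)" unfolding y_def
        using c0 L0 D1 by (intro divide_left_mono mult_pos_pos) auto
      then show ?thesis by (simp add: xp z_def)
    qed
    define P where "P = {q \<in> primes_res 1 z \<union> primes_res 3 z. \<forall>w\<in>exceptional v T. \<not> int q dvd w}"
    define \<rho> where "\<rho> q = real (card ({0..<int q ^ 2} \<inter> sieved_residues v T q))" for q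
    define E where "E = (\<Sum>q\<in>P. \<rho> q / real q ^ 2)"
    have finP: "finite P" and prP: "\<And>q. q \<in> P \<Longrightarrow> prime q" and Pz: "\<And>q. q \<in> P \<Longrightarrow> real q \<le> z"
      using finite_primes_res by (auto simp: P_def primes_res_def)
    have \<rho>0: "\<rho> q \<ge> 0" for q by (simp add: \<rho>_def)
    have E0: "E \<ge> 0" unfolding E_def using \<rho>0 by (intro sum_nonneg) auto
    have dens: "E \<le> (real h + 2) * recips (primes_le z)"
      "E \<ge> 2 * recips (primes_res 1 z) + real h * recips (primes_res 3 z)
        - (real h + 2) * (\<Sum>w\<in>exceptional v T. recips (prime_divisors w)) - real h"
      using density_sum[of T h v z] T exc_facts(1) unfolding P_def \<rho>_def E_def by blast+
    have Eup: "E \<le> (real h + 3) * L"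
    proof -
      have "recips (primes_le z) \<le> L + c1"
        using c1[OF z2] lly lnD lnL by linarith
      then have "(real h + 2) * recips (primes_le z) \<le> (real h + 2) * (L + c1)"
        by (intro mult_left_mono) auto
      then show ?thesis using dens(1) Lc by (simp add: algebra_simps)
    qed
    have Elo: "- E \<le> - ((real h + 2) / 2 * L) + A * ln L + B"
    proof -
      have "(\<Sum>w\<in>exceptional v T. recips (prime_divisors w)) \<le> (\<Sum>w\<in>exceptional v T. ln L + c3)"
      proof (rule sum_mono)
        fix w assume w: "w \<in> exceptional v T"
        have "(2::real) \<le> exp 1" using exp_ge_add_one_self[of 1] by simp
        also have "\<dots> \<le> exp L" using L1 by simp
        finally have "ln x \<ge> 2" using lx by simp
        from c3[OF this exc_facts(1)[OF w] exc_facts(2)[OF w]]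
        show "recips (prime_divisors w) \<le> ln L + c3" by (simp add: L_def)
      qed
      also have "\<dots> = real (card (exceptional v T)) * (ln L + c3)" by simp
      also have "\<dots> \<le> wn * (ln L + c3)"
      proof (intro mult_right_mono)
        have "real (card (exceptional v T)) \<le> real (1 + card T + card T ^ 2)"
          using card_exceptional_le[OF T(1), of v] of_nat_le_iff by blast
        then show "real (card (exceptional v T)) \<le> wn" using T(2) by (simp add: wn_def)
      qed (use lnL c30 in auto)
      finally have W: "(real h + 2) * (\<Sum>w\<in>exceptional v T. recips (prime_divisors w))
          \<le> (real h + 2) * (wn * (ln L + c3))" by (intro mult_left_mono) auto
      have s1: "recips (primes_res 1 z) \<ge> (L - ln D - 2 * ln L) / 2 - c2"
        using c2[OF z2, of 1] lly by auto
      have "recips (primes_res 3 z) \<ge> (L - ln D - 2 * ln L) / 2 - c2"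
        using c2[OF z2, of 3] lly by auto
      then have s3: "real h * recips (primes_res 3 z) \<ge> real h * ((L - ln D - 2 * ln L) / 2 - c2)"
        by (intro mult_left_mono) auto
      have "- E \<le> - (2 * ((L - ln D - 2 * ln L) / 2 - c2)) - real h * ((L - ln D - 2 * ln L) / 2 - c2)
          + (real h + 2) * (wn * (ln L + c3)) + real h"
      proof -
        have "- e \<le> - (2 * s) - t + w' + r" if "2 * s' + t' - w - r \<le> e" "w \<le> w'" "s \<le> s'" "t \<le> t'"
          for e s s' t t' w w' r :: real
          using that by linarith
        from this[OF dens(2) W s1 s3] show ?thesis .
      qed
      also have "\<dots> = - ((real h + 2) / 2 * L) + A * ln L + B"
        by (simp add: A_def B_def field_simps)
      finally show ?thesis .
    qed
    \<comment> \<open>The main saving: half the primes exclude two classes and half exclude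
      \<open>h\<close>, so the density sums to (h+2)/2 times \<open>L\<close>.\<close>
    define Q where "Q = exp (- ((real h + 2) / 2 * L))"
    have Q: "Q = 1 / sqrt (ln x) ^ (h + 2)"
      unfolding lx sqrt_exp_power Q_def by (simp add: exp_minus field_simps)
    have LA: "L powr A = exp (A * ln L)" "L powr A \<ge> 1"
      using L0 A0 lnL by (auto simp: powr_def)
    have expE: "exp (- E) \<le> Q * L powr A * exp B"
    proof -
      have "exp (- E) \<le> exp (- ((real h + 2) / 2 * L) + A * ln L + B)" using Elo by simp
      then show ?thesis by (simp only: exp_add Q_def LA(1))
    qed
    define J where "J = 2 * nat \<lceil>a * L / 2\<rceil> + 1"
    have aL: "a * L \<ge> 27" using mult_mono[of 27 a 1 L] a27 L1 by simp
    have J: "odd J" "a * L \<le> real J" "real J \<le> 2 * (a * L)"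
    proof -
      define k where "k = nat \<lceil>a * L / 2\<rceil>"
      have "a * L / 2 \<le> real k" "real k \<le> a * L / 2 + 1"
        using aL unfolding k_def by linarith+
      moreover have "real J = 2 * real k + 1" by (simp add: J_def k_def)
      ultimately show "a * L \<le> real J" "real J \<le> 2 * (a * L)" using aL by linarith+
    qed (simp add: J_def)
    have J0: "J > 0" using J(1) by (cases J) auto
    have "9 * E \<le> a * L" using Eup by (simp add: a_def algebra_simps)
    then have "E ^ J / fact J \<le> exp (- real J)" using E0 J J0 by (intro power_over_fact_le) auto
    also have "\<dots> \<le> Q"
    proof -
      have "(real h + 2) / 2 \<le> a" by (simp add: a_def)
      then have "(real h + 2) / 2 * L \<le> a * L" using L1 by (intro mult_right_mono) auto
      then show ?thesis using J by (simp add: Q_def)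
    qed
    finally have EJ: "E ^ J / fact J \<le> Q" .
    have R1: "real R \<ge> exp (exp L / (c0 * L))" using R xp by simp
    have R2: "real R \<ge> 1"
    proof -
      have "exp L / (c0 * L) \<ge> 0" using c0 L0 by simp
      then have "exp (exp L / (c0 * L)) \<ge> 1" by simp
      then show ?thesis using R1 by linarith
    qed
    \<comment> \<open>At most \<open>z\<close> primes with at most z^2 residues each, together with
      J <= z^J, give z^(5J), no more than the square root of the level. The other half of that
      exponent exceeds (h+2) L / 2 and so pays for the factor \<open>Q\<close>.\<close>
    have err: "real J * (1 + (\<Sum>q\<in>P. \<rho> q)) ^ J \<le> real R * Q"
    proof -
      have "\<rho> q \<le> z ^ 2" if "q \<in> P" for q
      proof -
        have "card ({0..<int q ^ 2} \<inter> sieved_residues v T q) \<le> card {0..<int q ^ 2}" by (intro card_mono) auto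
        then have "\<rho> q \<le> real q ^ 2" unfolding \<rho>_def
          by simp (metis nat_int of_nat_le_iff of_nat_power)
        also have "\<dots> \<le> z ^ 2" using Pz[OF that] by (intro power_mono) auto
        finally show ?thesis .
      qed
      then have "(\<Sum>q\<in>P. \<rho> q) \<le> (\<Sum>q\<in>P. z ^ 2)" by (rule sum_mono)
      also have "\<dots> = real (card P) * z ^ 2" by simp
      also have "\<dots> \<le> z * z ^ 2"
      proof (intro mult_right_mono)
        have "P \<subseteq> {1..nat \<lfloor>z\<rfloor>}" using prP Pz by (auto simp: le_nat_floor Suc_le_eq prime_gt_0_nat)
        then have "card P \<le> card {1..nat \<lfloor>z\<rfloor>}" by (intro card_mono) auto
        then have "real (card P) \<le> real (nat \<lfloor>z\<rfloor>)" by simp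
        then show "real (card P) \<le> z" using z2 by linarith
      qed simp
      finally have "1 + (\<Sum>q\<in>P. \<rho> q) \<le> 1 + z * z ^ 2" by simp
      also have "\<dots> \<le> z ^ 4"
      proof -
        have "1 \<le> z * z ^ 2" using z2 one_le_power[of z 3] by (simp add: power_numeral_reduce)
        moreover have "2 * (z * z ^ 2) \<le> z * (z * z ^ 2)" using z2 by (intro mult_right_mono) auto
        ultimately show ?thesis by (simp add: power_numeral_reduce)
      qed
      finally have 1: "1 + (\<Sum>q\<in>P. \<rho> q) \<le> z ^ 4" .
      have "(1 + (\<Sum>q\<in>P. \<rho> q)) ^ J \<le> (z ^ 4) ^ J"
        using 1 \<rho>0 by (intro power_mono) (auto intro!: add_nonneg_nonneg sum_nonneg)
      moreover have "real J \<le> z ^ J"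
      proof -
        have "real J \<le> 2 ^ J" by (metis less_exp less_imp_le of_nat_le_iff of_nat_numeral of_nat_power)
        also have "\<dots> \<le> z ^ J" using z2 by (intro power_mono) auto
        finally show ?thesis .
      qed
      ultimately have "real J * (1 + (\<Sum>q\<in>P. \<rho> q)) ^ J \<le> z ^ J * (z ^ 4) ^ J"
        using z2 \<rho>0 by (intro mult_mono) (auto intro!: add_nonneg_nonneg sum_nonneg zero_le_power)
      also have "\<dots> = exp (5 * real J * y)"
        by (simp add: z_def power_mult_distrib[symmetric] power_mult[symmetric] exp_of_nat_mult[symmetric]
            exp_add[symmetric] algebra_simps)
      also have "\<dots> \<le> exp (exp L / (2 * c0 * L))"
      proof -
        have "5 * real J * y \<le> 5 * (2 * (a * L)) * y" using J y1 by (intro mult_right_mono mult_left_mono) auto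
        also have "\<dots> = exp L / (2 * c0 * L)"
          using L0 a27 c0 by (simp add: y_def D_def power2_eq_square field_simps)
        finally show ?thesis by simp
      qed
      also have "\<dots> \<le> exp (exp L / (c0 * L) - (real h + 2) / 2 * L)"
      proof -
        have "(real h + 2) / 2 * L \<le> exp L / (2 * c0 * L)"
          using Lh L0 c0 by (simp add: field_simps power2_eq_square)
        moreover have "exp L / (c0 * L) = exp L / (2 * c0 * L) + exp L / (2 * c0 * L)"
          using c0 L0 by (simp add: field_simps)
        moreover have "p \<le> q - r" if "r \<le> p" "q = p + p" for p q r :: real
          using that by simp
        ultimately show ?thesis unfolding exp_le_cancel_iff by blast
      qed
      also have "\<dots> = exp (exp L / (c0 * L)) * Q" unfolding Q_def exp_add[symmetric] by simp
      also have "\<dots> \<le> real R * Q" using R1 by (intro mult_right_mono) (auto simp: Q_def)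
      finally show ?thesis .
    qed
    have Q0: "Q > 0" by (simp add: Q_def)
    \<comment> \<open>Primes in the class 1 are excluded since z is at most the level, primes in the
      class 3 since a sum of two squares divisible by \<open>q\<close> is divisible by q^2. The
      symmetric interval is rewritten as a half-open one of length 2R + 1.\<close>
    have sub: "?Sel \<subseteq> {u \<in> {- int R..<- int R + int (2 * R + 1)}. \<forall>q\<in>P. u \<notin> sieved_residues v T q}"
    proof
      fix u assume u: "u \<in> ?Sel"
      have "u \<notin> sieved_residues v T q" if q: "q \<in> P" for q
      proof (cases "q mod 4 = 1")
        case True
        have "real q \<le> level c0 x" using Pz[OF q] zle by linarith
        then show ?thesis using u prP[OF q] True by (auto simp: sieved_residues_def)
      next
        case False
        then have q3: "q mod 4 = 3" using q by (auto simp: P_def primes_res_def)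
        have "int q ^ 2 dvd s * u + t * v" if st: "(s, t) \<in> T" and d: "int q dvd s * u + t * v" for s t
        proof -
          obtain b where b: "b \<in> sums_two_squares" "int b = s * u + t * v" using u st by auto
          have "q dvd b" using d b by (metis int_dvd_int_iff)
          then have "q\<^sup>2 dvd b" using sums_two_squares_dvd[OF b(1) prP[OF q] q3] by simp
          then show ?thesis using b by (metis int_dvd_int_iff of_nat_power)
        qed
        then show ?thesis using False by (auto simp: sieved_residues_def)
      qed
      then show "u \<in> {u \<in> {- int R..<- int R + int (2 * R + 1)}. \<forall>q\<in>P. u \<notin> sieved_residues v T q}"
        using u by auto
    qed
    have "real (card ?Sel) \<le> real (card {u \<in> {- int R..<- int R + int (2 * R + 1)}. \<forall>q\<in>P. u \<notin> sieved_residues v T q})"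
      by (intro of_nat_mono card_mono sub finite_subset[OF _ finite_atLeastLessThan_int]) blast
    also have "\<dots> \<le> real (2 * R + 1) * (exp (- E) + E ^ J / fact J) + real J * (1 + (\<Sum>q\<in>P. \<rho> q)) ^ J"
      unfolding E_def \<rho>_def
      by (rule brun_sieve) (use finP prP J(1) in \<open>auto intro: periodic_sieved_residues prime_gt_0_nat\<close>)
    also have "\<dots> \<le> (3 * real R) * (Q * L powr A * exp B + Q * L powr A) + real R * Q * L powr A"
    proof (rule add_mono)
      have "E ^ J / fact J \<le> Q * L powr A"
        using EJ Q0 LA(2) mult_left_mono[of 1 "L powr A" Q] by linarith
      then show "real (2 * R + 1) * (exp (- E) + E ^ J / fact J)
          \<le> (3 * real R) * (Q * L powr A * exp B + Q * L powr A)"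
        using R2 E0 expE by (intro mult_mono add_mono) auto
      have "real R * Q * 1 \<le> real R * Q * L powr A" using Q0 LA(2) by (intro mult_left_mono) auto
      then show "real J * (1 + (\<Sum>q\<in>P. \<rho> q)) ^ J \<le> real R * Q * L powr A" using err by linarith
    qed
    also have "\<dots> = K * real R * L powr A * Q" by (simp add: K_def algebra_simps)
    finally show ?thesis unfolding Q L_def by simp
  qed
  show ?thesis
  proof (rule exI[of _ K], rule exI[of _ A], rule exI[of _ x0], intro conjI allI impI)
    show "K > 0" by (simp add: K_def add_pos_pos)
    show "A \<ge> 0" by (rule A0)
  qed (use main in blast)
qed

section \<open>Sums over integers with a given number of prime factors\<close>

lemma omega_star_mult_prime_power:
  assumes "prime p" "odd p" "e > 0" "\<not> p dvd m" "m > 0"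
  shows "omega_star (p ^ e * m) = Suc (omega_star m)"
proof -
  have "prime_factors (p ^ e * m) = insert p (prime_factors m)"
    using assms by (subst prime_factors_product) (auto simp: prime_factors_power prime_prime_factors)
  then have "{q \<in> prime_factors (p ^ e * m). odd q} = insert p {q \<in> prime_factors m. odd q}"
    using assms by auto
  moreover have "p \<notin> {q \<in> prime_factors m. odd q}" using assms by auto
  ultimately show ?thesis unfolding omega_star_def by simp
qed

lemma odd_omega_star_0: "odd m \<Longrightarrow> omega_star m = 0 \<Longrightarrow> m = 1"
proof (rule ccontr)
  assume m: "odd m" "omega_star m = 0" "m \<noteq> 1"
  then obtain p where p: "prime p" "p dvd m" using prime_factor_nat by blast
  have "p \<in> {p \<in> prime_factors m. odd p}" using p m by (auto simp: prime_factors_dvd odd_pos elim: dvdE)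
  then show False using m by (auto simp: omega_star_def)
qed

lemma omega_star_0:
  assumes "omega_star m = 0" "\<not> 4 dvd m" "m > 0"
  shows "m = 1 \<or> m = 2"
proof (cases "odd m")
  case True
  then show ?thesis using odd_omega_star_0 assms by auto
next
  case False
  then obtain r where r: "m = 2 * r" by auto
  have "odd r" using assms(2) r by (auto elim!: evenE)
  have "{p \<in> prime_factors r. odd p} \<subseteq> {p \<in> prime_factors m. odd p}"
    using r assms by (auto simp: prime_factors_dvd)
  then have "omega_star r \<le> omega_star m"
    unfolding omega_star_def by (intro card_mono) auto
  then show ?thesis using odd_omega_star_0[of r] \<open>odd r\<close> assms r by simp
qed

text \<open>The bound \<open>N\<close> makes the set finite, and the estimate below is uniform in
  it. Excluding multiples of 4 leaves only 1 and 2 for j = 0, whence the factor 3/2.\<close>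

definition omega_fixed :: "nat set \<Rightarrow> nat \<Rightarrow> nat \<Rightarrow> nat set" where
  "omega_fixed P N j = {m. 0 < m \<and> m \<le> N \<and> \<not> 4 dvd m \<and> omega_star m = j \<and>
     (\<forall>q. prime q \<longrightarrow> odd q \<longrightarrow> q dvd m \<longrightarrow> q \<in> P)}"

lemma finite_omega_fixed: "finite (omega_fixed P N j)"
  by (rule finite_subset[of _ "{..N}"]) (auto simp: omega_fixed_def)

text \<open>Splitting off \<open>p\<^sup>e\<close> for every odd prime \<open>p\<close> dividing \<open>m\<close> counts \<open>m\<close> exactly \<open>\<omega>\<^sup>*(m)\<close> times.\<close>

lemma sum_inverse_omega_fixed_le:
  assumes P: "finite P" "\<And>p. p \<in> P \<Longrightarrow> prime p"
  shows "(\<Sum>m\<in>omega_fixed P N j. 1 / real m) \<le> 3 / 2 * (\<Sum>p\<in>P. 1 / (real p - 1)) ^ j / fact j"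
proof (induction j)
  case 0
  have "omega_fixed P N 0 \<subseteq> {1, 2}" using omega_star_0 by (auto simp: omega_fixed_def)
  then have "(\<Sum>m\<in>omega_fixed P N 0. 1 / real m) \<le> (\<Sum>m\<in>{1, 2::nat}. 1 / real m)"
    by (intro sum_mono2) auto
  then show ?case by simp
next
  case (Suc j)
  define S where "S = (\<Sum>p\<in>P. 1 / (real p - 1))"
  define F where "F j = (\<Sum>m\<in>omega_fixed P N j. 1 / real m)" for j
  have F0: "F j \<ge> 0" for j unfolding F_def by (intro sum_nonneg) auto
  have p1: "real p > 1" if "p \<in> P" for p using P(2)[OF that] prime_gt_1_nat by simp
  have S0: "S \<ge> 0" unfolding S_def using p1 by (intro sum_nonneg) (auto simp: less_imp_le)
  define od where "od m = {p \<in> prime_factors m. odd p}" for m :: nat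
  have fod: "finite (od m)" for m by (simp add: od_def)
  have "real (Suc j) * F (Suc j) = (\<Sum>m\<in>omega_fixed P N (Suc j). \<Sum>p\<in>od m. 1 / real m)"
    unfolding F_def sum_distrib_left
    by (intro sum.cong) (auto simp: omega_fixed_def omega_star_def od_def simp del: of_nat_Suc)
  also have "\<dots> = (\<Sum>x\<in>(SIGMA m:omega_fixed P N (Suc j). od m). 1 / real (fst x))"
    by (subst sum.Sigma) (auto simp: finite_omega_fixed fod case_prod_unfold)
  \<comment> \<open>The cofactor \<open>r\<close> of p^e is allowed to be any element for
    \<open>j\<close>, which only enlarges the sum. The range of \<open>e\<close> suffices because e
    < p^e <= m <= N; its geometric series gives 1/(p-1).\<close>
  also have "\<dots> \<le> (\<Sum>x\<in>P \<times> {1..N} \<times> omega_fixed P N j. (1 / real (fst x) ^ fst (snd x)) * (1 / real (snd (snd x))))"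
  proof (rule sum_le_included[where i = "\<lambda>(p, e, m). (p ^ e * m, p)"])
    show "\<forall>x\<in>(SIGMA m:omega_fixed P N (Suc j). od m). \<exists>y\<in>P \<times> {1..N} \<times> omega_fixed P N j.
        (case y of (p, e, m) \<Rightarrow> (p ^ e * m, p)) = x \<and>
        1 / real (fst x) \<le> (1 / real (fst y) ^ fst (snd y)) * (1 / real (snd (snd y)))"
    proof
      fix x assume "x \<in> (SIGMA m:omega_fixed P N (Suc j). od m)"
      then obtain m p where x: "x = (m, p)" and m: "m \<in> omega_fixed P N (Suc j)" and p: "p \<in> od m" by auto
      have pp: "prime p" "odd p" "p dvd m" using p by (auto simp: od_def prime_factors_dvd)
      have m0: "m > 0" "m \<le> N" and no: "omega_star m = Suc j" "\<not> 4 dvd m"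
        and mP: "\<And>q. prime q \<Longrightarrow> odd q \<Longrightarrow> q dvd m \<Longrightarrow> q \<in> P" using m by (auto simp: omega_fixed_def)
      define e where "e = multiplicity p m"
      have "\<not> is_unit p" using pp(1) by auto
      then obtain r where r: "m = p ^ e * r" "\<not> p dvd r"
        using multiplicity_decompose'[of m p] m0 unfolding e_def by auto
      have e0: "e > 0" using pp m0 r by (cases e) auto
      have r0: "r > 0" using r m0 by (cases r) auto
      have "e < p ^ e" using pp(1) prime_gt_1_nat by (intro power_gt_expt) auto
      also have "p ^ e \<le> m" using r r0 by simp
      finally have eN: "e \<le> N" using m0 by simp
      have "r dvd m" using r by simp
      moreover from this have "r \<le> m" using m0 by (intro dvd_imp_le)
      moreover have "omega_star r = j"
        using omega_star_mult_prime_power[OF pp(1,2) e0 r(2) r0] no r by simp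
      ultimately have "r \<in> omega_fixed P N j"
        using r0 m0 no mP by (auto simp: omega_fixed_def intro: dvd_trans)
      moreover have "p \<in> P" using mP pp by simp
      ultimately show "\<exists>y\<in>P \<times> {1..N} \<times> omega_fixed P N j.
        (case y of (p, e, m) \<Rightarrow> (p ^ e * m, p)) = x \<and>
        1 / real (fst x) \<le> (1 / real (fst y) ^ fst (snd y)) * (1 / real (snd (snd y)))"
        using e0 eN r x by (intro bexI[of _ "(p, e, r)"]) auto
    qed
  qed (use P finite_omega_fixed fod in auto)
  also have "\<dots> = (\<Sum>p\<in>P. \<Sum>e=1..N. \<Sum>m\<in>omega_fixed P N j. (1 / real p ^ e) * (1 / real m))"
    by (simp add: sum.cartesian_product case_prod_unfold)
  also have "\<dots> = (\<Sum>p\<in>P. \<Sum>e=1..N. 1 / real p ^ e) * F j"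
    by (simp only: F_def sum_distrib_left[symmetric] sum_distrib_right)
  also have "\<dots> \<le> S * F j"
    unfolding S_def using p1 F0 by (intro mult_right_mono sum_mono sum_inverse_powers_le) auto
  also have "\<dots> \<le> S * (3 / 2 * S ^ j / fact j)"
    using Suc S0 unfolding F_def S_def by (intro mult_left_mono) auto
  finally have "real (Suc j) * F (Suc j) \<le> 3 / 2 * S ^ Suc j / fact j" by (simp add: mult_ac)
  then have "real (Suc j) * F (Suc j) / real (Suc j) \<le> 3 / 2 * S ^ Suc j / fact j / real (Suc j)"
    by (intro divide_right_mono) auto
  moreover have "real (Suc j) * F (Suc j) / real (Suc j) = F (Suc j)" by (simp del: of_nat_Suc)
  moreover have "3 / 2 * S ^ Suc j / fact j / real (Suc j) = 3 / 2 * S ^ Suc j / fact (Suc j)"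
    unfolding fact_Suc by (simp add: mult.commute del: of_nat_Suc)
  ultimately show ?case by (simp only: F_def S_def)
qed

text \<open>The factor 2 is the possible prime 2. The bound is applied with Y = y: an integer larger
  than 2 y^k must have an odd prime power factor above \<open>y\<close>.\<close>

lemma le_twice_power_omega_star:
  assumes "n > 0" "\<not> 4 dvd n"
    and "\<And>q. prime q \<Longrightarrow> odd q \<Longrightarrow> q dvd n \<Longrightarrow> real (q ^ multiplicity q n) \<le> Y"
  shows "real n \<le> 2 * Y ^ omega_star n"
proof -
  define od where "od = {p \<in> prime_factors n. odd p}"
  define ev where "ev = {p \<in> prime_factors n. even p}"
  have un: "prime_factors n = od \<union> ev" "od \<inter> ev = {}" "finite od" "finite ev"
    by (auto simp: od_def ev_def)
  have ev: "ev \<subseteq> {2}"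
  proof
    fix p assume "p \<in> ev"
    then have "prime p" "even p" by (auto simp: ev_def)
    then have "p = 2" by (metis primes_dvd_imp_eq two_is_prime_nat)
    then show "p \<in> {2}" by simp
  qed
  have "(\<Prod>p\<in>ev. real (p ^ multiplicity p n)) \<le> 2"
  proof (cases "ev = {}")
    case False
    then have "ev = {2}" using ev by auto
    have "multiplicity 2 n \<le> 1"
    proof (rule ccontr)
      assume "\<not> multiplicity 2 n \<le> 1"
      then have "2 ^ 2 dvd n" by (intro multiplicity_dvd') auto
      then show False using assms(2) by simp
    qed
    then have "(2::real) ^ multiplicity 2 n \<le> 2 ^ 1" by (intro power_increasing) auto
    then show ?thesis using \<open>ev = {2}\<close> by simp
  qed simp
  moreover have "(\<Prod>p\<in>od. real (p ^ multiplicity p n)) \<le> (\<Prod>p\<in>od. Y)"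
    using assms(3) by (intro prod_mono) (auto simp: od_def prime_factors_dvd)
  moreover have "real n = (\<Prod>p\<in>ev. real (p ^ multiplicity p n)) * (\<Prod>p\<in>od. real (p ^ multiplicity p n))"
  proof -
    have "n = (\<Prod>p\<in>prime_factors n. p ^ multiplicity p n)"
      using assms(1) by (rule prime_factorization_nat)
    also have "\<dots> = (\<Prod>p\<in>od. p ^ multiplicity p n) * (\<Prod>p\<in>ev. p ^ multiplicity p n)"
      unfolding un(1) by (rule prod.union_disjoint) (use un in auto)
    finally have "real n = real ((\<Prod>p\<in>od. p ^ multiplicity p n) * (\<Prod>p\<in>ev. p ^ multiplicity p n))"
      by (rule arg_cong)
    then show ?thesis by (simp add: mult.commute)
  qed
  moreover have "(\<Prod>p\<in>od. Y) = Y ^ omega_star n" by (simp add: od_def omega_star_def)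
  moreover have "(\<Prod>p\<in>od. real (p ^ multiplicity p n)) \<ge> 0" by (intro prod_nonneg) auto
  moreover have "A * B \<le> 2 * C" if "A \<le> 2" "B \<le> C" "0 \<le> B" for A B C :: real
    using that by (intro mult_mono) auto
  ultimately show ?thesis by simp
qed

section \<open>Integers divisible by a large square\<close>

lemma sum_inverse_squares_tail:
  fixes D :: real
  assumes "D > 0"
  shows "(\<Sum>d\<in>{d. d \<le> N \<and> real d \<ge> D}. 1 / real d ^ 2) \<le> 2 / D"
proof -
  define A where "A = nat \<lceil>D\<rceil>"
  have A: "A \<ge> 1" "real A \<ge> D" using assms by (auto simp: A_def Suc_le_eq) 
  have "{d. d \<le> N \<and> real d \<ge> D} = {A..N}" using assms by (auto simp: A_def nat_le_iff ceiling_le_iff)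
  moreover have "(\<Sum>d=A..N. 1 / real d ^ 2) \<le> 2 / real A"
  proof (cases "A \<le> N")
    case True
    \<comment> \<open>The shift by 1/2 lets the telescoping start at A = 1 and still gives 1/(A -
      1/2) <= 2/A.\<close>
    have step: "1 / a ^ 2 \<le> 1 / (a - 1/2) - 1 / (a + 1/2)" if "a \<ge> 1" for a :: real
    proof -
      have "1 / (a - 1/2) - 1 / (a + 1/2) = 1 / (a ^ 2 - 1/4)"
      proof -
        have "(a - 1/2) * (a + 1/2) = a ^ 2 - 1/4" by (simp add: power2_eq_square algebra_simps)
        moreover have "1 / (a - 1/2) - 1 / (a + 1/2) = ((a + 1/2) - (a - 1/2)) / ((a - 1/2) * (a + 1/2))"
          using that by (subst diff_frac_eq) auto
        ultimately show ?thesis by simp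
      qed
      moreover have "1 / a ^ 2 \<le> 1 / (a ^ 2 - 1/4)"
      proof (intro divide_left_mono mult_pos_pos)
        have "1 \<le> a ^ 2" using that by (rule one_le_power)
        then show "0 < a ^ 2" "0 < a ^ 2 - 1/4" "a ^ 2 - 1/4 \<le> a ^ 2" by linarith+
      qed simp
      ultimately show ?thesis by simp
    qed
    have "(\<Sum>d=A..N. 1 / real d ^ 2) \<le> 1 / (real A - 1/2) - 1 / (real N + 1/2)"
      using True
    proof (induction N rule: dec_induct)
      case base
      then show ?case using step[of "real A"] A by simp
    next
      case (step n)
      then show ?case using \<open>\<And>a. 1 \<le> a \<Longrightarrow> _ a\<close>[of "real (Suc n)"] by (simp add: add.commute)
    qed
    also have "\<dots> \<le> 1 / (real A - 1/2)" by simp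
    also have "\<dots> \<le> 2 / real A" using A by (simp add: field_simps)
    finally show ?thesis .
  qed simp
  moreover have "2 / real A \<le> 2 / D" using A assms by (intro divide_left_mono) auto
  ultimately show ?thesis by simp
qed

lemma card_square_divisor_le:
  fixes x D :: real
  assumes "x \<ge> 0" "D > 0"
  shows "real (card {n. n > 0 \<and> real n \<le> x \<and> (\<exists>d::nat. real d \<ge> D \<and> d\<^sup>2 dvd n)}) \<le> 2 * x / D"
proof -
  define N where "N = nat \<lfloor>x\<rfloor>"
  define Ds where "Ds = {d. d \<le> N \<and> real d \<ge> D}"
  have Nx: "real N \<le> x" using assms by (simp add: N_def)
  have nN: "real n \<le> x \<longleftrightarrow> n \<le> N" for n using assms by (simp add: N_def le_nat_iff le_floor_iff)
  have finD: "finite Ds" by (rule finite_subset[of _ "{..N}"]) (auto simp: Ds_def)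
  have "{n. n > 0 \<and> real n \<le> x \<and> (\<exists>d::nat. real d \<ge> D \<and> d\<^sup>2 dvd n)}
      \<subseteq> (\<Union>d\<in>Ds. (\<lambda>i. d\<^sup>2 * i) ` {1..N div d\<^sup>2})"
  proof
    fix n assume "n \<in> {n. n > 0 \<and> real n \<le> x \<and> (\<exists>d::nat. real d \<ge> D \<and> d\<^sup>2 dvd n)}"
    then obtain d where n: "n > 0" "n \<le> N" and d: "real d \<ge> D" "d\<^sup>2 dvd n" using nN by auto
    have d0: "d > 0" using d assms by (cases d) auto
    have "d \<le> d\<^sup>2" using d0 by (simp add: power2_eq_square)
    also have "\<dots> \<le> n" using d n by (intro dvd_imp_le) auto
    finally have "d \<in> Ds" using n d by (simp add: Ds_def)
    moreover obtain i where i: "n = d\<^sup>2 * i" using d by (elim dvdE)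
    moreover have "i \<in> {1..N div d\<^sup>2}" using n i d0
      by (auto simp: less_eq_div_iff_mult_less_eq Suc_le_eq mult.commute)
    ultimately show "n \<in> (\<Union>d\<in>Ds. (\<lambda>i. d\<^sup>2 * i) ` {1..N div d\<^sup>2})" by blast
  qed
  then have "card {n. n > 0 \<and> real n \<le> x \<and> (\<exists>d::nat. real d \<ge> D \<and> d\<^sup>2 dvd n)}
      \<le> card (\<Union>d\<in>Ds. (\<lambda>i. d\<^sup>2 * i) ` {1..N div d\<^sup>2})"
    using finD by (intro card_mono) auto
  also have "\<dots> \<le> (\<Sum>d\<in>Ds. card ((\<lambda>i. d\<^sup>2 * i) ` {1..N div d\<^sup>2}))" using finD by (rule card_UN_le)
  also have "\<dots> \<le> (\<Sum>d\<in>Ds. N div d\<^sup>2)" 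
    by (intro sum_mono order_trans[OF card_image_le]) auto
  finally have "real (card {n. n > 0 \<and> real n \<le> x \<and> (\<exists>d::nat. real d \<ge> D \<and> d\<^sup>2 dvd n)})
      \<le> (\<Sum>d\<in>Ds. real (N div d\<^sup>2))" by (simp only: of_nat_sum[symmetric] of_nat_le_iff)
  also have "\<dots> \<le> (\<Sum>d\<in>Ds. x * (1 / real d ^ 2))"
  proof (rule sum_mono)
    fix d
    have "real (N div d\<^sup>2) \<le> real N / real (d\<^sup>2)" by (rule of_nat_div_le_of_nat)
    also have "\<dots> \<le> x / real (d\<^sup>2)" using Nx by (intro divide_right_mono) auto
    finally show "real (N div d\<^sup>2) \<le> x * (1 / real d ^ 2)" by simp
  qed
  also have "\<dots> = x * (\<Sum>d\<in>Ds. 1 / real d ^ 2)" by (simp add: sum_distrib_left)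
  also have "\<dots> \<le> x * (2 / D)"
    unfolding Ds_def using assms by (intro mult_left_mono sum_inverse_squares_tail) auto
  finally show ?thesis by (simp add: mult.commute)
qed

section \<open>The representations that are counted\<close>

definition reps :: "nat \<Rightarrow> (nat \<times> nat) set" where
  "reps n = {(a, b). b \<in> sums_two_squares \<and> a\<^sup>2 + b\<^sup>2 = n \<and> coprime a b}"

lemma r_star_eq_card_reps: "r_star sums_two_squares n = card (reps n)"
  by (simp only: r_star_def reps_def coprime_iff_gcd_eq_1)

lemma reps_prim_reps: "(a, b) \<in> reps n \<Longrightarrow> (int a, int b) \<in> prim_reps n"
  by (auto simp: reps_def prim_reps_def)

lemma card_reps_le:
  assumes "n > 0"
  shows "finite (reps n)" "card (reps n) \<le> 4 * 2 ^ omega_star n"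
proof -
  let ?f = "\<lambda>(a, b). (int a, int b)"
  have sub: "?f ` reps n \<subseteq> prim_reps n" using reps_prim_reps by auto
  have inj: "inj_on ?f (reps n)" by (auto simp: inj_on_def)
  show "finite (reps n)" by (rule inj_on_finite[OF inj sub finite_prim_reps])
  show "card (reps n) \<le> 4 * 2 ^ omega_star n"
    using card_inj_on_le[OF inj sub finite_prim_reps] card_prim_reps_le[OF assms] by linarith
qed

lemma binomial_le_power:
  assumes "n \<le> N"
  shows "n choose l \<le> N ^ l"
proof (cases "l \<le> n")
  case True
  then have "n choose l \<le> n ^ l" by (rule binomial_le_pow)
  also have "\<dots> \<le> N ^ l" using assms by (rule power_mono) simp
  finally show ?thesis .
qed (simp add: binomial_eq_0)

section \<open>From representations to lattice points\<close>

text \<open>In the Gaussian integers the quotient of the two elements has norm 1 and imaginary part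
  0, so it is 1 or -1.\<close>

lemma prim_reps_proportional:
  assumes "(s, t) \<in> prim_reps m" "(s', t') \<in> prim_reps m" "m > 0" "s * t' - s' * t = 0"
  shows "(s', t') = (s, t) \<or> (s', t') = (- s, - t)"
proof -
  define F where "F = s * s' + t * t'"
  have sm: "s\<^sup>2 + t\<^sup>2 = int m" "s'\<^sup>2 + t'\<^sup>2 = int m" using assms by (auto simp: prim_reps_def)
  have "(s * t' - s' * t)\<^sup>2 + F\<^sup>2 = (s\<^sup>2 + t\<^sup>2) * (s'\<^sup>2 + t'\<^sup>2)"
    by (simp add: F_def algebra_simps power2_eq_square)
  then have "F\<^sup>2 = (int m)\<^sup>2" using assms(4) unfolding sm by (simp add: power2_eq_square)
  then have F: "F = int m \<or> F = - int m" by (simp add: power2_eq_iff)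
  have "(s\<^sup>2 + t\<^sup>2) * s' = s * F - t * (s * t' - s' * t)" "(s\<^sup>2 + t\<^sup>2) * t' = t * F + s * (s * t' - s' * t)"
    by (simp_all add: F_def algebra_simps power2_eq_square)
  then have "int m * s' = s * F" "int m * t' = t * F" using assms(4) unfolding sm by simp_all
  then have "int m * s' = int m * s \<and> int m * t' = int m * t \<or>
      int m * s' = int m * (- s) \<and> int m * t' = int m * (- t)"
    using F by (auto simp: mult.commute)
  then show ?thesis using assms(3) unfolding mult_cancel_left by simp
qed

text \<open>The last condition excludes opposite pairs, for which \<open>s u + t v\<close> cannot both be positive.\<close>

definition forms :: "nat \<Rightarrow> nat \<Rightarrow> (int \<times> int) set set" where
  "forms m l = {T. T \<subseteq> prim_reps m \<and> card T = l \<and>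
     (\<forall>s t s' t'. (s, t) \<in> T \<longrightarrow> (s', t') \<in> T \<longrightarrow> (s, t) \<noteq> (s', t') \<longrightarrow> s * t' - s' * t \<noteq> 0)}"

lemma finite_forms: "finite (forms m l)"
  by (rule finite_subset[of _ "Pow (prim_reps m)"]) (auto simp: forms_def finite_prim_reps)

lemma card_forms_le:
  assumes "m > 0"
  shows "card (forms m l) \<le> (4 * 2 ^ omega_star m) ^ l"
proof -
  have "card (forms m l) \<le> card {T. T \<subseteq> prim_reps m \<and> card T = l}"
    by (intro card_mono) (auto simp: forms_def finite_prim_reps)
  also have "\<dots> = card (prim_reps m) choose l" by (rule n_subsets[OF finite_prim_reps])
  also have "\<dots> \<le> (4 * 2 ^ omega_star m) ^ l"
    by (rule binomial_le_power[OF card_prim_reps_le[OF assms]])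
  finally show ?thesis .
qed

text \<open>The pair (u, v) stands for the prime u^2 + v^2, with primality relaxed to the absence of
  prime factors up to \<open>w\<close>. That \<open>v\<close> is nonzero is legitimate because a
  prime is no square, and it is needed for \<open>v\<close> as an exceptional integer of the
  sieve.\<close>

definition lattice_pts :: "real \<Rightarrow> real \<Rightarrow> nat \<Rightarrow> (int \<times> int) set \<Rightarrow> (int \<times> int) set" where
  "lattice_pts x w m T = {(u, v). real m * of_int (u\<^sup>2 + v\<^sup>2) \<le> x \<and> v \<noteq> 0 \<and>
     (\<forall>q. prime q \<and> real q \<le> w \<longrightarrow> \<not> int q dvd u\<^sup>2 + v\<^sup>2) \<and>
     (\<forall>(s, t)\<in>T. \<exists>b\<in>sums_two_squares. int b = s * u + t * v)}"

lemma lattice_pts_bound: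
  assumes "(u, v) \<in> lattice_pts x w m T" "m > 0"
  shows "\<bar>u\<bar> \<le> int (nat \<lfloor>sqrt (x / real m)\<rfloor>)" "\<bar>v\<bar> \<le> int (nat \<lfloor>sqrt (x / real m)\<rfloor>)"
proof -
  have "real m * of_int (u\<^sup>2 + v\<^sup>2) \<le> x" using assms by (auto simp: lattice_pts_def)
  then have "real_of_int (u\<^sup>2 + v\<^sup>2) \<le> x / real m" using assms(2) by (simp add: field_simps)
  then have "(real_of_int u)\<^sup>2 + (real_of_int v)\<^sup>2 \<le> x / real m" by simp
  then have le: "(real_of_int u)\<^sup>2 \<le> x / real m" "(real_of_int v)\<^sup>2 \<le> x / real m"
    using zero_le_power2[of "real_of_int u"] zero_le_power2[of "real_of_int v"] by linarith+
  have "\<bar>i\<bar> \<le> int (nat \<lfloor>sqrt (x / real m)\<rfloor>)" if "(real_of_int i)\<^sup>2 \<le> x / real m" for i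
  proof -
    have "real_of_int \<bar>i\<bar> \<le> sqrt (x / real m)" using that by (simp add: real_le_rsqrt)
    then have "\<bar>i\<bar> \<le> \<lfloor>sqrt (x / real m)\<rfloor>" by (simp only: le_floor_iff)
    then show ?thesis by linarith
  qed
  then show "\<bar>u\<bar> \<le> int (nat \<lfloor>sqrt (x / real m)\<rfloor>)" "\<bar>v\<bar> \<le> int (nat \<lfloor>sqrt (x / real m)\<rfloor>)"
    using le by blast+
qed

lemma finite_lattice_pts: "m > 0 \<Longrightarrow> finite (lattice_pts x w m T)"
proof (rule finite_subset)
  let ?R = "int (nat \<lfloor>sqrt (x / real m)\<rfloor>)"
  assume "m > 0"
  then show "lattice_pts x w m T \<subseteq> {- ?R..?R} \<times> {- ?R..?R}"
  proof (intro subsetI)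
    fix z assume "z \<in> lattice_pts x w m T"
    moreover obtain u v where uv: "z = (u, v)" by (cases z)
    ultimately have "\<bar>u\<bar> \<le> ?R" "\<bar>v\<bar> \<le> ?R"
      using lattice_pts_bound[of u v x w m T] \<open>m > 0\<close> by blast+
    then have "u \<in> {- ?R..?R}" "v \<in> {- ?R..?R}" unfolding atLeastAtMost_iff by linarith+
    then show "z \<in> {- ?R..?R} \<times> {- ?R..?R}" unfolding uv by (rule SigmaI)
  qed
qed auto

lemma card_lattice_pts_le:
  assumes "m > 0" and "Z \<ge> 0"
    and "\<And>v. v \<noteq> 0 \<Longrightarrow> \<bar>v\<bar> \<le> int R \<Longrightarrow> real (card (survivors R w v T)) \<le> Z"
    and R: "R = nat \<lfloor>sqrt (x / real m)\<rfloor>"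
  shows "real (card (lattice_pts x w m T)) \<le> 2 * real R * Z"
proof -
  define U where "U v = survivors R w v T" for v
  let ?V = "{- int R..int R} - {0}"
  have finU: "finite (U v)" for v unfolding U_def by (rule finite_subset[of _ "{- int R..int R}"]) auto
  have "lattice_pts x w m T \<subseteq> (\<lambda>(v, u). (u, v)) ` (SIGMA v:?V. U v)"
  proof
    fix z assume z: "z \<in> lattice_pts x w m T"
    obtain u v where uv: "z = (u, v)" by (cases z)
    have "\<bar>u\<bar> \<le> int R" "\<bar>v\<bar> \<le> int R" using lattice_pts_bound[of u v] z uv assms(1) R by auto
    then have "u \<in> {- int R..int R}" "v \<in> {- int R..int R}" by auto
    then have "(v, u) \<in> (SIGMA v:?V. U v)" using z unfolding uv by (auto simp: lattice_pts_def U_def)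
    then show "z \<in> (\<lambda>(v, u). (u, v)) ` (SIGMA v:?V. U v)" unfolding uv by (rule rev_image_eqI) simp
  qed
  then have "card (lattice_pts x w m T) \<le> card (SIGMA v:?V. U v)"
    using finU by (intro surj_card_le) auto
  also have "\<dots> = (\<Sum>v\<in>?V. card (U v))" using finU by (intro card_SigmaI) auto
  finally have "real (card (lattice_pts x w m T)) \<le> (\<Sum>v\<in>?V. real (card (U v)))"
    by (simp only: of_nat_sum[symmetric] of_nat_le_iff)
  also have "\<dots> \<le> (\<Sum>v\<in>?V. Z)"
    using assms(3) unfolding U_def by (intro sum_mono) auto
  also have "\<dots> = 2 * real R * Z"
    by (simp add: card_Diff_singleton of_nat_diff nat_add_distrib)
  finally show ?thesis .
qed

text \<open>Since \<open>p\<close> divides \<open>n\<close> exactly once, the cofactor is prime to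
  \<open>p\<close> and its \<open>omega_star\<close> is exactly one less.\<close>

definition good :: "real \<Rightarrow> real \<Rightarrow> nat \<Rightarrow> nat set" where
  "good x y k = {n. n > 0 \<and> real n \<le> x \<and> omega_star n = k \<and>
     (\<exists>p. prime p \<and> odd p \<and> p dvd n \<and> \<not> p\<^sup>2 dvd n \<and> y \<le> real p)}"

lemma finite_nat_le: "finite {n::nat. n > 0 \<and> real n \<le> x \<and> Q n}"
  by (rule finite_subset[of _ "{..nat \<lfloor>x\<rfloor>}"]) (auto simp: le_nat_floor)

lemma good_0: "good x y 0 = {}"
proof (rule ccontr)
  assume "good x y 0 \<noteq> {}"
  then obtain n p where n: "n > 0" "omega_star n = 0" "prime p" "odd p" "p dvd n" by (auto simp: good_def)
  then have "p \<in> {p \<in> prime_factors n. odd p}" by (auto simp: prime_factors_dvd)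
  then show False using n by (auto simp: omega_star_def)
qed

text \<open>One prime \<open>p\<close> and one pair (u, v) serve all representations in
  \<open>S\<close>. Each gives a pair (s, t) from which it can be computed back, so distinct
  representations give distinct forms.\<close>

lemma good_decompose:
  assumes n: "n \<in> good x y (Suc j)" and w: "w < y" "0 < y"
    and S: "S \<subseteq> reps n" "card S = l" "l \<ge> 1"
  shows "\<exists>m T u v. m \<in> omega_fixed (primes_res 1 x) (nat \<lfloor>x / y\<rfloor>) j \<and> T \<in> forms m l \<and> (u, v) \<in> lattice_pts x w m T
    \<and> n = nat (int m * (u\<^sup>2 + v\<^sup>2)) \<and> S = (\<lambda>(s, t). (nat \<bar>t * u - s * v\<bar>, nat (s * u + t * v))) ` T"
proof -
  obtain p where n0: "n > 0" "real n \<le> x" "omega_star n = Suc j"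
    and p: "prime p" "odd p" "p dvd n" "\<not> p\<^sup>2 dvd n" "y \<le> real p"
    using n by (auto simp: good_def)
  have p0: "p > 0" using p(1) prime_gt_0_nat by blast
  obtain m where m: "n = m * p" using p(3) by (metis dvdE mult.commute)
  have m0: "m > 0" using n0 m by (cases m) auto
  have pm: "\<not> p dvd m" using p(4) m by (auto simp: power2_eq_square)
  have finS: "finite S" using S by (metis card.infinite not_one_le_zero)
  have "S \<noteq> {}" using S(2,3) by auto
  \<comment> \<open>Any one representation shows that -1 is a square modulo \<open>p\<close>, so
    that \<open>p\<close> is a sum of two squares; primitivity keeps \<open>p\<close> from dividing
    b0.\<close>
  then obtain a0 b0 where ab0: "(a0, b0) \<in> S" by auto
  then have rep0: "(int a0, int b0) \<in> prim_reps n" using S(1) reps_prim_reps by blast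
  have "int p dvd (int a0)\<^sup>2 + (int b0)\<^sup>2" using rep0 p(3) by (auto simp: prim_reps_def)
  moreover have "\<not> int p dvd int b0" using prim_reps_not_dvd[OF rep0 p(1,3)] by simp
  ultimately obtain u v where uv: "u\<^sup>2 + v\<^sup>2 = int p" using prime_sum_two_squares[OF p(1)] by blast
  have v0: "v \<noteq> 0"
  proof
    assume "v = 0"
    then have "u\<^sup>2 = int p" using uv by simp
    then have "(nat \<bar>u\<bar>)\<^sup>2 = p" by (metis nat_int nat_power_eq abs_ge_zero power2_abs)
    then show False using p(1) by (metis prime_power_iff one_neq_zero numeral_eq_one_iff semiring_norm(85))
  qed
  have "\<forall>z\<in>S. \<exists>w. (fst w)\<^sup>2 + (snd w)\<^sup>2 = int m \<and> coprime (fst w) (snd w)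
      \<and> int (snd z) = fst w * u + snd w * v \<and> int (fst z) = \<bar>snd w * u - fst w * v\<bar>"
  proof
    fix z assume z: "z \<in> S"
    have "(int (fst z), int (snd z)) \<in> prim_reps n" using z S(1) reps_prim_reps[of "fst z" "snd z"] by auto
    then have "(int (fst z))\<^sup>2 + (int (snd z))\<^sup>2 = int m * int p" "coprime (int (fst z)) (int (snd z))"
      by (auto simp: prim_reps_def m)
    from sum_squares_factor[OF p(1) this(1) uv this(2)]
    show "\<exists>w. (fst w)\<^sup>2 + (snd w)\<^sup>2 = int m \<and> coprime (fst w) (snd w)
      \<and> int (snd z) = fst w * u + snd w * v \<and> int (fst z) = \<bar>snd w * u - fst w * v\<bar>" by auto
  qed
  from bchoice[OF this] obtain \<sigma> where \<sigma>: "\<And>z. z \<in> S \<Longrightarrow> (fst (\<sigma> z))\<^sup>2 + (snd (\<sigma> z))\<^sup>2 = int m \<and> coprime (fst (\<sigma> z)) (snd (\<sigma> z))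
      \<and> int (snd z) = fst (\<sigma> z) * u + snd (\<sigma> z) * v \<and> int (fst z) = \<bar>snd (\<sigma> z) * u - fst (\<sigma> z) * v\<bar>"
    by blast
  \<comment> \<open>A left inverse of the choice \<sigma>. The absolute value undoes the unknown
    sign of the first component.\<close>
  define \<psi> where "\<psi> = (\<lambda>(s, t). (nat \<bar>t * u - s * v\<bar>, nat (s * u + t * v)))"
  have \<psi>: "\<psi> (\<sigma> z) = z" if "z \<in> S" for z
    using \<sigma>[OF that] by (cases z, cases "\<sigma> z") (auto simp: \<psi>_def dest: sym)
  define T where "T = \<sigma> ` S"
  have inj: "inj_on \<sigma> S" using \<psi> by (metis inj_onI)
  have ST: "S = \<psi> ` T" using \<psi> by (auto simp: T_def image_image)
  have Tm: "T \<subseteq> prim_reps m" using \<sigma> by (auto simp: T_def prim_reps_def case_prod_unfold)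
  have pos: "\<exists>b\<in>sums_two_squares. int b = s * u + t * v" if st: "(s, t) \<in> T" for s t
  proof -
    obtain z where z: "z \<in> S" "\<sigma> z = (s, t)" using st by (auto simp: T_def)
    then have "snd z \<in> sums_two_squares" using S(1) by (auto simp: reps_def)
    moreover have "int (snd z) = s * u + t * v" using \<sigma>[OF z(1)] z(2) by simp
    ultimately show ?thesis by blast
  qed
  have bpos: "s * u + t * v > 0" if st: "(s, t) \<in> T" for s t
  proof -
    obtain b where b: "b \<in> sums_two_squares" "int b = s * u + t * v" using pos[OF st] by blast
    have "b > 0" using b(1) by (auto simp: sums_two_squares_def)
    then show ?thesis using b(2) by simp
  qed
  have T: "T \<in> forms m l"
    unfolding forms_def
  proof (intro CollectI conjI allI impI)
    show "card T = l" unfolding T_def card_image[OF inj] by (rule S(2))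
    fix s t s' t' assume st: "(s, t) \<in> T" "(s', t') \<in> T" "(s, t) \<noteq> (s', t')"
    show "s * t' - s' * t \<noteq> 0"
    proof
      assume "s * t' - s' * t = 0"
      then have "(s', t') = (s, t) \<or> (s', t') = (- s, - t)"
        using prim_reps_proportional[of s t m s' t'] st Tm m0 by blast
      then show False using st bpos[OF st(1)] bpos[OF st(2)] by auto
    qed
  qed (rule Tm)
  obtain s1 t1 where st1: "(s1, t1) \<in> prim_reps m" 
    using Tm ab0 unfolding T_def by (metis image_subset_iff surj_pair)
  have "m \<in> omega_fixed (primes_res 1 x) (nat \<lfloor>x / y\<rfloor>) j"
    unfolding omega_fixed_def
  proof (intro CollectI conjI allI impI)
    have "real m * y \<le> real m * real p" using p(5) by (intro mult_left_mono) auto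
    also have "\<dots> \<le> x" using n0 m by simp
    finally have "real m \<le> x / y" using w by (simp add: field_simps)
    then show "m \<le> nat \<lfloor>x / y\<rfloor>" by (rule le_nat_floor)
    show "\<not> 4 dvd m" by (rule prim_reps_not_4_dvd[OF st1])
    show "omega_star m = j"
      using omega_star_mult_prime_power[OF p(1,2) _ pm m0, of 1] n0(3) m by (simp add: mult.commute)
    fix q assume q: "prime q" "odd q" "q dvd m"
    have "q \<le> m" using q m0 by (intro dvd_imp_le)
    also have "m \<le> n" using m p0 by simp
    finally have "real q \<le> x" using n0 by linarith
    then show "q \<in> primes_res 1 x" using prim_reps_prime_mod_4[OF st1 q] q by (simp add: primes_res_def)
  qed (rule m0)
  moreover have "(u, v) \<in> lattice_pts x w m T"
    unfolding lattice_pts_def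
  proof (intro CollectI case_prodI conjI allI impI)
    have "real m * of_int (u\<^sup>2 + v\<^sup>2) = real n" unfolding uv m by simp
    then show "real m * of_int (u\<^sup>2 + v\<^sup>2) \<le> x" using n0 by simp
    show "\<not> int q dvd u\<^sup>2 + v\<^sup>2" if q: "prime q \<and> real q \<le> w" for q
    proof
      assume "int q dvd u\<^sup>2 + v\<^sup>2"
      then have "q dvd p" unfolding uv by simp
      then have "q = p" using q p(1) by (simp add: primes_dvd_imp_eq)
      then show False using q w p(5) by simp
    qed
    show "\<forall>(s, t)\<in>T. \<exists>b\<in>sums_two_squares. int b = s * u + t * v" using pos by auto
  qed (rule v0)
  moreover have "n = nat (int m * (u\<^sup>2 + v\<^sup>2))" unfolding uv m by (simp add: nat_mult_distrib)
  ultimately show ?thesis using T ST unfolding \<psi>_def by blast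
qed

text \<open>The binomial coefficient counts subsets \<open>S\<close> of size \<open>l\<close>. The
  pairs (n, S) are covered by the image of the triples (m, T, (u, v)), so repeated images do no
  harm.\<close>

lemma sum_good_le:
  assumes w: "w < y" "0 < y" and l: "l \<ge> 1"
  shows "(\<Sum>n\<in>good x y (Suc j). card (reps n) choose l)
    \<le> (\<Sum>m\<in>omega_fixed (primes_res 1 x) (nat \<lfloor>x / y\<rfloor>) j. \<Sum>T\<in>forms m l. card (lattice_pts x w m T))"
proof -
  let ?M = "omega_fixed (primes_res 1 x) (nat \<lfloor>x / y\<rfloor>) j"
  let ?A = "SIGMA n:good x y (Suc j). {S. S \<subseteq> reps n \<and> card S = l}"
  let ?B = "SIGMA m:?M. SIGMA T:forms m l. lattice_pts x w m T"
  let ?f = "\<lambda>(m, T, (u, v)). (nat (int m * (u\<^sup>2 + v\<^sup>2)), (\<lambda>(s, t). (nat \<bar>t * u - s * v\<bar>, nat (s * u + t * v))) ` T)"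
  have fing: "finite (good x y (Suc j))" unfolding good_def by (rule finite_nat_le)
  have m0: "m > 0" if "m \<in> ?M" for m using that by (simp add: omega_fixed_def)
  have finr: "finite (reps n)" if "n \<in> good x y (Suc j)" for n
    using that by (intro card_reps_le) (simp add: good_def)
  have finB1: "finite (SIGMA T:forms m l. lattice_pts x w m T)" if "m \<in> ?M" for m
    by (intro finite_SigmaI finite_forms finite_lattice_pts m0[OF that])
  have finB: "finite ?B" by (intro finite_SigmaI finite_omega_fixed finB1)
  have "(\<Sum>n\<in>good x y (Suc j). card (reps n) choose l)
      = (\<Sum>n\<in>good x y (Suc j). card {S. S \<subseteq> reps n \<and> card S = l})"
    by (intro sum.cong refl n_subsets[symmetric] finr)
  also have "\<dots> = card ?A"
    by (rule card_SigmaI[symmetric]) (use fing finr in auto)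
  also have "\<dots> \<le> card ?B"
  proof (rule surj_card_le[OF finB])
    show "?A \<subseteq> ?f ` ?B"
    proof
      fix z assume "z \<in> ?A"
      then obtain n S where z: "z = (n, S)" "n \<in> good x y (Suc j)" "S \<subseteq> reps n" "card S = l" by auto
      obtain m T u v where "m \<in> ?M" "T \<in> forms m l" "(u, v) \<in> lattice_pts x w m T"
        "n = nat (int m * (u\<^sup>2 + v\<^sup>2))" "S = (\<lambda>(s, t). (nat \<bar>t * u - s * v\<bar>, nat (s * u + t * v))) ` T"
        using good_decompose[OF z(2) w z(3,4) l] by blast
      then show "z \<in> ?f ` ?B" unfolding z(1) by (intro rev_image_eqI[of "(m, T, (u, v))"]) auto
    qed
  qed
  also have "\<dots> = (\<Sum>m\<in>?M. card (SIGMA T:forms m l. lattice_pts x w m T))"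
    by (rule card_SigmaI) (use finB1 finite_omega_fixed in auto)
  also have "\<dots> = (\<Sum>m\<in>?M. \<Sum>T\<in>forms m l. card (lattice_pts x w m T))"
    by (intro sum.cong refl card_SigmaI finite_forms ballI finite_lattice_pts m0)
  finally show ?thesis .
qed

section \<open>The main estimate\<close>

text \<open>The sieve needs every s to be nonzero. Two forms with s = 0 would have determinant 0, so
  there is at most one; it is removed if present. Both s and the determinants are at most
  \<open>m\<close> in size, the latter because their square plus another square is m^2.\<close>

lemma forms_drop_zero:
  assumes T: "T \<in> forms m l" and l: "l \<ge> 1" and m: "m > 0"
  shows "\<exists>T'\<subseteq>T. finite T' \<and> card T' = l - 1 \<and>
    (\<forall>v. v \<noteq> 0 \<longrightarrow> (\<forall>w\<in>exceptional v T'. w \<noteq> 0 \<and> \<bar>w\<bar> \<le> max \<bar>v\<bar> (int m)))"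
proof -
  have Tm: "T \<subseteq> prim_reps m" and cT: "card T = l"
    and nz: "\<And>s t s' t'. (s, t) \<in> T \<Longrightarrow> (s', t') \<in> T \<Longrightarrow> (s, t) \<noteq> (s', t') \<Longrightarrow> s * t' - s' * t \<noteq> 0"
    using T unfolding forms_def by blast+
  have finT: "finite T" using Tm finite_prim_reps finite_subset by blast
  have neT: "T \<noteq> {}" using cT l by auto
  \<comment> \<open>If no form has s = 0, the condition is vacuous and an arbitrary form is removed,
    so that always exactly l - 1 remain.\<close>
  have "\<exists>z\<in>T. \<forall>t. (0, t) \<in> T \<longrightarrow> z = (0, t)"
  proof (cases "\<exists>t. (0, t) \<in> T")
    case True
    then obtain t where t: "(0, t) \<in> T" by blast
    have "(0, t) = (0, t')" if "(0, t') \<in> T" for t'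
      using nz[OF t that] by auto
    then show ?thesis using t by meson
  next
    case False
    then show ?thesis using neT by blast
  qed
  then obtain z where z: "z \<in> T" "\<And>t. (0, t) \<in> T \<Longrightarrow> z = (0, t)" by blast
  define T' where "T' = T - {z}"
  have T'T: "T' \<subseteq> T" and finT': "finite T'" using finT by (auto simp: T'_def)
  have cT': "card T' = l - 1" using z(1) finT cT by (simp add: T'_def)
  have sq: "s\<^sup>2 + t\<^sup>2 = int m" if "(s, t) \<in> T'" for s t
    using that T'T Tm by (auto simp: prim_reps_def)
  have "w \<noteq> 0 \<and> \<bar>w\<bar> \<le> max \<bar>v\<bar> (int m)" if v: "v \<noteq> 0" and w: "w \<in> exceptional v T'" for v w
  proof -
    from w show ?thesis
    proof (cases rule: exceptional_cases)
      case diag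
      then show ?thesis using v by simp
    next
      case (fst s t)
      have "s \<noteq> 0" using fst(1) z(2)[of t] by (auto simp: T'_def)
      moreover have "\<bar>s\<bar> \<le> int m"
        using abs_le_square_int[of s] sq[OF fst(1)] zero_le_power2[of t] by linarith
      ultimately show ?thesis using fst(2) by simp
    next
      case (cross s t s' t')
      have "w \<noteq> 0"
        using nz[OF subsetD[OF T'T cross(1)] subsetD[OF T'T cross(2)] cross(3)] cross(4) by simp
      moreover have "w\<^sup>2 + (s * s' + t * t')\<^sup>2 = (s\<^sup>2 + t\<^sup>2) * (s'\<^sup>2 + t'\<^sup>2)"
        unfolding cross(4) by (simp add: algebra_simps power2_eq_square)
      then have "w\<^sup>2 + (s * s' + t * t')\<^sup>2 = (int m)\<^sup>2"
        unfolding sq[OF cross(1)] sq[OF cross(2)] by (simp add: power2_eq_square)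
      then have "w\<^sup>2 \<le> (int m)\<^sup>2" using zero_le_power2[of "s * s' + t * t'"] by linarith
      then have "\<bar>w\<bar> \<le> int m" by (simp add: abs_le_square_iff[symmetric])
      ultimately show ?thesis by simp
    qed
  qed
  then have "\<forall>v. v \<noteq> 0 \<longrightarrow> (\<forall>w\<in>exceptional v T'. w \<noteq> 0 \<and> \<bar>w\<bar> \<le> max \<bar>v\<bar> (int m))"
    by (intro allI impI ballI)
  with T'T finT' cT' show ?thesis by (intro exI[of _ T'] conjI)
qed

text \<open>For each \<open>v\<close> the sieve runs over \<open>u\<close> up to sqrt(x/m) with h =
  l - 1 forms, which gives the exponent h + 2 = l + 1. The trivial count of \<open>v\<close>
  supplies the second factor sqrt(x/m).\<close>

lemma lattice_bound:
  fixes l :: nat and c0 :: real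
  assumes l: "l \<ge> 1" and c0: "c0 \<ge> 1"
  shows "\<exists>K A x0. K > 0 \<and> A \<ge> 0 \<and> (\<forall>x\<ge>x0. \<forall>m T. m > 0 \<longrightarrow> T \<in> forms m l \<longrightarrow>
     real m \<le> x / level c0 x ^ 6 \<longrightarrow>
     real (card (lattice_pts x (level c0 x) m T))
       \<le> K * (x / real m) * (ln (ln x) powr A / sqrt (ln x) ^ (l + 1)))"
proof -
  obtain K A x1 where K: "K > 0" and A: "A \<ge> 0" and sieve: "\<forall>x\<ge>x1. \<forall>T v R. finite T \<longrightarrow> card T = l - 1 \<longrightarrow>
    (\<forall>w\<in>exceptional v T. w \<noteq> 0 \<and> \<bar>real_of_int w\<bar> \<le> x) \<longrightarrow> level c0 x \<le> real R \<longrightarrow>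
    real (card (survivors R (level c0 x) v T))
      \<le> K * real R * ln (ln x) powr A / sqrt (ln x) ^ (l - 1 + 2)"
    using sieve_bound[OF c0, of "l - 1"] by blast
  have ev: "\<forall>\<^sub>F L in at_top. L \<ge> 1 \<and> c0 * L ^ 2 \<le> exp L"
    by (intro eventually_conj eventually_ge_at_top eventually_quadratic_le_exp)
  obtain x2 where x2: "x2 > 1" "\<forall>x\<ge>x2. ln (ln x) \<ge> 1 \<and> c0 * ln (ln x) ^ 2 \<le> exp (ln (ln x))"
    using eventually_ge_exp[OF ev] by blast
  have "real (card (lattice_pts x (level c0 x) m T))
       \<le> (2 * K) * (x / real m) * (ln (ln x) powr A / sqrt (ln x) ^ (l + 1))"
    if x: "x \<ge> max x1 x2" and m: "m > 0" and T: "T \<in> forms m l"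
      and mx: "real m \<le> x / level c0 x ^ 6" for x m T
  proof -
    define L where "L = ln (ln x)"
    define w where "w = level c0 x"
    have x1': "x > 1" "x \<ge> x1" using x x2(1) by auto
    have L1: "L \<ge> 1" and Lc: "c0 * L ^ 2 \<le> exp L" using x2(2) x unfolding L_def by auto
    have lx: "ln x = exp L" using x1' by (simp add: L_def)
    have wexp: "w = exp (exp L / (c0 * L))" using x1' lx by (simp add: powr_def w_def L_def)
    have "1 \<le> exp L / (c0 * L)"
    proof -
      have "c0 * L * 1 \<le> c0 * L * L" using L1 c0 by (intro mult_left_mono) auto
      then have "c0 * L \<le> exp L" using Lc by (simp add: power2_eq_square mult.assoc)
      then show ?thesis using L1 c0 by simp
    qed
    then have "exp 1 \<le> w" unfolding wexp by simp
    then have w2: "w \<ge> 2" using exp_ge_add_one_self[of 1] by linarith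
    define X where "X = x / real m"
    have X0: "X > 0" using x1' m by (simp add: X_def)
    have wX: "w ^ 6 \<le> X" using mx m w2 unfolding w_def[symmetric] X_def by (simp add: field_simps)
    have "w ^ 3 \<le> sqrt X"
    proof (rule real_le_rsqrt)
      show "(w ^ 3)\<^sup>2 \<le> X" using wX by (simp add: power_mult[symmetric])
    qed
    \<comment> \<open>The extra 1 makes up for the rounding in the definition of
      \<open>R\<close>.\<close>
    moreover have "w + 1 \<le> w ^ 3"
    proof -
      have "2 * w \<le> w * w" using w2 by (intro mult_right_mono) auto
      moreover have "1 * (w * w) \<le> w * (w * w)" using w2 by (intro mult_right_mono) auto
      ultimately have "w + 1 \<le> w * (w * w)" using w2 by linarith
      then show ?thesis by (simp add: power3_eq_cube mult.assoc)
    qed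
    ultimately have wsX: "w + 1 \<le> sqrt X" by linarith
    define R where "R = nat \<lfloor>sqrt (x / real m)\<rfloor>"
    have RX: "real R \<le> sqrt X" using X0 by (simp add: R_def X_def)
    have "sqrt X \<le> real R + 1" unfolding R_def X_def by linarith
    then have wR: "w \<le> real R" using wsX by linarith
    have mlex: "real m \<le> x"
    proof -
      have "1 \<le> w ^ 6" using w2 by (intro one_le_power) auto
      then have "1 \<le> X" using wX by linarith
      then show ?thesis using m by (simp add: X_def field_simps)
    qed
    obtain T' where T': "T' \<subseteq> T" "finite T'" "card T' = l - 1"
      "\<And>v w. v \<noteq> 0 \<Longrightarrow> w \<in> exceptional v T' \<Longrightarrow> w \<noteq> 0 \<and> \<bar>w\<bar> \<le> max \<bar>v\<bar> (int m)"
      using forms_drop_zero[OF T l m] by blast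
    define Z where "Z = K * real R * L powr A / sqrt (ln x) ^ (l + 1)"
    have sq0: "sqrt (ln x) ^ (l + 1) > 0" using lx by simp
    have Z0: "Z \<ge> 0" unfolding Z_def using K sq0 by simp
    have "real (card (lattice_pts x w m T)) \<le> 2 * real R * Z"
    proof (rule card_lattice_pts_le[OF m Z0])
      fix v :: int assume v: "v \<noteq> 0" "\<bar>v\<bar> \<le> int R"
      have "\<bar>real_of_int v\<bar> \<le> real R" using v(2) by linarith
      also have "\<dots> \<le> sqrt X" by (rule RX)
      also have "\<dots> \<le> sqrt x"
      proof -
        have "X \<le> x" using m x1' unfolding X_def by (simp add: field_simps)
        then show ?thesis by simp
      qed
      also have "\<dots> \<le> x" using x1' by (intro real_le_lsqrt) (auto simp: power2_eq_square)
      finally have vx: "\<bar>real_of_int v\<bar> \<le> x" .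
      have exc_facts: "\<forall>w\<in>exceptional v T'. w \<noteq> 0 \<and> \<bar>real_of_int w\<bar> \<le> x"
      proof
        fix w assume "w \<in> exceptional v T'"
        then have "w \<noteq> 0" "\<bar>w\<bar> \<le> max \<bar>v\<bar> (int m)" using T'(4)[OF v(1)] by auto
        moreover from this have "\<bar>w\<bar> \<le> \<bar>v\<bar> \<or> \<bar>w\<bar> \<le> int m" by linarith
        then have "\<bar>real_of_int w\<bar> \<le> x" using vx mlex by linarith
        ultimately show "w \<noteq> 0 \<and> \<bar>real_of_int w\<bar> \<le> x" by blast
      qed
      let ?U = "\<lambda>T. survivors R w v T"
      have "finite (?U T')" by (rule finite_subset[of _ "{- int R..int R}"]) auto
      \<comment> \<open>Dropping a form drops a condition, so the count can only grow.\<close>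
      moreover have "?U T \<subseteq> ?U T'" using T'(1) by blast
      ultimately have "card (?U T) \<le> card (?U T')" by (rule card_mono)
      then have "real (card (?U T)) \<le> real (card (?U T'))" by (rule of_nat_mono)
      also have "\<dots> \<le> K * real R * ln (ln x) powr A / sqrt (ln x) ^ (l - 1 + 2)"
        using sieve x1'(2) T'(2,3) exc_facts wR unfolding w_def by blast
      also have "\<dots> = Z" using l by (simp add: Z_def L_def)
      finally show "real (card (?U T)) \<le> Z" .
    qed (rule R_def)
    also have "\<dots> = (2 * K) * (real R * real R) * (L powr A / sqrt (ln x) ^ (l + 1))"
      by (simp add: Z_def)
    also have "\<dots> \<le> (2 * K) * X * (L powr A / sqrt (ln x) ^ (l + 1))"
    proof (intro mult_right_mono mult_left_mono)
      have "real R * real R \<le> sqrt X * sqrt X" using RX X0 by (intro mult_mono) auto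
      then show "real R * real R \<le> X" using X0 by simp
    qed (use K sq0 in auto)
    finally show ?thesis unfolding w_def X_def L_def .
  qed
  then show ?thesis using K A by (intro exI[of _ "2 * K"] exI[of _ A] exI[of _ "max x1 x2"]) auto
qed

lemma sum_inverse_primes_pred:
  "\<exists>c\<ge>0. \<forall>x\<ge>2. (\<Sum>p\<in>primes_res 1 x. 1 / (real p - 1)) \<le> ln (ln x) / 2 + c"
proof -
  obtain c2 where c2: "\<And>z a. z \<ge> 2 \<Longrightarrow> a \<in> {1,3} \<Longrightarrow> \<bar>recips (primes_res a z) - ln (ln z) / 2\<bar> \<le> c2"
    and c20: "c2 \<ge> 0" using mertens_mod_4 by blast
  have "(\<Sum>p\<in>primes_res 1 x. 1 / (real p - 1)) \<le> ln (ln x) / 2 + (c2 + 2)" if x: "x \<ge> 2" for x :: real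
  proof -
    have "(\<Sum>p\<in>primes_res 1 x. 1 / (real p - 1)) \<le> (\<Sum>p\<in>primes_res 1 x. 1 / real p + 2 * (1 / real p ^ 2))"
    proof (rule sum_mono)
      fix p assume "p \<in> primes_res 1 x"
      then have p2: "real p \<ge> 2" using prime_ge_2_nat[of p] by (simp add: primes_res_def)
      have "1 / (a - 1) \<le> 1 / a + 2 * (1 / a ^ 2)" if a: "a \<ge> 2" for a :: real
      proof -
        have "a ^ 2 \<le> (a + 2) * (a - 1)" using a by (simp add: power2_eq_square algebra_simps)
        then show ?thesis using a by (simp add: field_simps power2_eq_square)
      qed
      from this[OF p2] show "1 / (real p - 1) \<le> 1 / real p + 2 * (1 / real p ^ 2)" .
    qed
    also have "\<dots> = recips (primes_res 1 x) + 2 * (\<Sum>p\<in>primes_res 1 x. 1 / real p ^ 2)"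
      by (simp add: sum.distrib sum_distrib_left)
    also have "(\<Sum>p\<in>primes_res 1 x. 1 / real p ^ 2) \<le> 1"
      by (intro sum_inverse_squares_le finite_primes_res) (auto simp: primes_res_def intro: prime_ge_2_nat)
    also have "recips (primes_res 1 x) \<le> ln (ln x) / 2 + c2" using c2[OF x, of 1] by auto
    finally show ?thesis by simp
  qed
  then show ?thesis using c20 by (intro exI[of _ "c2 + 2"]) auto
qed

text \<open>The bound j + 1 <= C L is used twice: it keeps the shift by \<open>c\<close> down to a
  factor exp(2 c C), and it exchanges j! for (j+1)! at the cost of the factor C L = 2 C (L/2).
  Without a linear bound on \<open>k\<close> neither loss would be constant.\<close>

lemma shifted_power_over_fact_le:
  fixes L c C :: real
  assumes L: "L \<ge> 1" and c: "c \<ge> 0" and C: "real (Suc j) \<le> C * L"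
  shows "(L / 2 + c) ^ j / fact j \<le> 2 * C * exp (2 * c * C) * ((L / 2) ^ Suc j / fact (Suc j))"
proof -
  have "L / 2 + c = (L / 2) * (1 + 2 * c / L)" using L by (simp add: field_simps)
  also have "\<dots> \<le> (L / 2) * exp (2 * c / L)" using L by (intro mult_left_mono exp_ge_add_one_self) auto
  finally have "(L / 2 + c) ^ j \<le> ((L / 2) * exp (2 * c / L)) ^ j" using L c by (intro power_mono) auto
  also have "\<dots> = (L / 2) ^ j * exp (real j * (2 * c / L))"
    by (simp only: power_mult_distrib exp_of_nat_mult)
  also have "\<dots> \<le> (L / 2) ^ j * exp (2 * c * C)"
  proof (intro mult_left_mono)
    have "real j * (2 * c) \<le> (C * L) * (2 * c)" using C c by (intro mult_right_mono) auto
    then have "real j * (2 * c / L) \<le> 2 * c * C" using L by (simp add: field_simps)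
    then show "exp (real j * (2 * c / L)) \<le> exp (2 * c * C)" by simp
  qed (use L in auto)
  finally have 1: "(L / 2 + c) ^ j \<le> (L / 2) ^ j * exp (2 * c * C)" .
  have "(L / 2) ^ j * real (Suc j) \<le> (L / 2) ^ j * (C * L)" using C L by (intro mult_left_mono) auto
  also have "\<dots> = 2 * C * (L / 2) ^ Suc j" by simp
  finally have 2: "(L / 2) ^ j * real (Suc j) \<le> 2 * C * (L / 2) ^ Suc j" .
  have "(L / 2 + c) ^ j / fact j \<le> (L / 2) ^ j * exp (2 * c * C) / fact j"
    using 1 by (intro divide_right_mono) auto
  also have "\<dots> = ((L / 2) ^ j * real (Suc j)) * exp (2 * c * C) / fact (Suc j)"
    unfolding fact_Suc by (simp add: field_simps del: of_nat_Suc)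
  also have "\<dots> \<le> (2 * C * (L / 2) ^ Suc j) * exp (2 * c * C) / fact (Suc j)"
    using 2 by (intro divide_right_mono mult_right_mono) auto
  also have "\<dots> = 2 * C * exp (2 * c * C) * ((L / 2) ^ Suc j / fact (Suc j))"
    by (simp only: times_divide_eq_right mult_ac)
  finally show ?thesis .
qed

text \<open>With w = x^(1/(24 C L)), the sixth power is y = x^(1/(4 C L)). Hence m <= x/y is exactly
  the range in which \<open>lattice_bound\<close> applies.\<close>

lemma good_bound:
  fixes l :: nat and C :: real
  assumes l: "l \<ge> 1" and C: "C \<ge> 1"
  shows "\<exists>K A x0. K > 0 \<and> A \<ge> 0 \<and> (\<forall>x\<ge>x0. \<forall>k. real k \<le> C * ln (ln x) \<longrightarrow>
    real (\<Sum>n\<in>good x (level (24 * C) x ^ 6) k. card (reps n) choose l)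
      \<le> K * (x * ln (ln x) powr A / sqrt (ln x) ^ (l + 1)) * ((2 ^ (l - 1) * ln (ln x)) ^ k / fact k))"
proof -
  have "24 * C \<ge> 1" using C by simp
  from lattice_bound[OF l this] obtain K A x1 where K: "K > 0" and A: "A \<ge> 0"
    and lat: "\<And>x m T. x \<ge> x1 \<Longrightarrow> m > 0 \<Longrightarrow> T \<in> forms m l \<Longrightarrow>
     real m \<le> x / level (24 * C) x ^ 6 \<Longrightarrow>
     real (card (lattice_pts x (level (24 * C) x) m T))
       \<le> K * (x / real m) * (ln (ln x) powr A / sqrt (ln x) ^ (l + 1))" by blast
  obtain c where c: "c \<ge> 0" "\<And>x. x \<ge> 2 \<Longrightarrow> (\<Sum>p\<in>primes_res 1 x. 1 / (real p - 1)) \<le> ln (ln x) / 2 + c"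
    using sum_inverse_primes_pred by blast
  obtain x2 :: real where x2: "x2 > 1" "\<forall>x\<ge>x2. ln (ln x) \<ge> 1"
    using eventually_ge_exp[OF eventually_ge_at_top[of 1]] by blast
  define K' where "K' = K * 2 ^ l * (3 / 2) * (2 * C * exp (2 * c * C))"
  have K': "K' > 0" using K C by (simp add: K'_def)
  have main: "real (\<Sum>n\<in>good x (level (24 * C) x ^ 6) k. card (reps n) choose l)
      \<le> K' * (x * ln (ln x) powr A / sqrt (ln x) ^ (l + 1)) * ((2 ^ (l - 1) * ln (ln x)) ^ k / fact k)"
    if x: "x \<ge> max (max x1 x2) 2" and k: "real k \<le> C * ln (ln x)" for x k
  proof -
    define L where "L = ln (ln x)"
    define w where "w = level (24 * C) x"
    define y where "y = w ^ 6"
    define Q where "Q = L powr A / sqrt (ln x) ^ (l + 1)"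
    have x': "x \<ge> x1" "x \<ge> 2" and L1: "L \<ge> 1" using x x2 by (auto simp: L_def)
    have "ln x > 0" using x' by simp
    then have Q0: "Q \<ge> 0" by (simp add: Q_def)
    show ?thesis
    proof (cases k)
      case 0
      then show ?thesis using K' x' Q0 unfolding 0 good_0 L_def Q_def by simp
    next
      case (Suc j)
      let ?M = "omega_fixed (primes_res 1 x) (nat \<lfloor>x / y\<rfloor>) j"
      have "1 / (24 * C * ln (ln x)) > 0" using C L1 by (simp add: L_def)
      then have w1: "w > 1" using x' unfolding w_def by simp
      then have wy: "w < y" "0 < y" unfolding y_def using power_strict_increasing[of 1 6 w] by auto
      have M: "m > 0" "real m \<le> x / y" "omega_star m = j" if "m \<in> ?M" for m
      proof -
        have "m \<le> nat \<lfloor>x / y\<rfloor>" using that by (simp add: omega_fixed_def)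
        then have "real m \<le> real (nat \<lfloor>x / y\<rfloor>)" by simp
        also have "\<dots> \<le> x / y" using x' wy by (simp add: of_nat_floor)
        finally show "real m \<le> x / y" .
        show "m > 0" "omega_star m = j" using that by (simp_all add: omega_fixed_def)
      qed
      have "real (\<Sum>n\<in>good x y k. card (reps n) choose l)
          \<le> real (\<Sum>m\<in>?M. \<Sum>T\<in>forms m l. card (lattice_pts x w m T))"
        unfolding Suc by (intro of_nat_mono sum_good_le wy l)
      also have "\<dots> = (\<Sum>m\<in>?M. \<Sum>T\<in>forms m l. real (card (lattice_pts x w m T)))" by simp
      also have "\<dots> \<le> (\<Sum>m\<in>?M. \<Sum>T\<in>forms m l. K * (x / real m) * Q)"
      proof (intro sum_mono)
        fix m T assume mT: "m \<in> ?M" "T \<in> forms m l"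
        show "real (card (lattice_pts x w m T)) \<le> K * (x / real m) * Q"
          using lat[OF x'(1) M(1)[OF mT(1)] mT(2)] M(2)[OF mT(1)] unfolding w_def y_def Q_def L_def by blast
      qed
      also have "\<dots> = (\<Sum>m\<in>?M. real (card (forms m l)) * (K * (x / real m) * Q))" by simp
      \<comment> \<open>As k = j + 1, the count 4 * 2^j of primitive representations of
        \<open>m\<close> becomes 2 * 2^k.\<close>
      also have "\<dots> \<le> (\<Sum>m\<in>?M. (2 * 2 ^ k) ^ l * (K * (x / real m) * Q))"
      proof (intro sum_mono mult_right_mono)
        fix m assume m: "m \<in> ?M"
        have "card (forms m l) \<le> (4 * 2 ^ j) ^ l" using card_forms_le[OF M(1)[OF m], of l] M(3)[OF m] by simp
        then have "real (card (forms m l)) \<le> real ((4 * 2 ^ j) ^ l)" by (rule of_nat_mono)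
        then show "real (card (forms m l)) \<le> (2 * 2 ^ k) ^ l" by (simp add: Suc)
        show "0 \<le> K * (x / real m) * Q" using K x' Q0 by simp
      qed
      also have "\<dots> = (2 * 2 ^ k) ^ l * K * x * Q * (\<Sum>m\<in>?M. 1 / real m)"
        by (simp add: sum_distrib_left mult_ac)
      also have "\<dots> \<le> (2 * 2 ^ k) ^ l * K * x * Q * (3 / 2 * (2 * C * exp (2 * c * C) * ((L / 2) ^ k / fact k)))"
      proof (intro mult_left_mono)
        have "(\<Sum>m\<in>?M. 1 / real m) \<le> 3 / 2 * (\<Sum>p\<in>primes_res 1 x. 1 / (real p - 1)) ^ j / fact j"
          by (intro sum_inverse_omega_fixed_le finite_primes_res) (simp add: primes_res_def)
        also have "\<dots> \<le> 3 / 2 * (L / 2 + c) ^ j / fact j"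
        proof (intro divide_right_mono mult_left_mono power_mono)
          show "(\<Sum>p\<in>primes_res 1 x. 1 / (real p - 1)) \<le> L / 2 + c" using c(2)[OF x'(2)] by (simp add: L_def)
          have "0 \<le> 1 / (real p - 1)" if "p \<in> primes_res 1 x" for p
            using that prime_ge_1_nat[of p] by (simp add: primes_res_def)
          then show "0 \<le> (\<Sum>p\<in>primes_res 1 x. 1 / (real p - 1))" by (rule sum_nonneg)
        qed auto
        also have "\<dots> = 3 / 2 * ((L / 2 + c) ^ j / fact j)" by simp
        also have "\<dots> \<le> 3 / 2 * (2 * C * exp (2 * c * C) * ((L / 2) ^ k / fact k))"
          using shifted_power_over_fact_le[OF L1 c(1), of j C] k unfolding Suc L_def
          by (intro mult_left_mono) auto
        finally show "(\<Sum>m\<in>?M. 1 / real m) \<le> 3 / 2 * (2 * C * exp (2 * c * C) * ((L / 2) ^ k / fact k))" .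
      qed (use K x' Q0 in simp)
      also have "\<dots> = K' * (x * Q) * (((2 ^ k) ^ l * (L / 2) ^ k) / fact k)"
        by (simp add: K'_def power_mult_distrib mult_ac)
      \<comment> \<open>One of the \<open>l\<close> factors 2^k cancels the halves that come from
        the restriction to primes 1 mod 4.\<close>
      also have "(2 ^ k) ^ l * (L / 2) ^ k = (2 ^ (l - 1) * L) ^ k"
      proof -
        obtain h where h: "l = Suc h" using l by (cases l) auto
        have "(2 ^ k) ^ l = (2 ^ h) ^ k * (2::real) ^ k"
          unfolding h power_mult[symmetric] power_add[symmetric] by (simp add: algebra_simps)
        then show ?thesis unfolding h by (simp add: power_mult_distrib power_divide)
      qed
      finally show ?thesis unfolding y_def w_def Q_def L_def by simp
    qed
  qed
  show ?thesis
  proof (rule exI[of _ K'], rule exI[of _ A], rule exI[of _ "max (max x1 x2) 2"], intro conjI allI impI)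
    show "K' > 0" "A \<ge> 0" by (rule K', rule A)
  qed (rule main)
qed

text \<open>If all odd prime powers exactly dividing \<open>n\<close> are at most \<open>y\<close>,
  then \<open>n\<close> is small. Otherwise one of them, q^e, exceeds \<open>y\<close>; e = 1 would
  make \<open>n\<close> good, so e >= 2 and q^(e div 2) is the base of a large square
  divisor.\<close>

lemma not_good_cases:
  assumes n: "n > 0" "real n \<le> x" "omega_star n = k" "n \<notin> good x y k" "reps n \<noteq> {}"
    and D: "D > 0" "D ^ 3 \<le> y" and y: "2 * y ^ k \<le> z"
  shows "real n \<le> z \<or> (\<exists>d. real d \<ge> D \<and> d\<^sup>2 dvd n)"
proof (cases "\<forall>q. prime q \<longrightarrow> odd q \<longrightarrow> q dvd n \<longrightarrow> real (q ^ multiplicity q n) \<le> y")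
  case True
  obtain a b where "(a, b) \<in> reps n" using n(5) by auto
  then have "\<not> 4 dvd n" using reps_prim_reps prim_reps_not_4_dvd by blast
  then have "real n \<le> 2 * y ^ omega_star n" using True n(1) by (intro le_twice_power_omega_star) auto
  then show ?thesis using n(3) y by simp
next
  case False
  then obtain q where q: "prime q" "odd q" "q dvd n" and big: "real (q ^ multiplicity q n) > y" by auto
  define e where "e = multiplicity q n"
  have qn: "q ^ e dvd n" by (simp add: e_def multiplicity_dvd)
  have e2: "e \<ge> 2"
  proof (rule ccontr)
    assume "\<not> e \<ge> 2"
    then have e: "e \<le> 1" by simp
    have "\<not> q\<^sup>2 dvd n"
    proof
      assume "q\<^sup>2 dvd n"
      then have "2 \<le> e" unfolding e_def using n(1) q(1) by (intro multiplicity_geI) auto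
      then show False using e by simp
    qed
    moreover have "y \<le> real q"
    proof -
      have "q ^ e \<le> q ^ 1" using e q(1) prime_ge_1_nat by (intro power_increasing) auto
      then have "real (q ^ e) \<le> real (q ^ 1)" by (rule of_nat_mono)
      then show ?thesis using big unfolding e_def power_one_right by linarith
    qed
    ultimately have "n \<in> good x y k" using n q by (auto simp: good_def)
    then show False using n by simp
  qed
  define d where "d = q ^ (e div 2)"
  have "d\<^sup>2 = q ^ (e div 2 * 2)" by (simp only: d_def power_mult)
  also have "\<dots> dvd q ^ e" by (intro le_imp_power_dvd) simp
  finally have dn: "d\<^sup>2 dvd n" using qn dvd_trans by blast
  \<comment> \<open>For e >= 2, three times e div 2 is at least \<open>e\<close>, with equality at e
    = 3; this is why \<open>D\<close> is compared with the cube root of \<open>y\<close>.\<close>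
  have "q ^ e \<le> q ^ (e div 2 * 3)" using q(1) e2 prime_ge_1_nat by (intro power_increasing) auto
  also have "\<dots> = d ^ 3" by (simp only: d_def power_mult)
  finally have "real (q ^ e) \<le> real (d ^ 3)" by (simp only: of_nat_le_iff)
  then have "D ^ 3 \<le> real d ^ 3" using big D(2) by (simp add: e_def)
  then have "D \<le> real d" using D(1) by (simp add: power_mono_iff)
  then show ?thesis using dn by blast
qed

text \<open>The remaining \<open>n\<close> number at most a constant times x exp(-e^L/(12 C L)).
  This saving beats every fixed power of ln x, so the trivial bound for the number of
  representations suffices.\<close>

lemma not_good_bound:
  fixes l :: nat and C :: real
  assumes l: "l \<ge> 1" and C: "C \<ge> 1"
  shows "\<exists>x0. \<forall>x\<ge>x0. \<forall>k. real k \<le> C * ln (ln x) \<longrightarrow>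
    real (\<Sum>n\<in>{n. n > 0 \<and> real n \<le> x \<and> omega_star n = k} - good x (level (24 * C) x ^ 6) k.
        card (reps n) choose l)
      \<le> (3 * 4 ^ l) * (x / sqrt (ln x) ^ (l + 1)) * ((2 ^ (l - 1) * ln (ln x)) ^ k / fact k)"
proof -
  \<comment> \<open>The power of ln x to be beaten: l + 1 covers the denominator, C^2 the smallest
    possible size of L^k/k!, and C l the trivial bound (2^k)^l <= exp(C l L).\<close>
  define G where "G = real l + 1 + C ^ 2 + C * real l"
  have ev: "\<forall>\<^sub>F L in at_top. L \<ge> 1 \<and> L \<ge> 4 \<and> 12 * C * G * L ^ 2 \<le> exp L"
    by (intro eventually_conj eventually_ge_at_top eventually_quadratic_le_exp)
  obtain x0 where x0: "x0 > 1" "\<forall>x\<ge>x0. ln (ln x) \<ge> 1 \<and> ln (ln x) \<ge> 4 \<and> 12 * C * G * ln (ln x) ^ 2 \<le> exp (ln (ln x))"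
    using eventually_ge_exp[OF ev] by blast
  have main: "real (\<Sum>n\<in>{n. n > 0 \<and> real n \<le> x \<and> omega_star n = k} - good x (level (24 * C) x ^ 6) k.
        card (reps n) choose l)
      \<le> (3 * 4 ^ l) * (x / sqrt (ln x) ^ (l + 1)) * ((2 ^ (l - 1) * ln (ln x)) ^ k / fact k)"
    if x: "x \<ge> x0" and k: "real k \<le> C * ln (ln x)" for x k
  proof -
    define L where "L = ln (ln x)"
    define w where "w = level (24 * C) x"
    define y where "y = w ^ 6"
    define D where "D = w ^ 2"
    have x1: "x > 1" using x x0(1) by simp
    have L1: "L \<ge> 1" "L \<ge> 4" and LG: "12 * C * G * L ^ 2 \<le> exp L" using x0(2) x unfolding L_def by auto
    have lx: "ln x = exp L" using x1 by (simp add: L_def)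
    have xe: "x = exp (exp L)" using x1 lx by (metis exp_ln less_trans zero_less_one)
    have kL: "real k \<le> C * L" using k by (simp add: L_def)
    have wexp: "w = exp (exp L / (24 * C * L))" using x1 lx by (simp add: powr_def w_def L_def)
    have w0: "w > 0" by (simp add: wexp)
    have Dexp: "D = exp (exp L / (12 * C * L))"
      using C L1 by (simp add: D_def wexp exp_of_nat_mult[symmetric] field_simps)
    have yexp: "y = exp (exp L / (4 * C * L))"
      using C L1 by (simp add: y_def wexp exp_of_nat_mult[symmetric] field_simps)
    have "y ^ k = exp (real k * (exp L / (4 * C * L)))" by (simp only: yexp exp_of_nat_mult)
    also have "\<dots> \<le> exp (exp L / 4)"
    proof -
      have "real k * (exp L / (4 * C * L)) \<le> (C * L) * (exp L / (4 * C * L))"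
        using kL C L1 by (intro mult_right_mono) auto
      also have "\<dots> = exp L / 4" using C L1 by simp
      finally show ?thesis by simp
    qed
    finally have yk: "y ^ k \<le> exp (exp L / 4)" .
    have eL: "exp L \<ge> 4" using exp_ge_add_one_self[of L] L1 by linarith
    have "2 \<le> exp (1::real)" using exp_ge_add_one_self[of 1] by simp
    also have "\<dots> \<le> exp (exp L / 4)" using eL by simp
    \<comment> \<open>The second factor absorbs the 2; the result is the square root of
      \<open>x\<close>.\<close>
    finally have "2 * y ^ k \<le> exp (exp L / 4) * exp (exp L / 4)"
      using yk w0 by (intro mult_mono) (auto simp: y_def)
    then have yz: "2 * y ^ k \<le> exp (exp L / 2)" by (simp add: exp_add[symmetric])
    have Dy: "D > 0" "D ^ 3 \<le> y" using w0 by (auto simp: D_def y_def power_mult[symmetric])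
    let ?N = "{n. n > 0 \<and> real n \<le> x \<and> omega_star n = k}"
    let ?B1 = "{n::nat. n > 0 \<and> real n \<le> exp (exp L / 2)}"
    let ?B2 = "{n::nat. n > 0 \<and> real n \<le> x \<and> (\<exists>d::nat. real d \<ge> D \<and> d\<^sup>2 dvd n)}"
    have finN: "finite ?N" by (rule finite_nat_le)
    have B1: "?B1 \<subseteq> {1..nat \<lfloor>exp (exp L / 2)\<rfloor>}" by (auto simp: le_nat_floor Suc_le_eq)
    have finB1: "finite ?B1" by (rule finite_subset[OF B1]) simp
    have finB2: "finite ?B2" by (rule finite_nat_le)
    have "(\<Sum>n\<in>?N - good x y k. card (reps n) choose l)
        = (\<Sum>n\<in>{n\<in>?N - good x y k. reps n \<noteq> {}}. card (reps n) choose l)"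
      by (rule sum.mono_neutral_right) (use finN l in \<open>auto simp: binomial_eq_0_iff\<close>)
    also have "\<dots> \<le> (\<Sum>n\<in>{n\<in>?N - good x y k. reps n \<noteq> {}}. (4 * 2 ^ k) ^ l)"
    proof (rule sum_mono)
      fix n assume "n \<in> {n\<in>?N - good x y k. reps n \<noteq> {}}"
      then have "n > 0" "omega_star n = k" by auto
      then show "card (reps n) choose l \<le> (4 * 2 ^ k) ^ l"
        using card_reps_le(2)[of n] by (intro binomial_le_power) simp
    qed
    also have "\<dots> = card {n\<in>?N - good x y k. reps n \<noteq> {}} * (4 * 2 ^ k) ^ l" by simp
    also have "\<dots> \<le> (card ?B1 + card ?B2) * (4 * 2 ^ k) ^ l"
    proof (rule mult_right_mono)
      have "{n\<in>?N - good x y k. reps n \<noteq> {}} \<subseteq> ?B1 \<union> ?B2"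
        using not_good_cases[OF _ _ _ _ _ Dy yz] by blast
      then have "card {n\<in>?N - good x y k. reps n \<noteq> {}} \<le> card (?B1 \<union> ?B2)"
        using finB1 finB2 by (intro card_mono) auto
      also have "\<dots> \<le> card ?B1 + card ?B2" by (rule card_Un_le)
      finally show "card {n\<in>?N - good x y k. reps n \<noteq> {}} \<le> card ?B1 + card ?B2" .
    qed simp
    finally have "real (\<Sum>n\<in>?N - good x y k. card (reps n) choose l)
        \<le> real ((card ?B1 + card ?B2) * (4 * 2 ^ k) ^ l)" by (rule of_nat_mono)
    also have "\<dots> = (real (card ?B1) + real (card ?B2)) * (4 * 2 ^ k) ^ l" by simp
    also have "\<dots> \<le> (x * exp (- (G * L)) + 2 * (x * exp (- (G * L)))) * (4 ^ l * exp (C * real l * L))"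
    proof (intro mult_mono add_mono)
      have G0: "G \<ge> 0" using C by (simp add: G_def)
      have GL: "G * L \<le> exp L / (12 * C * L)"
        using LG C L1 by (simp add: field_simps power2_eq_square)
      have "card ?B1 \<le> card {1..nat \<lfloor>exp (exp L / 2)\<rfloor>}" by (intro card_mono B1) simp
      then have "real (card ?B1) \<le> real (card {1..nat \<lfloor>exp (exp L / 2)\<rfloor>})" by (rule of_nat_mono)
      also have "\<dots> = real (nat \<lfloor>exp (exp L / 2)\<rfloor>)" by simp
      also have "\<dots> \<le> exp (exp L / 2)" by simp
      also have "\<dots> \<le> exp (exp L - G * L)"
      proof -
        have "1 * 1 \<le> C * L" using C L1 by (intro mult_mono) auto
        then have "exp L / (12 * C * L) \<le> exp L / 2"
          by (intro divide_left_mono) auto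
        then have "G * L \<le> exp L / 2" using GL by linarith
        then show ?thesis by simp
      qed
      also have "\<dots> = x * exp (- (G * L))" unfolding xe exp_add[symmetric] by simp
      finally show "real (card ?B1) \<le> x * exp (- (G * L))" .
      have "real (card ?B2) \<le> 2 * x / D" using x1 Dy by (intro card_square_divisor_le) auto
      also have "\<dots> = 2 * (x * exp (- (exp L / (12 * C * L))))"
        by (simp only: Dexp exp_minus divide_inverse mult.assoc)
      also have "\<dots> \<le> 2 * (x * exp (- (G * L)))"
        using GL x1 by (intro mult_left_mono) auto
      finally show "real (card ?B2) \<le> 2 * (x * exp (- (G * L)))" .
      have "(2::real) \<le> exp 1" using exp_ge_add_one_self[of 1] by simp
      then have "(2::real) ^ k \<le> exp 1 ^ k" by (intro power_mono) auto
      also have "\<dots> = exp (real k)" by (simp add: exp_of_nat_mult[symmetric])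
      also have "\<dots> \<le> exp (C * L)" using kL by simp
      finally have "((2::real) ^ k) ^ l \<le> exp (C * L) ^ l" by (intro power_mono) auto
      also have "\<dots> = exp (C * real l * L)" by (simp add: exp_of_nat_mult[symmetric] mult_ac)
      finally show "(4 * 2 ^ k) ^ l \<le> 4 ^ l * exp (C * real l * L)"
        by (simp add: power_mult_distrib)
    qed (use x1 in auto)
    also have "\<dots> = (3 * 4 ^ l) * x * (exp (- (G * L)) * exp (C * real l * L))" by (simp add: algebra_simps)
    also have "exp (- (G * L)) * exp (C * real l * L) = exp (- ((real l + 1) * L)) * exp (- (C ^ 2 * L))"
      unfolding exp_add[symmetric] by (simp add: G_def algebra_simps)
    also have "(3 * 4 ^ l) * x * \<dots> \<le> (3 * 4 ^ l) * x * ((1 / sqrt (ln x) ^ (l + 1)) * ((2 ^ (l - 1) * L) ^ k / fact k))"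
    proof (intro mult_left_mono mult_mono)
      have "exp (- ((real l + 1) * L)) \<le> exp (- (real (l + 1) * L / 2))"
      proof -
        have e: "real l + 1 = real (l + 1)" by simp
        have "t / 2 \<le> t" if "0 \<le> t" for t :: real using that by simp
        then have "real (l + 1) * L / 2 \<le> real (l + 1) * L" using L1 by simp
        then show ?thesis unfolding e exp_le_cancel_iff neg_le_iff_le .
      qed
      also have "\<dots> = 1 / sqrt (ln x) ^ (l + 1)"
        unfolding lx sqrt_exp_power by (simp only: exp_minus inverse_eq_divide)
      finally show "exp (- ((real l + 1) * L)) \<le> 1 / sqrt (ln x) ^ (l + 1)" .
      \<comment> \<open>From k <= C L and ln C <= C, k! is at most (C L)^k <= exp(C^2 L) L^k, so
        L^k/k! is at least a fixed negative power of ln x.\<close>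
      have "fact k \<le> real k ^ k" using fact_le_power[of k, where 'a = real] by simp
      also have "\<dots> \<le> (C * L) ^ k" using kL by (intro power_mono) auto
      also have "\<dots> = C ^ k * L ^ k" by (simp add: power_mult_distrib)
      also have "\<dots> \<le> exp (C ^ 2 * L) * L ^ k"
      proof (intro mult_right_mono)
        have "C ^ k = exp (real k * ln C)" using C by (simp add: exp_of_nat_mult)
        also have "\<dots> \<le> exp (C * L * C)"
        proof -
          have "ln C \<le> C" using ln_le_minus_one[of C] C by simp
          then have "real k * ln C \<le> (C * L) * C" using kL C L1 by (intro mult_mono) auto
          then show ?thesis by simp
        qed
        finally show "C ^ k \<le> exp (C ^ 2 * L)" by (simp add: power2_eq_square mult_ac)
      qed (use L1 in auto)
      finally have "fact k \<le> exp (C ^ 2 * L) * L ^ k" .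
      then have "exp (- (C ^ 2 * L)) \<le> L ^ k / fact k"
        by (simp add: exp_minus field_simps)
      also have "\<dots> \<le> (2 ^ (l - 1) * L) ^ k / fact k"
      proof (intro divide_right_mono power_mono)
        have "1 * L \<le> 2 ^ (l - 1) * L" using L1 by (intro mult_right_mono) auto
        then show "L \<le> 2 ^ (l - 1) * L" by simp
      qed (use L1 in auto)
      finally show "exp (- (C ^ 2 * L)) \<le> (2 ^ (l - 1) * L) ^ k / fact k" .
    qed (use x1 in auto)
    finally show ?thesis unfolding y_def w_def L_def by (simp add: mult_ac)
  qed
  then show ?thesis by blast
qed

theorem theorem7p3p1:
  fixes l :: nat and C :: real
  assumes "l \<ge> 1" and "C > 0"
  shows "\<exists>K A x0 :: real. K > 0 \<and> A > 0 \<and> x0 > 0 \<and>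
    (\<forall>x \<ge> x0. \<forall>k :: nat. real k \<le> C * ln (ln x) \<longrightarrow>
      (\<Sum>n | n > 0 \<and> real n \<le> x \<and> omega_star n = k.
          real (r_star sums_two_squares n choose l))
        \<le> K * (x * ln (ln x) powr A / sqrt (ln x) ^ (l + 1))
            * ((2 ^ (l - 1) * ln (ln x)) ^ k / fact k))"
proof -
  \<comment> \<open>The estimates above assume a constant of at least 1; enlarging it only admits
    more \<open>k\<close>.\<close>
  define C' where "C' = max C 1"
  have C': "C' \<ge> 1" "C' \<ge> C" by (auto simp: C'_def)
  obtain K A x1 where K: "K > 0" and A: "A \<ge> 0" and good: "\<And>x k. x \<ge> x1 \<Longrightarrow> real k \<le> C' * ln (ln x) \<Longrightarrow>
    real (\<Sum>n\<in>good x (level (24 * C') x ^ 6) k. card (reps n) choose l)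
      \<le> K * (x * ln (ln x) powr A / sqrt (ln x) ^ (l + 1)) * ((2 ^ (l - 1) * ln (ln x)) ^ k / fact k)"
    using good_bound[OF assms(1) C'(1)] by blast
  obtain x2 where ngood: "\<And>x k. x \<ge> x2 \<Longrightarrow> real k \<le> C' * ln (ln x) \<Longrightarrow>
    real (\<Sum>n\<in>{n. n > 0 \<and> real n \<le> x \<and> omega_star n = k} - good x (level (24 * C') x ^ 6) k.
        card (reps n) choose l)
      \<le> (3 * 4 ^ l) * (x / sqrt (ln x) ^ (l + 1)) * ((2 ^ (l - 1) * ln (ln x)) ^ k / fact k)"
    using not_good_bound[OF assms(1) C'(1)] by blast
  obtain x3 :: real where x3: "x3 > 1" "\<forall>x\<ge>x3. ln (ln x) \<ge> 1"
    using eventually_ge_exp[OF eventually_ge_at_top[of 1]] by blast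
  \<comment> \<open>The exponent A + 1 is positive, as required, and since ln ln x >= 1 it dominates
    both the power \<open>A\<close> and the contribution that carries no power of ln ln x.\<close>
  have main: "(\<Sum>n | n > 0 \<and> real n \<le> x \<and> omega_star n = k. real (r_star sums_two_squares n choose l))
        \<le> (K + 3 * 4 ^ l) * (x * ln (ln x) powr (A + 1) / sqrt (ln x) ^ (l + 1))
            * ((2 ^ (l - 1) * ln (ln x)) ^ k / fact k)"
    if x: "x \<ge> max (max x1 x2) x3" and k: "real k \<le> C * ln (ln x)" for x k
  proof -
    define L where "L = ln (ln x)"
    define y where "y = level (24 * C') x ^ 6"
    define F where "F = (2 ^ (l - 1) * L) ^ k / fact k"
    define s where "s = sqrt (ln x) ^ (l + 1)"
    have x': "x \<ge> x1" "x \<ge> x2" "x > 1" using x x3(1) by auto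
    have L1: "L \<ge> 1" using x x3(2) by (simp add: L_def)
    have kC: "real k \<le> C' * ln (ln x)"
      using k C'(2) L1 mult_right_mono[of C C' L] unfolding L_def by linarith
    have s0: "s > 0" using x' by (simp add: s_def)
    have F0: "F \<ge> 0" using L1 by (simp add: F_def)
    let ?N = "{n. n > 0 \<and> real n \<le> x \<and> omega_star n = k}"
    have fin: "finite ?N" by (rule finite_nat_le)
    have sub: "good x y k \<subseteq> ?N" by (auto simp: good_def)
    have "(\<Sum>n\<in>?N. real (r_star sums_two_squares n choose l))
        = real (\<Sum>n\<in>?N. card (reps n) choose l)" by (simp add: r_star_eq_card_reps)
    also have "(\<Sum>n\<in>?N. card (reps n) choose l)
        = (\<Sum>n\<in>?N - good x y k. card (reps n) choose l) + (\<Sum>n\<in>good x y k. card (reps n) choose l)"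
      by (rule sum.subset_diff[OF sub fin])
    also have "real \<dots> = real (\<Sum>n\<in>?N - good x y k. card (reps n) choose l) + real (\<Sum>n\<in>good x y k. card (reps n) choose l)"
      by (rule of_nat_add)
    also have "\<dots> \<le> (3 * 4 ^ l) * (x / s) * F + K * (x * L powr A / s) * F"
      using good[OF x'(1) kC] ngood[OF x'(2) kC] unfolding y_def L_def F_def s_def by linarith
    also have "\<dots> \<le> (3 * 4 ^ l) * (x * L powr (A + 1) / s) * F + K * (x * L powr (A + 1) / s) * F"
    proof (intro add_mono mult_right_mono mult_left_mono)
      have "1 \<le> L powr (A + 1)" using L1 A by (intro ge_one_powr_ge_zero) auto
      then have "x * 1 \<le> x * L powr (A + 1)" using x' by (intro mult_left_mono) auto
      then show "x / s \<le> x * L powr (A + 1) / s" using s0 by (intro divide_right_mono) auto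
      have "L powr A \<le> L powr (A + 1)" using L1 by (intro powr_mono) auto
      then show "x * L powr A / s \<le> x * L powr (A + 1) / s"
        using s0 x' by (intro divide_right_mono mult_left_mono) auto
    qed (use K F0 in auto)
    also have "\<dots> = (K + 3 * 4 ^ l) * (x * L powr (A + 1) / s) * F" by (simp add: algebra_simps)
    finally show ?thesis unfolding L_def F_def s_def .
  qed
  show ?thesis
  proof (rule exI[of _ "K + 3 * 4 ^ l"], rule exI[of _ "A + 1"], rule exI[of _ "max (max x1 x2) x3"],
      intro conjI allI impI)
    show "K + 3 * 4 ^ l > 0" using K by (simp add: add_pos_pos)
    show "A + 1 > 0" using A by simp
    show "max (max x1 x2) x3 > 0" using x3(1) by simp
  qed (rule main)
qed

end
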